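(* Let $\Gamma$ be a simply laced Dynkin diagram (a finite simple graph) with nodes ordered $a_1,\dots,a_n$, let $P$ be a finite connected $\Gamma$-colored minuscule poset, and let $m\ge1$. Let $\lambda=\omega_j$, where $a_j$ is the color of the unique maximal element of $P$. Then $\lambda$ is a minuscule weight and $\mathrm{span}_{\mathbb{C}}(\mathcal{V}^m_D)$ is isomorphic to the irreducible $\mathfrak{g}$-representation $V(m\lambda)$ of highest weight $m\lambda$. For any fixed linear extension of $P$, the downward $m$-stackwise vectors form a basis of $\mathrm{span}_{\mathbb{C}}(\mathcal{V}^m_D)$; they are indexed by the $m$-flags of order filters of $P$, which are in natural one-to-one correspondence with $m$-multichains in the weight lattice (weight poset) of $V(\lambda)$. Every element of $\mathcal{V}^m_D$ can be expanded as an integer linear combination of the downward $m$-stackwise vectors.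
   Context: Colored posets: $P$ is a finite poset with a surjective coloring $\kappa:P\to\Gamma$; $a\sim b$ denotes adjacency in $\Gamma$; $x\to y$ means $y$ covers $x$ (neighbors). $P$ is $\Gamma$-colored minuscule if: (EC) elements of equal color are comparable; (NA) neighbors have adjacent colors; (AC) elements with adjacent colors are comparable; (ICE2) if $x<y$ both have color $a$ with no element of color $a$ strictly between them, then $(x,y)$ contains exactly two elements whose colors are adjacent to $a$; (UCB1) if $x$ is maximal among elements of color $a$, at most one element greater than $x$ has color adjacent to $a$; (LCB1) dually, if $x$ is minimal among elements of color $a$, at most one element less than $x$ has color adjacent to $a$. Such $P$ has a unique maximal element and $\Gamma$ is of finite type; $\mathfrak{g}$ is the simple(semisimple) Lie algebra with Cartan matrix $\theta_{ii}=2$, $\theta_{ik}=-1$ if $a_i\sim a_k$, $0$ otherwise, Chevalley generators $x_i,y_i,h_i$, fundamental weights $\omega_i$ ($\omega_i(h_k)=\delta_{ik}$). Representation: $V$ is the complex vector space with basis the order ideals $I$ of $P$. $X_i.I$ is $I\cup\{x\}$ summed over minimal elements $x$ of $P-I$ of color $a_i$; $Y_i.I$ is $I-\{x\}$ summed over maximal elements $x$ of $I$ of color $a_i$; $H_i.I=\mu_i(I)I$ where $\mu_i(P)=\delta_{ij}$ and, if $I'=I\cup\{y\}$ with $\kappa(y)=a_k$, $\mu_i(I)=\mu_i(I')-2\delta_{ik}+[a_i\sim a_k]$. With $x_i\mapsto X_i$, $y_i\mapsto Y_i$, $h_i\mapsto H_i$, $V$ is a $\mathfrak{g}$-module isomorphic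 to $V(\lambda)$, the ideal $I$ having weight $\sum_i\mu_i(I)\omega_i$; the weight poset of $V(\lambda)$ is isomorphic to the lattice of order ideals of $P$ under inclusion. The symmetric power $S^mV$ has basis the $m$-multisets of ideals $\{I_1,\dots,I_m\}$, with $z.\{I_1,\dots,I_m\}=\sum_k\{I_1,\dots,z.I_k,\dots,I_m\}$. Downward structures: $\langle a^k\rangle_D=\frac1{k!}Y_a^k$ and $\langle b_k^{n_k},\dots,b_1^{n_1}\rangle_D=\langle b_k^{n_k}\rangle_D\circ\cdots\circ\langle b_1^{n_1}\rangle_D$. $\mathcal{V}^m_D$ is the set of all vectors $\langle b_k^{n_k},\dots,b_1^{n_1}\rangle_D.\{P,\dots,P\}$ for colors $b_i$ and integers $n_i\ge0$. Fix a linear extension of $P$ and list $P$ in decreasing order $y_1>y_2>\dots>y_p$ (a linear extension of the dual poset), $b_t=\kappa(y_t)$. For an order-preserving $\varphi:P\to\{0,\dots,m\}$ (equivalently an $m$-flag of order filters $F_1\supseteq\cdots\supseteq F_m$, $F_k=\{y:\varphi(y)\ge k\}$), the downward $m$-stackwise vector is $\langle b_p^{\varphi(y_p)},\dots,b_1^{\varphi(y_1)}\rangle_D.\{P,\dots,P\}$. *)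

theory Defs
  imports Complex_Main "HOL-Library.Multiset" "HOL-Library.Poly_Mapping"
begin

section \<open>Colored minuscule posets\<close>

text \<open>
  The node set of the graph is the finite type \<open>'c\<close>, its edges are given by \<open>adj\<close>;
  the finite poset \<open>P\<close> is a finite type \<open>'p\<close> of class \<^class>\<open>order\<close>.
\<close>

definition simple_graph :: "('c \<Rightarrow> 'c \<Rightarrow> bool) \<Rightarrow> bool" where
  "simple_graph adj \<longleftrightarrow> (\<forall>a. \<not> adj a a) \<and> (\<forall>a b. adj a b \<longrightarrow> adj b a)"

definition covered_by :: "'p::order \<Rightarrow> 'p \<Rightarrow> bool" where
  "covered_by x y \<longleftrightarrow> x < y \<and> \<not> (\<exists>z. x < z \<and> z < y)"

definition connected_poset :: "'p::order itself \<Rightarrow> bool" where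
  "connected_poset _ \<longleftrightarrow>
     (\<forall>x y :: 'p. (x, y) \<in> {(u, v). covered_by u v \<or> covered_by v u}\<^sup>*)"

definition colored_minuscule ::
  "('c \<Rightarrow> 'c \<Rightarrow> bool) \<Rightarrow> ('p::{finite, order} \<Rightarrow> 'c) \<Rightarrow> bool" where
  "colored_minuscule adj \<kappa> \<longleftrightarrow>
     surj \<kappa> \<and>
     \<comment> \<open>EC\<close>
     (\<forall>x y. \<kappa> x = \<kappa> y \<longrightarrow> x \<le> y \<or> y \<le> x) \<and>
     \<comment> \<open>NA\<close>
     (\<forall>x y. covered_by x y \<longrightarrow> adj (\<kappa> x) (\<kappa> y)) \<and>
     \<comment> \<open>AC\<close>
     (\<forall>x y. adj (\<kappa> x) (\<kappa> y) \<longrightarrow> x \<le> y \<or> y \<le> x) \<and>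
     \<comment> \<open>ICE2\<close>
     (\<forall>x y. x < y \<and> \<kappa> x = \<kappa> y \<and> \<not> (\<exists>z. x < z \<and> z < y \<and> \<kappa> z = \<kappa> x) \<longrightarrow>
        card {z. x < z \<and> z < y \<and> adj (\<kappa> z) (\<kappa> x)} = 2) \<and>
     \<comment> \<open>UCB1\<close>
     (\<forall>x. \<not> (\<exists>z. x < z \<and> \<kappa> z = \<kappa> x) \<longrightarrow> card {z. x < z \<and> adj (\<kappa> z) (\<kappa> x)} \<le> 1) \<and>
     \<comment> \<open>LCB1\<close>
     (\<forall>x. \<not> (\<exists>z. z < x \<and> \<kappa> z = \<kappa> x) \<longrightarrow> card {z. z < x \<and> adj (\<kappa> z) (\<kappa> x)} \<le> 1)"

definition order_ideals :: "'p::order set set" where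
  "order_ideals = {I. \<forall>x\<in>I. \<forall>y. y \<le> x \<longrightarrow> y \<in> I}"

definition order_filters :: "'p::order set set" where
  "order_filters = {F. \<forall>x\<in>F. \<forall>y. x \<le> y \<longrightarrow> y \<in> F}"


section \<open>The Lie algebra of a simply laced Cartan matrix\<close>

definition cartan :: "('c \<Rightarrow> 'c \<Rightarrow> bool) \<Rightarrow> 'c \<Rightarrow> 'c \<Rightarrow> int" where
  "cartan adj i k = (if i = k then 2 else if adj i k then -1 else 0)"

record ('c, 'g) chev_alg =
  lscale :: "complex \<Rightarrow> 'g \<Rightarrow> 'g"
  brk :: "'g \<Rightarrow> 'g \<Rightarrow> 'g"
  gx :: "'c \<Rightarrow> 'g"
  gy :: "'c \<Rightarrow> 'g"
  gh :: "'c \<Rightarrow> 'g"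

definition lie_algebra :: "('c, 'g::ab_group_add) chev_alg \<Rightarrow> bool" where
  "lie_algebra G \<longleftrightarrow>
     vector_space (lscale G) \<and>
     (\<forall>u v w. brk G (u + v) w = brk G u w + brk G v w) \<and>
     (\<forall>u v w. brk G w (u + v) = brk G w u + brk G w v) \<and>
     (\<forall>c u w. brk G (lscale G c u) w = lscale G c (brk G u w)) \<and>
     (\<forall>c u w. brk G w (lscale G c u) = lscale G c (brk G w u)) \<and>
     (\<forall>u. brk G u u = 0) \<and>
     (\<forall>u v w. brk G u (brk G v w) + brk G v (brk G w u) + brk G w (brk G u v) = 0)"

text \<open>
  Formal Lie expressions in the Chevalley generators, and the smallest congruence on them that
  contains the axioms of a complex Lie algebra together with the Chevalley--Serre relations.
  The quotient is the Lie algebra presented by these generators and relations.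
\<close>

datatype 'c lie_term =
    TX 'c | TY 'c | TH 'c
  | TZero
  | TAdd "'c lie_term" "'c lie_term"
  | TScale complex "'c lie_term"
  | TBrk "'c lie_term" "'c lie_term"

inductive serre_eq :: "('c \<Rightarrow> 'c \<Rightarrow> bool) \<Rightarrow> 'c lie_term \<Rightarrow> 'c lie_term \<Rightarrow> bool"
  for adj :: "'c \<Rightarrow> 'c \<Rightarrow> bool" where
  refl: "serre_eq adj s s"
| sym: "serre_eq adj s t \<Longrightarrow> serre_eq adj t s"
| trans: "serre_eq adj s t \<Longrightarrow> serre_eq adj t u \<Longrightarrow> serre_eq adj s u"
| cong_add: "serre_eq adj s s' \<Longrightarrow> serre_eq adj t t' \<Longrightarrow> serre_eq adj (TAdd s t) (TAdd s' t')"
| cong_scale: "serre_eq adj s s' \<Longrightarrow> serre_eq adj (TScale c s) (TScale c s')"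
| cong_brk: "serre_eq adj s s' \<Longrightarrow> serre_eq adj t t' \<Longrightarrow> serre_eq adj (TBrk s t) (TBrk s' t')"
| add_assoc: "serre_eq adj (TAdd (TAdd s t) u) (TAdd s (TAdd t u))"
| add_comm: "serre_eq adj (TAdd s t) (TAdd t s)"
| add_zero: "serre_eq adj (TAdd TZero s) s"
| add_neg: "serre_eq adj (TAdd (TScale (-1) s) s) TZero"
| scale_add: "serre_eq adj (TScale c (TAdd s t)) (TAdd (TScale c s) (TScale c t))"
| add_scale: "serre_eq adj (TScale (c + d) s) (TAdd (TScale c s) (TScale d s))"
| scale_scale: "serre_eq adj (TScale c (TScale d s)) (TScale (c * d) s)"
| scale_one: "serre_eq adj (TScale 1 s) s"
| brk_add_left: "serre_eq adj (TBrk (TAdd s t) u) (TAdd (TBrk s u) (TBrk t u))"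
| brk_add_right: "serre_eq adj (TBrk u (TAdd s t)) (TAdd (TBrk u s) (TBrk u t))"
| brk_scale_left: "serre_eq adj (TBrk (TScale c s) u) (TScale c (TBrk s u))"
| brk_scale_right: "serre_eq adj (TBrk u (TScale c s)) (TScale c (TBrk u s))"
| brk_self: "serre_eq adj (TBrk s s) TZero"
| jacobi: "serre_eq adj
    (TAdd (TAdd (TBrk s (TBrk t u)) (TBrk t (TBrk u s))) (TBrk u (TBrk s t))) TZero"
| rel_hh: "serre_eq adj (TBrk (TH i) (TH k)) TZero"
| rel_xy: "serre_eq adj (TBrk (TX i) (TY k)) (if i = k then TH i else TZero)"
| rel_hx: "serre_eq adj (TBrk (TH i) (TX k)) (TScale (of_int (cartan adj i k)) (TX k))"
| rel_hy: "serre_eq adj (TBrk (TH i) (TY k)) (TScale (- of_int (cartan adj i k)) (TY k))"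
| rel_xx: "i \<noteq> k \<Longrightarrow>
    serre_eq adj ((TBrk (TX i) ^^ nat (1 - cartan adj i k)) (TX k)) TZero"
| rel_yy: "i \<noteq> k \<Longrightarrow>
    serre_eq adj ((TBrk (TY i) ^^ nat (1 - cartan adj i k)) (TY k)) TZero"

fun term_val :: "('c, 'g::ab_group_add) chev_alg \<Rightarrow> 'c lie_term \<Rightarrow> 'g" where
  "term_val G (TX a) = gx G a"
| "term_val G (TY a) = gy G a"
| "term_val G (TH a) = gh G a"
| "term_val G TZero = 0"
| "term_val G (TAdd s t) = term_val G s + term_val G t"
| "term_val G (TScale c s) = lscale G c (term_val G s)"
| "term_val G (TBrk s t) = brk G (term_val G s) (term_val G t)"

definition cartan_lie_algebra ::
  "('c \<Rightarrow> 'c \<Rightarrow> bool) \<Rightarrow> ('c, 'g::ab_group_add) chev_alg \<Rightarrow> bool" where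
  "cartan_lie_algebra adj G \<longleftrightarrow>
     lie_algebra G \<and>
     surj (term_val G) \<and>
     (\<forall>s t. term_val G s = term_val G t \<longleftrightarrow> serre_eq adj s t)"


section \<open>Modules, weights and highest weights\<close>

text \<open>A module lives on a subspace \<open>car\<close> of an ambient complex vector space \<open>'v\<close>.\<close>

record ('g, 'v) gmod =
  car :: "'v set"
  mscale :: "complex \<Rightarrow> 'v \<Rightarrow> 'v"
  act :: "'g \<Rightarrow> 'v \<Rightarrow> 'v"

definition lie_module ::
  "('c, 'g::ab_group_add) chev_alg \<Rightarrow> ('g, 'v::ab_group_add) gmod \<Rightarrow> bool" where
  "lie_module G M \<longleftrightarrow>
     vector_space (mscale M) \<and>
     module.subspace (mscale M) (car M) \<and>
     (\<forall>z. \<forall>v\<in>car M. act M z v \<in> car M) \<and>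
     (\<forall>z. \<forall>u\<in>car M. \<forall>v\<in>car M. act M z (u + v) = act M z u + act M z v) \<and>
     (\<forall>z c. \<forall>v\<in>car M. act M z (mscale M c v) = mscale M c (act M z v)) \<and>
     (\<forall>z w. \<forall>v\<in>car M. act M (z + w) v = act M z v + act M w v) \<and>
     (\<forall>c z. \<forall>v\<in>car M. act M (lscale G c z) v = mscale M c (act M z v)) \<and>
     (\<forall>z w. \<forall>v\<in>car M. act M (brk G z w) v = act M z (act M w v) - act M w (act M z v))"

definition irreducible_module ::
  "('c, 'g::ab_group_add) chev_alg \<Rightarrow> ('g, 'v::ab_group_add) gmod \<Rightarrow> bool" where
  "irreducible_module G M \<longleftrightarrow>
     lie_module G M \<and> car M \<noteq> {0} \<and>
     (\<forall>U. U \<subseteq> car M \<and> module.subspace (mscale M) U \<and> (\<forall>z. \<forall>v\<in>U. act M z v \<in> U) \<longrightarrow>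
          U = {0} \<or> U = car M)"

definition module_iso ::
  "('g, 'v::ab_group_add) gmod \<Rightarrow> ('g, 'w::ab_group_add) gmod \<Rightarrow> bool" where
  "module_iso M N \<longleftrightarrow>
     (\<exists>f. bij_betw f (car M) (car N) \<and>
          (\<forall>u\<in>car M. \<forall>v\<in>car M. f (u + v) = f u + f v) \<and>
          (\<forall>c. \<forall>v\<in>car M. f (mscale M c v) = mscale N c (f v)) \<and>
          (\<forall>z. \<forall>v\<in>car M. f (act M z v) = act N z (f v)))"

text \<open>
  A weight \<open>\<nu>\<close> is given by its values on the \<open>h\<^sub>i\<close>, i.e. by its coordinates with respect to the
  fundamental weights.
\<close>

definition weights ::
  "('c, 'g::ab_group_add) chev_alg \<Rightarrow> ('g, 'v::ab_group_add) gmod \<Rightarrow> ('c \<Rightarrow> complex) set" where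
  "weights G M = {\<nu>. \<exists>v\<in>car M. v \<noteq> 0 \<and> (\<forall>a. act M (gh G a) v = mscale M (\<nu> a) v)}"

text \<open>\<open>M\<close> is (a copy of) the irreducible module \<open>V(\<mu>)\<close>.\<close>

definition highest_weight_irrep ::
  "('c, 'g::ab_group_add) chev_alg \<Rightarrow> ('g, 'v::ab_group_add) gmod \<Rightarrow> ('c \<Rightarrow> complex) \<Rightarrow> bool" where
  "highest_weight_irrep G M \<mu> \<longleftrightarrow>
     irreducible_module G M \<and>
     (\<exists>v\<in>car M. v \<noteq> 0 \<and> (\<forall>a. act M (gx G a) v = 0) \<and>
                (\<forall>a. act M (gh G a) v = mscale M (\<mu> a) v))"

definition fund_weight :: "'c \<Rightarrow> 'c \<Rightarrow> complex" where
  "fund_weight j k = (if k = j then 1 else 0)"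

definition simple_root :: "('c \<Rightarrow> 'c \<Rightarrow> bool) \<Rightarrow> 'c \<Rightarrow> 'c \<Rightarrow> complex" where
  "simple_root adj k i = of_int (cartan adj i k)"

definition simple_reflection ::
  "('c \<Rightarrow> 'c \<Rightarrow> bool) \<Rightarrow> 'c \<Rightarrow> ('c \<Rightarrow> complex) \<Rightarrow> ('c \<Rightarrow> complex)" where
  "simple_reflection adj k \<nu> = (\<lambda>i. \<nu> i - \<nu> k * simple_root adj k i)"

inductive_set weyl_group ::
  "('c \<Rightarrow> 'c \<Rightarrow> bool) \<Rightarrow> (('c \<Rightarrow> complex) \<Rightarrow> ('c \<Rightarrow> complex)) set"
  for adj :: "'c \<Rightarrow> 'c \<Rightarrow> bool" where
  "id \<in> weyl_group adj"
| "w \<in> weyl_group adj \<Longrightarrow> simple_reflection adj k \<circ> w \<in> weyl_group adj"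

text \<open>
  A nonzero dominant integral weight \<open>\<mu>\<close> is minuscule if the weights of \<open>V(\<mu>)\<close> form a single
  orbit of the Weyl group; \<open>M\<close> is a copy of \<open>V(\<mu>)\<close>.
\<close>

definition minuscule_weight ::
  "('c \<Rightarrow> 'c \<Rightarrow> bool) \<Rightarrow> ('c, 'g::ab_group_add) chev_alg \<Rightarrow> ('g, 'v::ab_group_add) gmod \<Rightarrow>
   ('c \<Rightarrow> complex) \<Rightarrow> bool" where
  "minuscule_weight adj G M \<mu> \<longleftrightarrow>
     highest_weight_irrep G M \<mu> \<and>
     (\<forall>a. \<mu> a \<in> \<nat>) \<and> (\<exists>a. \<mu> a \<noteq> 0) \<and>
     weights G M = {w \<mu> |w. w \<in> weyl_group adj}"

definition weight_le ::
  "('c::finite \<Rightarrow> 'c \<Rightarrow> bool) \<Rightarrow> ('c \<Rightarrow> complex) \<Rightarrow> ('c \<Rightarrow> complex) \<Rightarrow> bool" where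
  "weight_le adj \<mu> \<nu> \<longleftrightarrow>
     (\<exists>n :: 'c \<Rightarrow> nat. \<forall>i. \<nu> i - \<mu> i = (\<Sum>k\<in>UNIV. of_nat (n k) * simple_root adj k i))"

text \<open>An \<open>m\<close>-multichain \<open>\<nu>\<^sub>1 \<le> \<dots> \<le> \<nu>\<^sub>m\<close> in the weight poset is the list of its members.\<close>

definition weight_multichains ::
  "('c::finite \<Rightarrow> 'c \<Rightarrow> bool) \<Rightarrow> nat \<Rightarrow> ('c \<Rightarrow> complex) set \<Rightarrow> ('c \<Rightarrow> complex) list set" where
  "weight_multichains adj m W =
     {\<nu>s. length \<nu>s = m \<and> set \<nu>s \<subseteq> W \<and> sorted_wrt (weight_le adj) \<nu>s}"


section \<open>Formal linear combinations\<close>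

definition pscale :: "complex \<Rightarrow> ('a \<Rightarrow>\<^sub>0 complex) \<Rightarrow> ('a \<Rightarrow>\<^sub>0 complex)" where
  "pscale c v = Poly_Mapping.map ((*) c) v"

lemma lookup_pscale: "Poly_Mapping.lookup (pscale c v) k = c * Poly_Mapping.lookup v k"
  by (simp add: pscale_def Poly_Mapping.map.rep_eq when_def)

interpretation pm: vector_space "pscale :: complex \<Rightarrow> ('a \<Rightarrow>\<^sub>0 complex) \<Rightarrow> ('a \<Rightarrow>\<^sub>0 complex)"
  by unfold_locales
    (rule poly_mapping_eqI, simp add: lookup_pscale lookup_add distrib_left distrib_right)+

definition lin_ext ::
  "('a \<Rightarrow> ('b \<Rightarrow>\<^sub>0 complex)) \<Rightarrow> ('a \<Rightarrow>\<^sub>0 complex) \<Rightarrow> ('b \<Rightarrow>\<^sub>0 complex)" where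
  "lin_ext f v = (\<Sum>k\<in>Poly_Mapping.keys v. pscale (Poly_Mapping.lookup v k) (f k))"


section \<open>The module of order ideals\<close>

definition ideal_space :: "('p::order set \<Rightarrow>\<^sub>0 complex) set" where
  "ideal_space = {v. Poly_Mapping.keys v \<subseteq> order_ideals}"

definition X_op ::
  "('p::order \<Rightarrow> 'c) \<Rightarrow> 'c \<Rightarrow> ('p set \<Rightarrow>\<^sub>0 complex) \<Rightarrow> ('p set \<Rightarrow>\<^sub>0 complex)" where
  "X_op \<kappa> a = lin_ext (\<lambda>I.
     \<Sum>x\<in>{x. x \<notin> I \<and> (\<forall>z. z < x \<longrightarrow> z \<in> I) \<and> \<kappa> x = a}. Poly_Mapping.single (insert x I) 1)"

definition Y_op ::
  "('p::order \<Rightarrow> 'c) \<Rightarrow> 'c \<Rightarrow> ('p set \<Rightarrow>\<^sub>0 complex) \<Rightarrow> ('p set \<Rightarrow>\<^sub>0 complex)" where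
  "Y_op \<kappa> a = lin_ext (\<lambda>I.
     \<Sum>x\<in>{x. x \<in> I \<and> (\<forall>z. x < z \<longrightarrow> z \<notin> I) \<and> \<kappa> x = a}. Poly_Mapping.single (I - {x}) 1)"

text \<open>
  The numbers \<open>\<mu>\<^sub>i(I)\<close>, where \<open>j\<close> is the color of the maximal element of \<open>P\<close>: the closed form of
  the recursion stated in the two lemmas that follow.
\<close>

definition ideal_mu ::
  "('c \<Rightarrow> 'c \<Rightarrow> bool) \<Rightarrow> ('p::finite \<Rightarrow> 'c) \<Rightarrow> 'c \<Rightarrow> 'c \<Rightarrow> 'p set \<Rightarrow> int" where
  "ideal_mu adj \<kappa> j i I = of_bool (i = j)
     + (\<Sum>y\<in>-I. of_bool (adj i (\<kappa> y)) - 2 * of_bool (i = \<kappa> y))"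

lemma ideal_mu_UNIV: "ideal_mu adj \<kappa> j i UNIV = of_bool (i = j)"
  by (simp add: ideal_mu_def)

lemma ideal_mu_remove:
  assumes "y \<notin> I"
  shows "ideal_mu adj \<kappa> j i I =
           ideal_mu adj \<kappa> j i (insert y I) - 2 * of_bool (i = \<kappa> y) + of_bool (adj i (\<kappa> y))"
proof -
  have "- I = insert y (- insert y I)" using assms by auto
  then have "(\<Sum>y\<in>-I. of_bool (adj i (\<kappa> y)) - 2 * of_bool (i = \<kappa> y) :: int) =
      of_bool (adj i (\<kappa> y)) - 2 * of_bool (i = \<kappa> y) +
      (\<Sum>y\<in>- insert y I. of_bool (adj i (\<kappa> y)) - 2 * of_bool (i = \<kappa> y))"
    by (simp only: sum.insert finite) simp
  then show ?thesis by (simp add: ideal_mu_def)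
qed

definition H_op ::
  "('c \<Rightarrow> 'c \<Rightarrow> bool) \<Rightarrow> ('p::finite \<Rightarrow> 'c) \<Rightarrow> 'c \<Rightarrow> 'c \<Rightarrow>
   ('p set \<Rightarrow>\<^sub>0 complex) \<Rightarrow> ('p set \<Rightarrow>\<^sub>0 complex)" where
  "H_op adj \<kappa> j a = lin_ext (\<lambda>I. Poly_Mapping.single I (of_int (ideal_mu adj \<kappa> j a I)))"

definition ideal_weight ::
  "('c \<Rightarrow> 'c \<Rightarrow> bool) \<Rightarrow> ('p::finite \<Rightarrow> 'c) \<Rightarrow> 'c \<Rightarrow> 'p set \<Rightarrow> ('c \<Rightarrow> complex)" where
  "ideal_weight adj \<kappa> j I = (\<lambda>a. of_int (ideal_mu adj \<kappa> j a I))"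

definition ideal_module ::
  "('g \<Rightarrow> ('p::order set \<Rightarrow>\<^sub>0 complex) \<Rightarrow> ('p set \<Rightarrow>\<^sub>0 complex)) \<Rightarrow>
   ('g, 'p set \<Rightarrow>\<^sub>0 complex) gmod" where
  "ideal_module \<rho> = \<lparr>car = ideal_space, mscale = pscale, act = \<rho>\<rparr>"

definition ideal_action ::
  "('c \<Rightarrow> 'c \<Rightarrow> bool) \<Rightarrow> ('p::{finite, order} \<Rightarrow> 'c) \<Rightarrow> 'c \<Rightarrow> ('c, 'g::ab_group_add) chev_alg \<Rightarrow>
   ('g \<Rightarrow> ('p set \<Rightarrow>\<^sub>0 complex) \<Rightarrow> ('p set \<Rightarrow>\<^sub>0 complex)) \<Rightarrow> bool" where
  "ideal_action adj \<kappa> j G \<rho> \<longleftrightarrow>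
     lie_module G (ideal_module \<rho>) \<and>
     (\<forall>a. \<forall>v\<in>ideal_space. \<rho> (gx G a) v = X_op \<kappa> a v \<and>
                            \<rho> (gy G a) v = Y_op \<kappa> a v \<and>
                            \<rho> (gh G a) v = H_op adj \<kappa> j a v)"


section \<open>Symmetric powers and downward structures\<close>

text \<open>
  The map induced on a symmetric power by an endomorphism \<open>f\<close>, on the basis of multisets:
  \<open>{I\<^sub>1,\<dots>,I\<^sub>m} \<mapsto> \<Sum>\<^sub>k {I\<^sub>1,\<dots>,f I\<^sub>k,\<dots>,I\<^sub>m}\<close>, where \<open>f I\<^sub>k\<close> is expanded linearly.
\<close>

definition sym_op ::
  "(('b \<Rightarrow>\<^sub>0 complex) \<Rightarrow> ('b \<Rightarrow>\<^sub>0 complex)) \<Rightarrow>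
   ('b multiset \<Rightarrow>\<^sub>0 complex) \<Rightarrow> ('b multiset \<Rightarrow>\<^sub>0 complex)" where
  "sym_op f = lin_ext (\<lambda>M. \<Sum>I\<in>#M.
     lin_ext (\<lambda>J. Poly_Mapping.single (add_mset J (M - {#I#})) 1)
       (f (Poly_Mapping.single I 1)))"

definition down_power ::
  "('p::order \<Rightarrow> 'c) \<Rightarrow> 'c \<Rightarrow> nat \<Rightarrow>
   ('p set multiset \<Rightarrow>\<^sub>0 complex) \<Rightarrow> ('p set multiset \<Rightarrow>\<^sub>0 complex)" where
  "down_power \<kappa> a k v = pscale (1 / fact k) ((sym_op (Y_op \<kappa> a) ^^ k) v)"

text \<open>The list \<open>[(b\<^sub>1,n\<^sub>1),\<dots>,(b\<^sub>k,n\<^sub>k)]\<close> is applied to \<open>{P,\<dots>,P}\<close> from its head on.\<close>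

definition down_vector ::
  "('p::order \<Rightarrow> 'c) \<Rightarrow> nat \<Rightarrow> ('c \<times> nat) list \<Rightarrow> ('p set multiset \<Rightarrow>\<^sub>0 complex)" where
  "down_vector \<kappa> m bs =
     fold (\<lambda>(b, n). down_power \<kappa> b n) bs (Poly_Mapping.single (replicate_mset m UNIV) 1)"

definition down_vectors ::
  "('p::order \<Rightarrow> 'c) \<Rightarrow> nat \<Rightarrow> ('p set multiset \<Rightarrow>\<^sub>0 complex) set" where
  "down_vectors \<kappa> m = range (down_vector \<kappa> m)"

definition down_module ::
  "('p::order \<Rightarrow> 'c) \<Rightarrow> nat \<Rightarrow>
   ('g \<Rightarrow> ('p set \<Rightarrow>\<^sub>0 complex) \<Rightarrow> ('p set \<Rightarrow>\<^sub>0 complex)) \<Rightarrow>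
   ('g, 'p set multiset \<Rightarrow>\<^sub>0 complex) gmod" where
  "down_module \<kappa> m \<rho> =
     \<lparr>car = pm.span (down_vectors \<kappa> m), mscale = pscale, act = (\<lambda>z. sym_op (\<rho> z))\<rparr>"

text \<open>A linear extension of \<open>P\<close>, listed in decreasing order.\<close>

definition decreasing_linear_extension :: "'p::order list \<Rightarrow> bool" where
  "decreasing_linear_extension ys \<longleftrightarrow>
     distinct ys \<and> set ys = UNIV \<and> sorted_wrt (\<lambda>u v. \<not> u < v) ys"

definition bounded_mono_maps :: "nat \<Rightarrow> ('p::order \<Rightarrow> nat) set" where
  "bounded_mono_maps m = {\<phi>. mono \<phi> \<and> (\<forall>y. \<phi> y \<le> m)}"

definition stackwise_vector ::
  "('p::order \<Rightarrow> 'c) \<Rightarrow> nat \<Rightarrow> 'p list \<Rightarrow> ('p \<Rightarrow> nat) \<Rightarrow> ('p set multiset \<Rightarrow>\<^sub>0 complex)" where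
  "stackwise_vector \<kappa> m ys \<phi> = down_vector \<kappa> m (map (\<lambda>y. (\<kappa> y, \<phi> y)) ys)"

text \<open>The flag \<open>F\<^sub>1 \<supseteq> \<dots> \<supseteq> F\<^sub>m\<close> is the list \<open>[F\<^sub>1,\<dots>,F\<^sub>m]\<close>.\<close>

definition filter_flags :: "nat \<Rightarrow> 'p::order set list set" where
  "filter_flags m = {Fs. length Fs = m \<and> set Fs \<subseteq> order_filters \<and> sorted_wrt (\<supseteq>) Fs}"

definition flag_of :: "nat \<Rightarrow> ('p \<Rightarrow> nat) \<Rightarrow> 'p set list" where
  "flag_of m \<phi> = map (\<lambda>k. {y. k \<le> \<phi> y}) [1..<m+1]"

end

theory Submission
  imports Defs "HOL-Library.Product_Plus" "HOL-Library.List_Lexorder" "HOL-Library.FuncSet"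
begin

text \<open>
  Since \<open>\<mu>\<^sub>i(I)\<close> is \<open>1\<close>, \<open>-1\<close> or \<open>0\<close> according to whether an element of color \<open>a\<^sub>i\<close> can be removed from \<open>I\<close>,
  added to \<open>I\<close>, or neither, and since \<open>Y\<^sub>a Y\<^sub>a = 0\<close> and \<open>Y\<^sub>a Y\<^sub>b Y\<^sub>a = 0\<close> for adjacent colors, the operators
  on ideals satisfy the Chevalley--Serre relations. The ideals are orthogonal for a form in which
  \<open>X\<^sub>a\<close> and \<open>Y\<^sub>a\<close> are adjoint, and it extends to the symmetric powers; therefore every submodule
  generated by a highest weight vector is irreducible.

  For a filter \<open>F\<close> consider the span of the vectors \<open>\<Prod> Y\<^sub>y\<^sup>n\<^sup>(\<^sup>y\<^sup>) {P,\<dots>,P}\<close>, with \<open>y\<close> running down through \<open>F\<close>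
  and arbitrary exponents. It is stable under \<open>Y\<^sub>b\<close> unless an element of color \<open>b\<close> can be added to \<open>F\<close>;
  in particular for \<open>F = P\<close> it contains all downward vectors. If \<open>z\<close> covers \<open>x\<close> and \<open>n(x) > n(z)\<close>, the
  higher Serre relations express the vector by others with the same exponents after \<open>x\<close> and a
  smaller one at \<open>x\<close>. This ends with order-preserving exponents. Conversely, the suitably
  normalized coefficient at the multichain of \<open>\<psi>\<close> of the stackwise vector of \<open>\<phi>\<close> is an integer, it is
  \<open>1\<close> for \<open>\<phi> = \<psi>\<close>, and it is \<open>0\<close> if \<open>\<phi> < \<psi>\<close> at the last place where they differ. This triangularity
  gives independence and integrality of all expansions.
\<close>

section \<open>Linear maps on formal linear combinations\<close>

text \<open>\<open>G\<close> is known only through generators and relations, so whatever finite type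
  would provide has to come from P. The substitute is the positive vector of color counts: it makes
  the Cartan matrix injective, so no nonempty sum of simple roots vanishes. This separates a highest
  weight from the weights below it, yields uniqueness of the irreducible modules, and turns the
  weight order into inclusion of ideals.

  The obstacle in straightening is that moving a power of one lowering operator past another leaves
  lowering operators further to the right, where they belong to no element of the filter. Spaces
  with arbitrary exponents attached to filters, counterparts of Demazure modules, exist in order to
  absorb these.

  The symmetric powers are handled as graded pieces of a polynomial ring. Lowering and raising
  operators are derivations whose square kills every variable, so their divided powers obey a
  two-term product rule without denominators. The form on polynomials is the one for which
  multiplication by a variable is adjoint to differentiation; hence the factorials of multiplicities
  and the division by m!.\<close>

abbreviation lk :: "('a \<Rightarrow>\<^sub>0 complex) \<Rightarrow> 'a \<Rightarrow> complex" where
  "lk \<equiv> Poly_Mapping.lookup"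

abbreviation bas :: "'a \<Rightarrow> ('a \<Rightarrow>\<^sub>0 complex)" where
  "bas x \<equiv> Poly_Mapping.single x 1"

definition plin :: "(('a \<Rightarrow>\<^sub>0 complex) \<Rightarrow> ('b \<Rightarrow>\<^sub>0 complex)) \<Rightarrow> bool" where
  "plin f \<longleftrightarrow> (\<forall>u v. f (u + v) = f u + f v) \<and> (\<forall>c v. f (pscale c v) = pscale c (f v))"

lemma plinI:
  "(\<And>u v. f (u + v) = f u + f v) \<Longrightarrow> (\<And>c v. f (pscale c v) = pscale c (f v)) \<Longrightarrow> plin f"
  by (simp add: plin_def)

lemma plin_add: "plin f \<Longrightarrow> f (u + v) = f u + f v"
  by (simp add: plin_def)

lemma plin_scale: "plin f \<Longrightarrow> f (pscale c v) = pscale c (f v)"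
  by (simp add: plin_def)

lemma plin_zero: "plin f \<Longrightarrow> f 0 = 0"
  using plin_scale[of f 0 0] by simp

lemma plin_diff: "plin f \<Longrightarrow> f (u - v) = f u - f v"
  using plin_add[of f "u - v" v] by (simp add: algebra_simps)

lemma plin_sum: "plin f \<Longrightarrow> f (\<Sum>i\<in>A. g i) = (\<Sum>i\<in>A. f (g i))"
  by (induction A rule: infinite_finite_induct) (auto simp: plin_zero plin_add)

lemma plin_compose: "plin f \<Longrightarrow> plin g \<Longrightarrow> plin (\<lambda>v. f (g v))"
  by (simp add: plin_def)

lemma plin_funpow: "plin f \<Longrightarrow> plin (f ^^ n)" for f :: "('a \<Rightarrow>\<^sub>0 complex) \<Rightarrow> ('a \<Rightarrow>\<^sub>0 complex)"
  by (induction n) (simp_all add: plin_def)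

lemma plin_id: "plin (\<lambda>v. v)"
  by (simp add: plin_def)

lemma plin_const0: "plin (\<lambda>v. 0)"
  by (simp add: plin_def)

lemma plin_plus: "plin f \<Longrightarrow> plin g \<Longrightarrow> plin (\<lambda>v. f v + g v)"
  by (simp add: plin_def pm.scale_right_distrib algebra_simps)

lemma plin_minus: "plin f \<Longrightarrow> plin g \<Longrightarrow> plin (\<lambda>v. f v - g v)"
  by (simp add: plin_def pm.scale_right_diff_distrib algebra_simps)

lemma plin_cscale: "plin f \<Longrightarrow> plin (\<lambda>v. pscale c (f v))"
  by (simp add: plin_def pm.scale_right_distrib mult.commute)

lemma plin_sumf: "(\<And>i. i \<in> A \<Longrightarrow> plin (f i)) \<Longrightarrow> plin (\<lambda>v. \<Sum>i\<in>A. f i v)"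
  by (induction A rule: infinite_finite_induct) (auto simp: plin_const0 plin_plus)

lemma pscale_single: "pscale c (Poly_Mapping.single k d) = Poly_Mapping.single k (c * d)"
  by (rule poly_mapping_eqI) (simp add: lookup_pscale lookup_single when_def)

lemma lin_ext_superset:
  assumes "finite A" "Poly_Mapping.keys v \<subseteq> A"
  shows "lin_ext f v = (\<Sum>k\<in>A. pscale (lk v k) (f k))"
  unfolding lin_ext_def using assms
  by (intro sum.mono_neutral_left) (auto simp: in_keys_iff)

lemma plin_lin_ext: "plin (lin_ext f)"
proof (rule plinI)
  fix u v :: "'a \<Rightarrow>\<^sub>0 complex"
  let ?A = "Poly_Mapping.keys u \<union> Poly_Mapping.keys v"
  have "Poly_Mapping.keys (u + v) \<subseteq> ?A" by (rule keys_add)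
  then show "lin_ext f (u + v) = lin_ext f u + lin_ext f v"
    by (simp add: lin_ext_superset[of ?A] lookup_add pm.scale_left_distrib sum.distrib)
next
  fix c and v :: "'a \<Rightarrow>\<^sub>0 complex"
  have "Poly_Mapping.keys (pscale c v) \<subseteq> Poly_Mapping.keys v"
    by (auto simp: in_keys_iff lookup_pscale)
  then show "lin_ext f (pscale c v) = pscale c (lin_ext f v)"
    by (simp add: lin_ext_superset[of "Poly_Mapping.keys v"] lookup_pscale pm.scale_sum_right)
qed

lemma lin_ext_bas [simp]: "lin_ext f (bas k) = f k"
  by (simp add: lin_ext_def)

lemma lin_ext_id: "lin_ext bas v = v"
proof (rule poly_mapping_eqI)
  fix k
  have "lk (lin_ext bas v) k = (\<Sum>i\<in>Poly_Mapping.keys v. if i = k then lk v k else 0)"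
    unfolding lin_ext_def lookup_sum
    by (intro sum.cong refl) (auto simp: lookup_pscale lookup_single when_def)
  also have "\<dots> = lk v k"
    by (simp add: sum.delta in_keys_iff)
  finally show "lk (lin_ext bas v) k = lk v k" .
qed

lemma bas_expand: "v = (\<Sum>k\<in>Poly_Mapping.keys v. pscale (lk v k) (bas k))"
  using lin_ext_id[of v] by (simp add: lin_ext_def)

lemma plin_eq_lin_ext: "plin f \<Longrightarrow> f v = lin_ext (\<lambda>k. f (bas k)) v"
  using arg_cong[OF bas_expand[of v], of f] by (simp add: plin_sum plin_scale lin_ext_def)

lemma plin_eqI:
  assumes "plin f" "plin g" "\<And>k. f (bas k) = g (bas k)"
  shows "f v = g v"
  by (subst plin_eq_lin_ext[OF assms(1)], subst plin_eq_lin_ext[OF assms(2)]) (simp add: assms(3))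

lemma plin_eq_onI:
  assumes "plin f" "plin g" "\<And>k. k \<in> Poly_Mapping.keys v \<Longrightarrow> f (bas k) = g (bas k)"
  shows "f v = g v"
  by (subst plin_eq_lin_ext[OF assms(1)], subst plin_eq_lin_ext[OF assms(2)])
    (simp add: lin_ext_def assms(3))

lemma plin_span_subspace:
  assumes f: "plin f" and T: "pm.subspace T" and S: "\<And>s. s \<in> S \<Longrightarrow> f s \<in> T" and u: "u \<in> pm.span S"
  shows "f u \<in> T"
  using u
proof (induction rule: pm.span_induct_alt)
  case base
  show ?case using T f by (simp add: plin_zero pm.subspace_0)
next
  case (step c x y)
  then show ?case
    by (simp add: plin_add[OF f] plin_scale[OF f] S T pm.subspace_add pm.subspace_scale)
qed

lemma plin_span:
  assumes "plin f" "\<And>s. s \<in> S \<Longrightarrow> f s \<in> pm.span T" "u \<in> pm.span S"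
  shows "f u \<in> pm.span T"
  using plin_span_subspace[OF assms(1) pm.subspace_span assms(2,3)] by blast

lemma in_span_bas: "Poly_Mapping.keys v \<subseteq> K \<Longrightarrow> v \<in> pm.span (bas ` K)"
  by (subst bas_expand[of v]) (intro pm.span_sum pm.span_scale pm.span_base, auto)

section \<open>Weighted hermitian forms\<close>

text \<open>Used with weight 1 on ideals and with \<open>fact_weight\<close> on multisets.
  Conjugating the second argument makes the form definite over the complex numbers.\<close>

definition herm :: "('a \<Rightarrow> nat) \<Rightarrow> ('a \<Rightarrow>\<^sub>0 complex) \<Rightarrow> ('a \<Rightarrow>\<^sub>0 complex) \<Rightarrow> complex" where
  "herm w u v = (\<Sum>k\<in>Poly_Mapping.keys u. of_nat (w k) * lk u k * cnj (lk v k))"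

lemma herm_superset:
  "finite A \<Longrightarrow> Poly_Mapping.keys u \<subseteq> A \<Longrightarrow>
     herm w u v = (\<Sum>k\<in>A. of_nat (w k) * lk u k * cnj (lk v k))"
  unfolding herm_def by (intro sum.mono_neutral_left) (auto simp: in_keys_iff)

lemma herm_add_left: "herm w (u + u') v = herm w u v + herm w u' v"
proof -
  let ?A = "Poly_Mapping.keys u \<union> Poly_Mapping.keys u'"
  have "Poly_Mapping.keys (u + u') \<subseteq> ?A" by (rule keys_add)
  then show ?thesis
    by (simp add: herm_superset[of ?A] lookup_add algebra_simps sum.distrib)
qed

lemma herm_scale_left: "herm w (pscale c u) v = c * herm w u v"
proof -
  have "Poly_Mapping.keys (pscale c u) \<subseteq> Poly_Mapping.keys u"
    by (auto simp: in_keys_iff lookup_pscale)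
  then show ?thesis
    by (simp add: herm_superset[of "Poly_Mapping.keys u"] lookup_pscale sum_distrib_left mult_ac)
qed

lemma herm_add_right: "herm w u (v + v') = herm w u v + herm w u v'"
  by (simp add: herm_def lookup_add algebra_simps sum.distrib)

lemma herm_scale_right: "herm w u (pscale c v) = cnj c * herm w u v"
  by (simp add: herm_def lookup_pscale sum_distrib_left mult_ac)

lemma herm_zero_left [simp]: "herm w 0 v = 0"
  by (simp add: herm_def)

lemma herm_zero_right [simp]: "herm w u 0 = 0"
  by (simp add: herm_def)

lemma herm_sum_left: "herm w (\<Sum>i\<in>A. f i) v = (\<Sum>i\<in>A. herm w (f i) v)"
  by (induction A rule: infinite_finite_induct) (auto simp: herm_add_left)

lemma herm_sum_right: "herm w u (\<Sum>i\<in>A. f i) = (\<Sum>i\<in>A. herm w u (f i))"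
  by (induction A rule: infinite_finite_induct) (auto simp: herm_add_right)

lemma herm_bas_right: "herm w u (bas k) = of_nat (w k) * lk u k"
proof -
  have "herm w u (bas k) = (\<Sum>i\<in>Poly_Mapping.keys u. if i = k then of_nat (w k) * lk u k else 0)"
    unfolding herm_def by (intro sum.cong refl) (auto simp: lookup_single when_def)
  then show ?thesis by (simp add: sum.delta in_keys_iff)
qed

lemma herm_bas_left: "herm w (bas k) v = of_nat (w k) * cnj (lk v k)"
  by (simp add: herm_def)

lemma herm_definite:
  assumes "\<And>k. w k > 0" "herm w u u = 0"
  shows "u = 0"
proof (rule poly_mapping_eqI)
  fix k
  have "herm w u u = of_real (\<Sum>k\<in>Poly_Mapping.keys u. real (w k) * (cmod (lk u k))\<^sup>2)"
    by (simp add: herm_def mult.assoc complex_mult_cnj cmod_power2 del: of_real_add)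
  then have "(\<Sum>k\<in>Poly_Mapping.keys u. real (w k) * (cmod (lk u k))\<^sup>2) = 0"
    using assms(2) by (metis of_real_eq_0_iff)
  then have "\<forall>k\<in>Poly_Mapping.keys u. real (w k) * (cmod (lk u k))\<^sup>2 = 0"
    by (subst (asm) sum_nonneg_eq_0_iff) auto
  then show "lk u k = lk 0 k"
    using assms(1)[of k] by (cases "k \<in> Poly_Mapping.keys u") (auto simp: in_keys_iff)
qed

lemma herm_adjointI:
  assumes f: "plin f" and g: "plin g"
    and fg: "\<And>i j. herm w' (f (bas i)) (bas j) = herm w (bas i) (g (bas j))"
  shows "herm w' (f u) v = herm w u (g v)"
proof -
  have "f u = (\<Sum>i\<in>Poly_Mapping.keys u. pscale (lk u i) (f (bas i)))"
    by (subst plin_eq_lin_ext[OF f]) (simp add: lin_ext_def)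
  moreover have "g v = (\<Sum>j\<in>Poly_Mapping.keys v. pscale (lk v j) (g (bas j)))"
    by (subst plin_eq_lin_ext[OF g]) (simp add: lin_ext_def)
  moreover have "herm w' (\<Sum>i\<in>Poly_Mapping.keys u. pscale (lk u i) (f (bas i)))
       (\<Sum>j\<in>Poly_Mapping.keys v. pscale (lk v j) (bas j)) =
     herm w (\<Sum>i\<in>Poly_Mapping.keys u. pscale (lk u i) (bas i))
       (\<Sum>j\<in>Poly_Mapping.keys v. pscale (lk v j) (g (bas j)))"
    by (simp only: herm_sum_left herm_sum_right herm_scale_left herm_scale_right fg)
  ultimately show ?thesis
    using bas_expand[of u] bas_expand[of v] by simp
qed

section \<open>The symmetric algebra\<close>

text \<open>
  Formal combinations of multisets form a commutative ring under convolution, the symmetric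
  algebra of the space of formal combinations of their elements.
\<close>

definition emb :: "('b \<Rightarrow>\<^sub>0 complex) \<Rightarrow> ('b multiset \<Rightarrow>\<^sub>0 complex)" where
  "emb = lin_ext (\<lambda>J. bas {#J#})"

lemma plin_emb: "plin emb"
  unfolding emb_def by (rule plin_lin_ext)

lemma emb_bas [simp]: "emb (bas J) = bas {#J#}"
  by (simp add: emb_def)

lemma pscale_conv_mult: "pscale c (v :: 'b multiset \<Rightarrow>\<^sub>0 complex) = Poly_Mapping.single 0 c * v"
  by (simp add: pscale_def mult_map_scale_conv_mult)

lemma pscale_mult_left: "pscale c u * w = pscale c (u * w)" for u w :: "'b multiset \<Rightarrow>\<^sub>0 complex"
  by (simp add: pscale_conv_mult mult.assoc)

lemma pscale_mult_right: "u * pscale c w = pscale c (u * w)" for u w :: "'b multiset \<Rightarrow>\<^sub>0 complex"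
  by (simp add: pscale_conv_mult mult_ac)

lemma plin_mult_left: "plin (\<lambda>w. u * w)" for u :: "'b multiset \<Rightarrow>\<^sub>0 complex"
  by (rule plinI) (simp_all add: distrib_left pscale_mult_right)

lemma plin_mult_right: "plin (\<lambda>w. w * u)" for u :: "'b multiset \<Rightarrow>\<^sub>0 complex"
  by (rule plinI) (simp_all add: distrib_right pscale_mult_left)

lemma bas_mult: "bas M * bas N = bas (M + N)" for M N :: "'b multiset"
  by (simp add: mult_single)

lemma bas_add_mset: "bas (add_mset I M) = bas {#I#} * bas M"
  by (simp add: bas_mult)

lemma plin_sym_op: "plin (sym_op f)"
  unfolding sym_op_def by (rule plin_lin_ext)

lemma sym_op_bas: "sym_op f (bas M) = (\<Sum>I\<in>#M. emb (f (bas I)) * bas (M - {#I#}))"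
proof -
  have "lin_ext (\<lambda>J. bas (add_mset J N)) v = emb v * bas N" for N :: "'a multiset" and v
    by (rule plin_eqI[OF plin_lin_ext plin_compose[OF plin_mult_right plin_emb]])
      (simp add: bas_mult)
  then show ?thesis by (simp add: sym_op_def)
qed

text \<open>Every member of M + N comes from M or from N, and replacing it leaves the other factor
  alone: the Leibniz rule. Thus \<open>sym_op f\<close> is the derivation extending f.\<close>

lemma sym_op_mult_bas:
  "sym_op f (bas M * bas N) = sym_op f (bas M) * bas N + bas M * sym_op f (bas N)"
proof -
  have "(\<Sum>I\<in>#M. emb (f (bas I)) * bas (M + N - {#I#})) =
      (\<Sum>I\<in>#M. emb (f (bas I)) * bas (M - {#I#}) * bas N)"
    by (intro arg_cong[where f = sum_mset] image_mset_cong)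
      (auto simp: mult.assoc bas_mult multiset_diff_union_assoc add.commute dest!: multi_member_split)
  moreover have "(\<Sum>I\<in>#N. emb (f (bas I)) * bas (M + N - {#I#})) =
      (\<Sum>I\<in>#N. bas M * (emb (f (bas I)) * bas (N - {#I#})))"
    by (intro arg_cong[where f = sum_mset] image_mset_cong)
      (auto simp: mult.left_commute[of "bas M"] bas_mult dest!: multi_member_split)
  ultimately show ?thesis
    by (simp add: bas_mult sym_op_bas sum_mset_distrib_left sum_mset_distrib_right)
qed

lemma sym_op_mult: "sym_op f (u * w) = sym_op f u * w + u * sym_op f w"
proof -
  have 1: "sym_op f (bas M * w) = sym_op f (bas M) * w + bas M * sym_op f w" for M
    by (rule plin_eqI[of "\<lambda>w. sym_op f (bas M * w)"])
      (intro plin_plus plin_compose[OF plin_sym_op] plin_compose[OF plin_mult_left] plin_mult_left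
        plin_sym_op sym_op_mult_bas)+
  show ?thesis
    by (rule plin_eqI[of "\<lambda>u. sym_op f (u * w)"])
      (intro plin_plus plin_compose[OF plin_sym_op] plin_compose[OF plin_mult_right] plin_mult_right
        plin_sym_op 1)+
qed

lemma sym_op_gen: "sym_op f (bas {#I#}) = emb (f (bas I))"
  by (simp add: sym_op_bas)

lemma sym_op_emb: "plin f \<Longrightarrow> sym_op f (emb v) = emb (f v)"
  by (rule plin_eqI[of "\<lambda>v. sym_op f (emb v)"])
    (auto intro: plin_compose[OF plin_sym_op] plin_compose[OF plin_emb] plin_emb simp: sym_op_gen)

lemma sym_op_empty: "sym_op f (bas {#}) = 0"
  by (simp add: sym_op_bas del: single_one)

lemma sym_op_add: "sym_op (\<lambda>v. f v + g v) u = sym_op f u + sym_op g u"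
  by (rule plin_eqI[OF plin_sym_op plin_plus[OF plin_sym_op plin_sym_op]])
    (simp add: sym_op_bas plin_add[OF plin_emb] distrib_right sum_mset.distrib)

lemma sym_op_scale: "sym_op (\<lambda>v. pscale c (f v)) u = pscale c (sym_op f u)"
proof (rule plin_eqI[OF plin_sym_op plin_cscale[OF plin_sym_op]])
  fix M
  show "sym_op (\<lambda>v. pscale c (f v)) (bas M) = pscale c (sym_op f (bas M))"
    by (simp add: sym_op_bas plin_scale[OF plin_emb] pscale_mult_left)
      (simp add: pscale_conv_mult sum_mset_distrib_left)
qed

text \<open>A commutator of derivations is again a derivation, so it suffices to compare both sides
  on single factors. This is what makes the symmetric algebra a Lie module.\<close>

lemma sym_op_commutator:
  assumes f: "plin f" and g: "plin g"
  shows "sym_op (\<lambda>v. f (g v) - g (f v)) u = sym_op f (sym_op g u) - sym_op g (sym_op f u)"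
proof (rule plin_eqI[OF plin_sym_op plin_minus[OF plin_compose[OF plin_sym_op plin_sym_op]
        plin_compose[OF plin_sym_op plin_sym_op]]])
  fix M
  show "sym_op (\<lambda>v. f (g v) - g (f v)) (bas M) =
      sym_op f (sym_op g (bas M)) - sym_op g (sym_op f (bas M))"
  proof (induction M)
    case empty
    show ?case by (simp only: sym_op_empty plin_zero[OF plin_sym_op] diff_0_right)
  next
    case (add I M)
    show ?case
      unfolding bas_add_mset[of I M] sym_op_mult add.IH
      by (simp only: sym_op_gen sym_op_mult sym_op_emb[OF f] sym_op_emb[OF g]
          plin_diff[OF plin_emb] plin_add[OF plin_sym_op])
        (simp add: algebra_simps)
  qed
qed

text \<open>Allows \<open>Y_op\<close> to be exchanged for an operator that agrees with it on order
  ideals only.\<close>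

lemma sym_op_cong_on:
  assumes "\<And>M I. M \<in> Poly_Mapping.keys u \<Longrightarrow> I \<in># M \<Longrightarrow> f (bas I) = g (bas I)"
  shows "sym_op f u = sym_op g u"
proof (rule plin_eq_onI[OF plin_sym_op plin_sym_op])
  fix M assume "M \<in> Poly_Mapping.keys u"
  then have "(\<Sum>I\<in>#M. emb (f (bas I)) * bas (M - {#I#})) = (\<Sum>I\<in>#M. emb (g (bas I)) * bas (M - {#I#}))"
    by (intro arg_cong[where f = sum_mset] image_mset_cong) (simp add: assms)
  then show "sym_op f (bas M) = sym_op g (bas M)"
    by (simp only: sym_op_bas)
qed

section \<open>Adjoint derivations\<close>

text \<open>The squared norm of a monomial in the Fischer form on polynomials.\<close>

definition fact_weight :: "'b multiset \<Rightarrow> nat" where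
  "fact_weight M = (\<Prod>I\<in>set_mset M. fact (count M I))"

lemma fact_weight_pos: "fact_weight M > 0"
  by (simp add: fact_weight_def)

lemma fact_weight_add: "fact_weight (add_mset I M) = Suc (count M I) * fact_weight M"
proof -
  let ?S = "insert I (set_mset M)"
  have "fact_weight N = (\<Prod>J\<in>?S. fact (count N J))" if "set_mset N \<subseteq> ?S" for N
    unfolding fact_weight_def using that
    by (intro prod.mono_neutral_left) (auto simp: not_in_iff)
  then have *: "fact_weight N = fact (count N I) * (\<Prod>J\<in>?S - {I}. fact (count N J))"
    if "set_mset N \<subseteq> ?S" for N
    using that prod.remove[of ?S I "\<lambda>J. fact (count N J) :: nat"] by simp
  have "(\<Prod>J\<in>?S - {I}. fact (count (add_mset I M) J)) = (\<Prod>J\<in>?S - {I}. fact (count M J) :: nat)"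
    by (intro prod.cong) auto
  then show ?thesis
    using *[of "add_mset I M"] *[of M, OF subset_insertI] by (auto simp: algebra_simps)
qed

definition pderiv_mset :: "'b \<Rightarrow> ('b multiset \<Rightarrow>\<^sub>0 complex) \<Rightarrow> ('b multiset \<Rightarrow>\<^sub>0 complex)" where
  "pderiv_mset I = lin_ext (\<lambda>M. pscale (of_nat (count M I)) (bas (M - {#I#})))"

lemma plin_pderiv_mset: "plin (pderiv_mset I)"
  unfolding pderiv_mset_def by (rule plin_lin_ext)

lemma herm_cnj: "herm w v u = cnj (herm w u v)"
proof -
  let ?A = "Poly_Mapping.keys u \<union> Poly_Mapping.keys v"
  show ?thesis by (simp add: herm_superset[of ?A] mult_ac)
qed

text \<open>The weight is chosen for this: adding J to a multiset multiplies it by the new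
  multiplicity of J, which is the factor that differentiation produces.\<close>

lemma herm_mult_gen:
  "herm fact_weight (bas {#J#} * u) w = herm fact_weight u (pderiv_mset J w)"
proof (rule herm_adjointI[OF plin_mult_left plin_pderiv_mset])
  fix M N
  show "herm fact_weight (bas {#J#} * bas M) (bas N) =
      herm fact_weight (bas M) (pderiv_mset J (bas N))"
  proof (cases "J \<in># N")
    case True
    then obtain N' where N: "N = add_mset J N'" by (auto dest: multi_member_split)
    show ?thesis
      by (simp add: bas_mult herm_bas_right pderiv_mset_def N herm_scale_right lookup_single when_def
          fact_weight_add distrib_left distrib_right mult.commute[of "of_nat (fact_weight _)"])
  next
    case False
    then have "count N J = 0" and "add_mset J M \<noteq> N" by (auto simp: count_eq_zero_iff)
    then show ?thesis
      by (simp add: bas_mult herm_bas_right pderiv_mset_def lookup_single)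
  qed
qed

lemma sum_mset_count_pscale:
  fixes F :: "'b::finite \<Rightarrow> ('d \<Rightarrow>\<^sub>0 complex)"
  shows "(\<Sum>x\<in>#M. F x) = (\<Sum>x\<in>UNIV. pscale (of_nat (count M x)) (F x))"
proof (induction M)
  case empty
  show ?case by simp
next
  case (add a M)
  have "(\<Sum>x\<in>UNIV. pscale (of_nat (count (add_mset a M) x)) (F x)) =
      (\<Sum>x\<in>UNIV. pscale (of_nat (count M x)) (F x) + (if x = a then F x else 0))"
    by (intro sum.cong refl) (auto simp: pm.scale_left_distrib add.commute)
  then show ?case using add by (simp add: sum.distrib sum.delta add.commute)
qed

text \<open>A derivation is a first-order differential operator: the sum of f_JI x_J d/dx_I over the
  matrix entries of f. In this form its adjoint can be read off.\<close>

lemma sym_op_expand: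
  fixes u :: "'b::finite multiset \<Rightarrow>\<^sub>0 complex"
  shows "sym_op f u =
    (\<Sum>I\<in>UNIV. \<Sum>J\<in>UNIV. pscale (lk (f (bas I)) J) (bas {#J#} * pderiv_mset I u))"
proof (rule plin_eqI[OF plin_sym_op])
  show "plin (\<lambda>u. \<Sum>I\<in>UNIV. \<Sum>J\<in>UNIV. pscale (lk (f (bas I)) J) (bas {#J#} * pderiv_mset I u))"
    by (intro plin_sumf plin_cscale plin_compose[OF plin_mult_left] plin_pderiv_mset)
  fix M
  have e: "emb v = (\<Sum>J\<in>UNIV. pscale (lk v J) (bas {#J#}))" for v :: "'b \<Rightarrow>\<^sub>0 complex"
    by (simp add: emb_def lin_ext_superset[of UNIV])
  show "sym_op f (bas M) =
    (\<Sum>I\<in>UNIV. \<Sum>J\<in>UNIV. pscale (lk (f (bas I)) J) (bas {#J#} * pderiv_mset I (bas M)))"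
    by (simp add: sym_op_bas sum_mset_count_pscale e sum_distrib_right pscale_mult_left
        pscale_mult_right pderiv_mset_def pm.scale_sum_right mult.commute[of "lk _ _"])
qed

text \<open>The adjoint of x_J d/dx_I is x_I d/dx_J, and the matrices of f and g are conjugate
  transposes of each other.\<close>

lemma sym_op_adjoint:
  fixes u v :: "'b::finite multiset \<Rightarrow>\<^sub>0 complex"
  assumes "plin f" "plin g"
    and fg: "\<And>u v. herm (\<lambda>_. 1) (f u) v = herm (\<lambda>_. 1) u (g v)"
  shows "herm fact_weight (sym_op f u) v = herm fact_weight u (sym_op g v)"
proof -
  have c: "lk (f (bas I)) J = cnj (lk (g (bas J)) I)" for I J
    using fg[of "bas I" "bas J"] by (simp add: herm_bas_right herm_bas_left)
  have s: "herm fact_weight u (bas {#I#} * w) = herm fact_weight (pderiv_mset I u) w" for I w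
    by (subst (1 2) herm_cnj) (simp only: herm_mult_gen)
  show ?thesis
    unfolding sym_op_expand[of f] sym_op_expand[of g]
      herm_sum_left herm_sum_right herm_scale_left herm_scale_right s herm_mult_gen c
    by (rule sum.swap)
qed

section \<open>Divided powers of derivations\<close>

definition dpow ::
  "(('a \<Rightarrow>\<^sub>0 complex) \<Rightarrow> ('a \<Rightarrow>\<^sub>0 complex)) \<Rightarrow> nat \<Rightarrow> ('a \<Rightarrow>\<^sub>0 complex) \<Rightarrow> ('a \<Rightarrow>\<^sub>0 complex)" where
  "dpow D k w = pscale (1 / fact k) ((D ^^ k) w)"

lemma plin_dpow: "plin D \<Longrightarrow> plin (dpow D k)"
  unfolding dpow_def by (intro plin_cscale plin_funpow)

text \<open>Leibniz' formula stops after two terms because a second application to \<open>a\<close>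
  vanishes; the factor counts which of the applications hits \<open>a\<close>.\<close>

lemma sym_op_funpow_mult:
  assumes "sym_op f (sym_op f a) = 0"
  shows "(sym_op f ^^ Suc k) (a * w) =
    a * (sym_op f ^^ Suc k) w + pscale (of_nat (Suc k)) (sym_op f a * (sym_op f ^^ k) w)"
proof (induction k)
  case 0
  show ?case by (simp add: sym_op_mult add.commute)
next
  case (Suc k)
  have "(sym_op f ^^ Suc (Suc k)) (a * w) = sym_op f ((sym_op f ^^ Suc k) (a * w))"
    by simp
  also have "\<dots> = a * (sym_op f ^^ Suc (Suc k)) w + sym_op f a * (sym_op f ^^ Suc k) w
      + pscale (of_nat (Suc k)) (sym_op f a * (sym_op f ^^ Suc k) w)"
    unfolding Suc.IH plin_add[OF plin_sym_op] plin_scale[OF plin_sym_op] sym_op_mult assms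
    by (simp add: add_ac)
  also have "\<dots> = a * (sym_op f ^^ Suc (Suc k)) w
      + pscale (of_nat (Suc (Suc k))) (sym_op f a * (sym_op f ^^ Suc k) w)"
    unfolding of_nat_Suc[of "Suc k"] pm.scale_left_distrib by (simp add: add_ac)
  finally show ?case .
qed

text \<open>The division by factorials absorbs the binomial factor. The absence of denominators here
  is the source of all integrality below.\<close>

lemma dpow_mult:
  assumes "sym_op f (sym_op f a) = 0"
  shows "dpow (sym_op f) (Suc k) (a * w) =
    a * dpow (sym_op f) (Suc k) w + sym_op f a * dpow (sym_op f) k w"
proof -
  have "(1 + complex_of_nat k) / ((1 + of_nat k) * fact k) = 1 / fact k"
    by (metis fact_Suc mult_divide_mult_cancel_left mult.right_neutral of_nat_Suc of_nat_neq_0)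
  then show ?thesis
    unfolding dpow_def sym_op_funpow_mult[OF assms]
    by (simp add: pm.scale_right_distrib pscale_mult_right del: funpow.simps)
qed

section \<open>Colored minuscule posets\<close>

lemma finite_minimal:
  fixes S :: "'p::{finite, order} set"
  assumes "x \<in> S" shows "\<exists>c\<in>S. \<forall>b\<in>S. \<not> b < c"
  using finite_has_minimal[of S] assms by (metis empty_iff finite order.strict_iff_order)

lemma finite_maximal:
  fixes S :: "'p::{finite, order} set"
  assumes "x \<in> S" shows "\<exists>c\<in>S. \<forall>b\<in>S. \<not> c < b"
  using finite_has_maximal[of S] assms by (metis empty_iff finite order.strict_iff_order)

lemma covered_by_above:
  fixes x y :: "'p::{finite, order}"
  assumes "x < y" obtains c where "covered_by x c" "c \<le> y"
proof -
  let ?S = "{z. x < z \<and> z \<le> y}"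
  have yS: "y \<in> ?S" using assms by simp
  obtain c where cS: "c \<in> ?S" and mS: "\<And>b. b \<in> ?S \<Longrightarrow> \<not> b < c"
    using finite_minimal[OF yS] by blast
  have c: "x < c" "c \<le> y" using cS by auto
  have m: "\<not> b < c" if "x < b" "b \<le> y" for b using mS that by simp
  have "\<not> (x < z \<and> z < c)" for z
    using m[of z] less_imp_le[OF order.strict_trans2[OF _ c(2), of z]] by blast
  then show thesis
    using that[of c] c by (simp add: covered_by_def)
qed

lemma covered_by_below:
  fixes x y :: "'p::{finite, order}"
  assumes "x < y" obtains c where "covered_by c y" "x \<le> c"
proof -
  let ?S = "{z. x \<le> z \<and> z < y}"
  have xS: "x \<in> ?S" using assms by simp
  obtain c where cS: "c \<in> ?S" and mS: "\<And>b. b \<in> ?S \<Longrightarrow> \<not> c < b"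
    using finite_maximal[OF xS] by blast
  have c: "x \<le> c" "c < y" using cS by auto
  have m: "\<not> c < b" if "x \<le> b" "b < y" for b using mS that by simp
  have "\<not> (c < z \<and> z < y)" for z
    using m[of z] less_imp_le[OF order.strict_trans1[OF c(1), of z]] by blast
  then show thesis
    using that[of c] c by (simp add: covered_by_def)
qed

definition removable :: "('p::order \<Rightarrow> 'c) \<Rightarrow> 'c \<Rightarrow> 'p set \<Rightarrow> 'p \<Rightarrow> bool" where
  "removable \<kappa> b I x \<longleftrightarrow> x \<in> I \<and> (\<forall>z. x < z \<longrightarrow> z \<notin> I) \<and> \<kappa> x = b"

definition addable :: "('p::order \<Rightarrow> 'c) \<Rightarrow> 'c \<Rightarrow> 'p set \<Rightarrow> 'p \<Rightarrow> bool" where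
  "addable \<kappa> b I x \<longleftrightarrow> x \<notin> I \<and> (\<forall>z. z < x \<longrightarrow> z \<in> I) \<and> \<kappa> x = b"

lemma idealD: "I \<in> order_ideals \<Longrightarrow> x \<in> I \<Longrightarrow> y \<le> x \<Longrightarrow> y \<in> I"
  by (auto simp: order_ideals_def)

lemma filterD: "F \<in> order_filters \<Longrightarrow> x \<in> F \<Longrightarrow> x \<le> y \<Longrightarrow> y \<in> F"
  by (auto simp: order_filters_def)

lemma ideal_compl_filter: "F \<in> order_filters \<longleftrightarrow> - F \<in> order_ideals"
  by (auto simp: order_filters_def order_ideals_def)

text \<open>\<open>t\<close> is assumed to be maximal; that it is the greatest element is derived
  from connectedness in \<open>le_t\<close>.\<close>

locale minuscule_poset =
  fixes adj :: "'c::finite \<Rightarrow> 'c \<Rightarrow> bool" and \<kappa> :: "'p::{finite, order} \<Rightarrow> 'c" and t :: 'p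
  assumes graph: "simple_graph adj" and minuscule: "colored_minuscule adj \<kappa>"
    and conn: "connected_poset TYPE('p)" and t_max: "\<forall>x. \<not> t < x"
begin

abbreviation mu :: "'c \<Rightarrow> 'p set \<Rightarrow> int" where
  "mu \<equiv> ideal_mu adj \<kappa> (\<kappa> t)"

abbreviation iw :: "'p set \<Rightarrow> 'c \<Rightarrow> complex" where
  "iw \<equiv> ideal_weight adj \<kappa> (\<kappa> t)"

lemma adj_irrefl [simp]: "\<not> adj a a"
  using graph by (auto simp: simple_graph_def)

lemma adj_sym: "adj a b \<longleftrightarrow> adj b a"
  using graph by (auto simp: simple_graph_def)

lemma surj_color: "\<exists>x. \<kappa> x = b"
  using minuscule by (auto simp: colored_minuscule_def surj_def) metis

lemma EC: "\<kappa> x = \<kappa> y \<Longrightarrow> x \<le> y \<or> y \<le> x"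
  using minuscule by (auto simp: colored_minuscule_def)

lemma NA: "covered_by x y \<Longrightarrow> adj (\<kappa> x) (\<kappa> y)"
  using minuscule by (auto simp: colored_minuscule_def)

lemma AC: "adj (\<kappa> x) (\<kappa> y) \<Longrightarrow> x < y \<or> y < x"
  using minuscule adj_irrefl unfolding colored_minuscule_def by (metis order.strict_iff_order)

lemma ICE2: "x < y \<Longrightarrow> \<kappa> x = \<kappa> y \<Longrightarrow> \<not> (\<exists>z. x < z \<and> z < y \<and> \<kappa> z = \<kappa> x) \<Longrightarrow>
    card {z. x < z \<and> z < y \<and> adj (\<kappa> z) (\<kappa> x)} = 2"
  using minuscule unfolding colored_minuscule_def by blast

lemma UCB1: "\<not> (\<exists>z. x < z \<and> \<kappa> z = \<kappa> x) \<Longrightarrow> card {z. x < z \<and> adj (\<kappa> z) (\<kappa> x)} \<le> 1"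
  using minuscule unfolding colored_minuscule_def by blast

lemma LCB1: "\<not> (\<exists>z. z < x \<and> \<kappa> z = \<kappa> x) \<Longrightarrow> card {z. z < x \<and> adj (\<kappa> z) (\<kappa> x)} \<le> 1"
  using minuscule unfolding colored_minuscule_def by blast

lemma adj_above:
  assumes "x < y" obtains c where "covered_by x c" "x < c" "c \<le> y" "adj (\<kappa> c) (\<kappa> x)"
  using covered_by_above[OF assms] NA adj_sym by (metis covered_by_def)

lemma adj_below:
  assumes "x < y" obtains c where "covered_by c y" "c < y" "x \<le> c" "adj (\<kappa> c) (\<kappa> y)"
  using covered_by_below[OF assms] NA by (metis covered_by_def)

lemma next_color:
  assumes "x < z" "\<kappa> z = \<kappa> x"
  obtains y where "x < y" "\<kappa> y = \<kappa> x" "\<not> (\<exists>z. x < z \<and> z < y \<and> \<kappa> z = \<kappa> x)"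
proof -
  let ?S = "{z. x < z \<and> \<kappa> z = \<kappa> x}"
  obtain y where "y \<in> ?S" and "\<And>b. b \<in> ?S \<Longrightarrow> \<not> b < y"
    using finite_minimal[of z ?S] assms by blast
  then show thesis by (intro that[of y]) auto
qed

lemma previous_color:
  assumes "z < x" "\<kappa> z = \<kappa> x"
  obtains y where "y < x" "\<kappa> y = \<kappa> x" "\<not> (\<exists>z. y < z \<and> z < x \<and> \<kappa> z = \<kappa> x)"
proof -
  let ?S = "{z. z < x \<and> \<kappa> z = \<kappa> x}"
  obtain y where "y \<in> ?S" and "\<And>b. b \<in> ?S \<Longrightarrow> \<not> y < b"
    using finite_maximal[of z ?S] assms by blast
  then show thesis by (intro that[of y]) auto
qed

lemma top_color:
  obtains x where "\<kappa> x = b" "\<not> (\<exists>z. x < z \<and> \<kappa> z = \<kappa> x)"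
proof -
  let ?S = "{z. \<kappa> z = b}"
  obtain x where "x \<in> ?S" using surj_color[of b] by auto
  then obtain y where "y \<in> ?S" and "\<And>b. b \<in> ?S \<Longrightarrow> \<not> y < b"
    using finite_maximal[of x ?S] by blast
  then show thesis by (intro that[of y]) auto
qed

section \<open>The greatest element\<close>

lemma maximal_above: "\<exists>s\<ge>x. \<forall>z. \<not> s < z" for x :: 'p
proof -
  obtain y where "y \<in> {z. x \<le> z}" and "\<And>b. b \<in> {z. x \<le> z} \<Longrightarrow> \<not> y < b"
    using finite_maximal[of x "{z. x \<le> z}"] by blast
  then show ?thesis by (intro exI[of _ y]) (auto dest: order.strict_trans1)
qed

text \<open>Take a highest z below two maximal elements s and r, and covers u, v of z towards them;
  u and v differ, since above z uniqueness holds. If the color of z does not recur above z, then u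
  and v violate UCB1. If it recurs at w, then AC puts u and v below w, and a maximal element above w
  would be both s and r.\<close>

lemma maximal_above_unique:
  fixes x s r :: 'p
  assumes "x \<le> s" "\<forall>z. \<not> s < z" "x \<le> r" "\<forall>z. \<not> r < z"
  shows "s = r"
proof (rule ccontr)
  define mx where "mx x s \<longleftrightarrow> x \<le> s \<and> (\<forall>z. \<not> s < z)" for x s :: 'p
  have mx_mono: "mx u s" if "mx v s" "u \<le> v" for u v s
    using that by (auto simp: mx_def)
  let ?B = "{z. \<exists>s r. mx z s \<and> mx z r \<and> s \<noteq> r}"
  assume "s \<noteq> r"
  then have "x \<in> ?B" using assms by (auto simp: mx_def)
  then obtain z where z: "z \<in> ?B" and zm: "\<And>b. b \<in> ?B \<Longrightarrow> \<not> z < b"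
    using finite_maximal[of x ?B] by blast
  have above: "p = q" if "mx y p" "mx y q" "z < y" for y p q
    using zm[of y] that by blast
  from z obtain s r where s: "mx z s" and r: "mx z r" and sr: "s \<noteq> r" by auto
  have zs: "z < s" and zr: "z < r"
    using s r sr by (auto simp: mx_def order.strict_iff_order)
  obtain u where u: "covered_by z u" "z < u" "u \<le> s" "adj (\<kappa> u) (\<kappa> z)"
    using adj_above[OF zs] .
  obtain v where v: "covered_by z v" "z < v" "v \<le> r" "adj (\<kappa> v) (\<kappa> z)"
    using adj_above[OF zr] .
  have mu: "mx u s" and mv: "mx v r" using u v s r by (auto simp: mx_def)
  have uv: "u \<noteq> v" using above mu mv u sr by metis
  show False
  proof (cases "\<exists>w. z < w \<and> \<kappa> w = \<kappa> z")
    case False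
    have "card {u, v} \<le> card {w. z < w \<and> adj (\<kappa> w) (\<kappa> z)}"
      using u v by (intro card_mono) auto
    then show False using UCB1[OF False] uv by simp
  next
    case True
    then obtain w where w: "z < w" "\<kappa> w = \<kappa> z" by auto
    have "u < w" using AC[of u w] u w by (auto simp: covered_by_def)
    moreover have "v < w" using AC[of v w] v w by (auto simp: covered_by_def)
    moreover obtain q where "mx w q" using maximal_above[of w] by (auto simp: mx_def)
    ultimately have "mx u q" "mx v q" using mx_mono by (auto intro: less_imp_le)
    then show False using above mu mv u v sr by metis
  qed
qed

text \<open>Walk from \<open>t\<close> along covers. An upward step cannot leave the elements below
  \<open>t\<close>, because two maximal elements above the same element coincide.\<close>

lemma le_t: "x \<le> t"
proof -
  have "(t, x) \<in> {(u, v). covered_by u v \<or> covered_by v u}\<^sup>*"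
    using conn by (auto simp: connected_poset_def)
  then show ?thesis
  proof (induction rule: rtrancl_induct)
    case (step y z)
    show ?case
    proof (cases "covered_by y z")
      case True
      obtain s where s: "z \<le> s" "\<forall>w. \<not> s < w" using maximal_above by blast
      then have "s = t"
        using maximal_above_unique[of y s t] True step t_max by (auto simp: covered_by_def)
      then show ?thesis using s by simp
    next
      case False
      then show ?thesis using step by (auto simp: covered_by_def)
    qed
  qed simp
qed

text \<open>The left-hand side is \<open>\<mu>\<close> of the ideal \<open>{z. \<not> x \<le> z}\<close> at the color of \<open>x\<close>.\<close>

lemma color_count_above:
  "of_bool (\<kappa> x = \<kappa> t) + int (card {z. x < z \<and> adj (\<kappa> z) (\<kappa> x)})
     - 2 * int (card {z. x \<le> z \<and> \<kappa> z = \<kappa> x}) = -1"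
proof (induction "card {z. x < z}" arbitrary: x rule: less_induct)
  case less
  show ?case
  proof (cases "\<exists>z. x < z \<and> \<kappa> z = \<kappa> x")
    case False
    then have "{z. x \<le> z \<and> \<kappa> z = \<kappa> x} = {x}" by (auto simp: order.order_iff_strict)
    \<comment> \<open>UCB1 allows at most one neighbor color above and a cover of x provides one;
      for x = t there is none, and the first summand is 1 instead.\<close>
    moreover have "of_bool (\<kappa> x = \<kappa> t) + int (card {z. x < z \<and> adj (\<kappa> z) (\<kappa> x)}) = 1"
    proof (cases "x = t")
      case True
      then show ?thesis using t_max by simp
    next
      case x: False
      then have "x < t" using le_t by (simp add: order.strict_iff_order)
      then obtain c where "x < c" "adj (\<kappa> c) (\<kappa> x)" using adj_above by metis
      then have "card {z. x < z \<and> adj (\<kappa> z) (\<kappa> x)} > 0" by (auto simp: card_gt_0_iff)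
      moreover have "\<kappa> x \<noteq> \<kappa> t" using False \<open>x < t\<close> by auto
      ultimately show ?thesis using UCB1[OF False] by simp
    qed
    ultimately show ?thesis by simp
  next
    case True
    then obtain y where y: "x < y" "\<kappa> y = \<kappa> x" "\<not> (\<exists>z. x < z \<and> z < y \<and> \<kappa> z = \<kappa> x)"
      using next_color by metis
    have "{z. y < z} \<subset> {z. x < z}" using y(1) by auto
    then have IH: "of_bool (\<kappa> x = \<kappa> t) + int (card {z. y < z \<and> adj (\<kappa> z) (\<kappa> x)})
       - 2 * int (card {z. y \<le> z \<and> \<kappa> z = \<kappa> x}) = -1"
      using less[of y] y(2) by (simp add: psubset_card_mono)
    have "{z. x < z \<and> adj (\<kappa> z) (\<kappa> x)} =
        {z. x < z \<and> z < y \<and> adj (\<kappa> z) (\<kappa> x)} \<union> {z. y < z \<and> adj (\<kappa> z) (\<kappa> x)}"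
      using y AC[of _ y] by (auto dest: order.strict_trans)
    then have 1: "card {z. x < z \<and> adj (\<kappa> z) (\<kappa> x)} = 2 + card {z. y < z \<and> adj (\<kappa> z) (\<kappa> x)}"
      using ICE2[OF y(1) y(2)[symmetric] y(3)]
        card_Un_disjoint[of "{z. x < z \<and> z < y \<and> adj (\<kappa> z) (\<kappa> x)}" "{z. y < z \<and> adj (\<kappa> z) (\<kappa> x)}"]
      by force
    have "{z. x \<le> z \<and> \<kappa> z = \<kappa> x} = insert x {z. y \<le> z \<and> \<kappa> z = \<kappa> x}"
    proof (intro set_eqI iffI)
      fix z assume z: "z \<in> {z. x \<le> z \<and> \<kappa> z = \<kappa> x}"
      then have "z \<le> y \<or> y \<le> z" using EC[of z y] y by simp
      then show "z \<in> insert x {z. y \<le> z \<and> \<kappa> z = \<kappa> x}"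
        using z y(3) by (auto simp: order.order_iff_strict)
    qed (use y in auto)
    then have 2: "card {z. x \<le> z \<and> \<kappa> z = \<kappa> x} = Suc (card {z. y \<le> z \<and> \<kappa> z = \<kappa> x})"
      using y(1) by simp
    \<comment> \<open>Passing from y down to x adds two elements of adjacent color, by ICE2, and one
      element of the color itself, which counts twice.\<close>
    show ?thesis using IH unfolding 1 2 by simp
  qed
qed

section \<open>The value of mu at an ideal\<close>

lemma ideal_mu_card:
  "mu b I = of_bool (b = \<kappa> t) + int (card {y. y \<notin> I \<and> adj (\<kappa> y) b})
     - 2 * int (card {y. y \<notin> I \<and> \<kappa> y = b})"
proof -
  have "(\<Sum>y\<in>-I. of_bool (adj b (\<kappa> y)) :: int) = int (card {y. y \<notin> I \<and> adj (\<kappa> y) b})"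
    by (subst sum_of_bool_eq) (auto simp: adj_sym intro!: arg_cong[where f = card])
  moreover have "(\<Sum>y\<in>-I. of_bool (b = \<kappa> y) :: int) = int (card {y. y \<notin> I \<and> \<kappa> y = b})"
    by (subst sum_of_bool_eq) (auto intro!: arg_cong[where f = card])
  ultimately show ?thesis
    by (simp add: ideal_mu_def sum_subtractf flip: sum_distrib_left)
qed

text \<open>Let y be the lowest element of color b outside I and x the preceding one of that color,
  if any. ICE2 places two elements of adjacent color between them: those in I prevent the removal of
  x, those outside I prevent the addition of y, and the number of the latter minus 1 is mu. Without
  x, LCB1 leaves at most one obstruction; without y, the top element of color b takes over, with
  \<open>color_count_above\<close> in place of ICE2.\<close>

lemma ideal_mu_eq:
  assumes I: "I \<in> order_ideals"
  shows "mu b I = of_bool (\<exists>x. removable \<kappa> b I x) - of_bool (\<exists>x. addable \<kappa> b I x)"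
proof (cases "\<exists>y. y \<notin> I \<and> \<kappa> y = b")
  case False
  obtain x where x: "\<kappa> x = b" "\<not> (\<exists>z. x < z \<and> \<kappa> z = \<kappa> x)" using top_color .
  let ?U = "{z. x < z \<and> adj (\<kappa> z) b}"
  have xI: "x \<in> I" using False x by auto
  have "{y. y \<notin> I \<and> adj (\<kappa> y) b} = ?U - I"
    using AC[of _ x] x(1) xI idealD[OF I xI] by (auto dest: less_imp_le)
  moreover have "{y. y \<notin> I \<and> \<kappa> y = b} = {}" using False by auto
  ultimately have mu: "mu b I = of_bool (b = \<kappa> t) + int (card (?U - I))"
    unfolding ideal_mu_card by simp
  have "{z. x \<le> z \<and> \<kappa> z = b} = {x}" using x by (auto simp: order.order_iff_strict)
  then have U: "of_bool (b = \<kappa> t) + int (card ?U) = 1"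
    using color_count_above[of x] x(1) by simp
  have na: "\<not> (\<exists>x. addable \<kappa> b I x)" using False by (auto simp: addable_def)
  have rx: "(\<exists>x. removable \<kappa> b I x) \<longleftrightarrow> removable \<kappa> b I x"
  proof
    assume "\<exists>x. removable \<kappa> b I x"
    then obtain r where r: "removable \<kappa> b I r" by auto
    then have "r \<le> x \<or> x \<le> r" using EC[of r x] x(1) by (auto simp: removable_def)
    then have "r = x" using r x xI by (auto simp: removable_def order.order_iff_strict)
    then show "removable \<kappa> b I x" using r by simp
  qed auto
  show ?thesis
  proof (cases "removable \<kappa> b I x")
    case True
    then have "?U - I = ?U" by (auto simp: removable_def)
    then show ?thesis using mu U rx na True by (simp add: of_bool_def split: if_splits)
  next
    case r: False
    then obtain z where z: "x < z" "z \<in> I" using xI x(1) by (auto simp: removable_def)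
    obtain c where c: "x < c" "c \<le> z" "adj (\<kappa> c) (\<kappa> x)" using adj_above[OF z(1)] by metis
    then have cU: "c \<in> ?U" "c \<in> I" using x(1) z(2) idealD[OF I] by auto
    then have "card ?U \<noteq> 0" by auto
    then have 1: "card ?U = 1" "b \<noteq> \<kappa> t" using U by (auto simp: of_bool_def split: if_splits)
    obtain w where w: "?U = {w}" using 1(1) by (rule card_1_singletonE)
    then have "c = w" using cU(1) by (simp only: singleton_iff)
    then have "?U - I = {}" unfolding w using cU(2) by simp
    then show ?thesis using mu rx r na 1 by (simp del: Diff_eq_empty_iff)
  qed
next
  case True
  let ?S = "{y. y \<notin> I \<and> \<kappa> y = b}"
  obtain y0 where "y0 \<in> ?S" using True by auto
  then obtain y where yS: "y \<in> ?S" and ym: "\<And>z. z \<in> ?S \<Longrightarrow> \<not> z < y"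
    using finite_minimal[of y0 ?S] by blast
  have y: "y \<notin> I" "\<kappa> y = b" using yS by auto
  have ymin: "y \<le> z" if "z \<in> ?S" for z
    using EC[of y z] ym[of z] that y by (auto simp: order.order_iff_strict)
  let ?L = "{z. z < y \<and> z \<notin> I \<and> adj (\<kappa> z) b}"
  have upI: "z \<notin> I" if "y \<le> z" for z using that idealD[OF I _ that] y by auto
  have "?S = {z. y \<le> z \<and> \<kappa> z = b}" using ymin upI by auto
  moreover have "{z. z \<notin> I \<and> adj (\<kappa> z) b} = {z. y < z \<and> adj (\<kappa> z) b} \<union> ?L"
    using AC[of _ y] y upI by (auto dest: less_imp_le)
  moreover have "card ({z. y < z \<and> adj (\<kappa> z) b} \<union> ?L) = card {z. y < z \<and> adj (\<kappa> z) b} + card ?L"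
    by (intro card_Un_disjoint) auto
  \<comment> \<open>By \<open>color_count_above\<close>, y and all that lies above it contribute -1;
    only elements of adjacent color below y and outside I remain.\<close>
  ultimately have mu: "mu b I = int (card ?L) - 1"
    using color_count_above[of y] y(2) unfolding ideal_mu_card by simp
  have ad: "(\<exists>x. addable \<kappa> b I x) \<longleftrightarrow> ?L = {}"
  proof
    assume "\<exists>x. addable \<kappa> b I x"
    then obtain x where x: "addable \<kappa> b I x" by auto
    then have "y \<le> x" using ymin by (auto simp: addable_def)
    then have "y = x" using x y by (auto simp: addable_def order.order_iff_strict)
    then show "?L = {}" using x by (auto simp: addable_def)
  next
    assume L: "?L = {}"
    have "z \<in> I" if zy: "z < y" for z
    proof (rule ccontr)
      assume z: "z \<notin> I"
      obtain c where c: "c < y" "z \<le> c" "adj (\<kappa> c) (\<kappa> y)" using adj_below[OF zy] by metis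
      then have "c \<in> ?L" using z idealD[OF I] y by auto
      then show False using L by auto
    qed
    then show "\<exists>x. addable \<kappa> b I x" using y by (auto simp: addable_def)
  qed
  show ?thesis
  proof (cases "\<exists>x. x < y \<and> \<kappa> x = \<kappa> y")
    case False
    have "\<not> (\<exists>x. removable \<kappa> b I x)"
      using False EC[of _ y] y upI by (auto simp: removable_def order.order_iff_strict)
    moreover have "card ?L \<le> card {z. z < y \<and> adj (\<kappa> z) (\<kappa> y)}"
      using y by (intro card_mono) auto
    moreover have "card ?L = 0 \<longleftrightarrow> ?L = {}" by (rule card_0_eq) simp
    ultimately have "int (card ?L) = of_bool (?L \<noteq> {})"
      using LCB1[OF False] unfolding of_bool_def by (cases "card ?L = 0") (simp_all del: Collect_empty_eq card_0_eq)
    then show ?thesis using mu \<open>\<not> (\<exists>x. removable \<kappa> b I x)\<close> unfolding ad by simp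
  next
    case True
    then obtain x where x: "x < y" "\<kappa> x = \<kappa> y" "\<not> (\<exists>z. x < z \<and> z < y \<and> \<kappa> z = \<kappa> y)"
      using previous_color by metis
    let ?A = "{z. x < z \<and> z < y \<and> adj (\<kappa> z) b}"
    have A: "card ?A = 2" using ICE2[of x y] x y by auto
    have xI: "x \<in> I" using ymin[of x] x y by (auto simp: less_le_not_le)
    have L: "?L = ?A - I" using AC[of _ x] x(1,2) y idealD[OF I xI] by (auto dest: less_imp_le)
    have re: "(\<exists>x. removable \<kappa> b I x) \<longleftrightarrow> ?A \<inter> I = {}"
    proof
      assume "\<exists>x. removable \<kappa> b I x"
      then obtain r where r: "removable \<kappa> b I r" by auto
      have "r < y" using EC[of r y] r upI y by (auto simp: removable_def order.order_iff_strict)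
      then have "r \<le> x" using EC[of r x] x r y by (auto simp: removable_def order.order_iff_strict)
      then have "r = x" using r xI by (auto simp: removable_def order.order_iff_strict)
      then show "?A \<inter> I = {}" using r by (auto simp: removable_def)
    next
      assume AI: "?A \<inter> I = {}"
      have "z \<notin> I" if xz: "x < z" for z
      proof
        assume z: "z \<in> I"
        obtain c where c: "x < c" "c \<le> z" "adj (\<kappa> c) (\<kappa> x)" using adj_above[OF xz] by metis
        then have "c \<in> I" using z idealD[OF I] by auto
        moreover have "c < y" using AC[of c y] c x upI \<open>c \<in> I\<close> by (auto dest: less_imp_le)
        ultimately show False using AI c x y by auto
      qed
      then show "\<exists>x. removable \<kappa> b I x" using xI x y by (auto simp: removable_def)
    qed
    have "card ?A = card (?A \<inter> I) + card (?A - I)"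
      by (subst card_Un_disjoint[symmetric]) (auto intro: arg_cong[where f = card])
    then have n: "card (?A \<inter> I) + card (?A - I) = 2" using A by simp
    have arith: "int n' - 1 = of_bool (n = 0) - of_bool (n' = 0)" if "n + n' = 2" for n n' :: nat
      using that by (auto simp: of_bool_def)
    have "card (?A \<inter> I) = 0 \<longleftrightarrow> ?A \<inter> I = {}" "card (?A - I) = 0 \<longleftrightarrow> ?A - I = {}"
      by (rule card_0_eq, simp)+
    then show ?thesis using mu arith[OF n] unfolding ad re L by (simp only:)
  qed
qed

section \<open>Injectivity of the Cartan matrix and the order on weights\<close>

definition color_count :: "'p set \<Rightarrow> 'c \<Rightarrow> int" where
  "color_count A k = int (card {y\<in>A. \<kappa> y = k})"

lemma sum_color: "(\<Sum>y\<in>A. g (\<kappa> y)) = (\<Sum>k\<in>UNIV. g k * color_count A k)" for g :: "'c \<Rightarrow> int"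
proof -
  have "(\<Sum>k\<in>UNIV. \<Sum>y\<in>{y\<in>A. \<kappa> y = k}. g (\<kappa> y)) = (\<Sum>y\<in>A. g (\<kappa> y))"
    by (rule sum.group) auto
  moreover have "(\<Sum>y\<in>{y\<in>A. \<kappa> y = k}. g (\<kappa> y)) = g k * color_count A k" for k
    by (simp add: color_count_def mult.commute)
  ultimately show ?thesis by (simp only:)
qed

lemma ideal_mu_cartan:
  "mu i I = of_bool (i = \<kappa> t) - (\<Sum>y\<in>-I. cartan adj i (\<kappa> y))"
  unfolding ideal_mu_def diff_conv_add_uminus sum_negf[symmetric]
  by (intro arg_cong2[where f = "(+)"] refl sum.cong) (auto simp: cartan_def)

lemma ideal_mu_diff:
  "mu i J - mu i I =
     (\<Sum>k\<in>UNIV. cartan adj i k * (color_count J k - color_count I k))"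
proof -
  have "(\<Sum>y\<in>-A. cartan adj i (\<kappa> y)) + (\<Sum>y\<in>A. cartan adj i (\<kappa> y)) = (\<Sum>y\<in>UNIV. cartan adj i (\<kappa> y))" for A
    by (subst sum.union_disjoint[symmetric]) (auto intro!: sum.cong)
  note a = this[of I] this[of J]
  show ?thesis
    using a by (simp add: ideal_mu_cartan sum_color[of "cartan adj i" I] sum_color[of "cartan adj i" J]
        right_diff_distrib sum_subtractf)
qed

text \<open>Nothing can be removed from the empty ideal, so mu is at most 0 there; compare with its
  value at P.\<close>

lemma cartan_color_count:
  "of_bool (i = \<kappa> t) \<le> (\<Sum>k\<in>UNIV. cartan adj i k * color_count UNIV k)"
proof -
  have "mu i {} \<le> 0"
    by (subst ideal_mu_eq) (auto simp: order_ideals_def removable_def)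
  then show ?thesis
    using ideal_mu_diff[of i UNIV "{}"] by (simp add: ideal_mu_UNIV color_count_def)
qed

lemma color_count_pos: "0 < color_count UNIV k"
  using surj_color[of k] by (auto simp: color_count_def card_gt_0_iff)

text \<open>
  The color counts \<open>c\<close> of \<open>P\<close> are a positive vector with \<open>\<theta> c \<ge> 0\<close> and \<open>\<theta> c \<noteq> 0\<close>.
  A kernel vector of \<open>\<theta>\<close> whose ratio to \<open>c\<close> has a positive maximum would, by connectedness,
  be a multiple of \<open>c\<close>.
\<close>

lemma cartan_kernel_nonpos:
  assumes u: "\<And>i. (\<Sum>k\<in>UNIV. cartan adj i k * u k) = 0"
  shows "u k \<le> 0"
proof (rule ccontr)
  assume "\<not> u k \<le> 0"
  define c where "c k = real_of_int (color_count UNIV k)" for k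
  have cpos: "c k > 0" for k using color_count_pos by (simp add: c_def)
  define r where "r = Max (range (\<lambda>k. real_of_int (u k) / c k))"
  have r: "real_of_int (u k) / c k \<le> r" for k unfolding r_def by (rule Max_ge) auto
  have "0 < real_of_int (u k) / c k" using \<open>\<not> u k \<le> 0\<close> cpos by simp
  then have rpos: "r > 0" using r[of k] by linarith
  define d where "d k = r * c k - real_of_int (u k)" for k
  have d: "d k \<ge> 0" for k using r[of k] cpos[of k] by (simp add: d_def field_simps)
  have "r \<in> range (\<lambda>k. real_of_int (u k) / c k)" unfolding r_def by (rule Max_in) auto
  then obtain k0 where "r = real_of_int (u k0) / c k0" by auto
  then have k0: "d k0 = 0" using cpos[of k0] by (simp add: d_def field_simps)
  \<comment> \<open>Since u lies in the kernel, d and r c have the same image under the Cartan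
    matrix. That image is nonnegative, and at least r at the color of t.\<close>
  have ineq: "r * of_bool (i = \<kappa> t) \<le> 2 * d i - (\<Sum>k\<in>{k. adj i k}. d k)" for i
  proof -
    have "real_of_int (of_bool (i = \<kappa> t)) \<le> (\<Sum>k\<in>UNIV. real_of_int (cartan adj i k) * c k)"
      using cartan_color_count[of i] unfolding c_def of_int_mult[symmetric] of_int_sum[symmetric]
      by (simp only: of_int_le_iff)
    then have "r * of_bool (i = \<kappa> t) \<le> r * (\<Sum>k\<in>UNIV. real_of_int (cartan adj i k) * c k)"
      using rpos by (simp add: mult_left_mono)
    also have "(\<Sum>k\<in>UNIV. real_of_int (cartan adj i k) * real_of_int (u k)) = 0"
      using u[of i] unfolding of_int_mult[symmetric] of_int_sum[symmetric] by simp
    then have "r * (\<Sum>k\<in>UNIV. real_of_int (cartan adj i k) * c k) =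
        (\<Sum>k\<in>UNIV. real_of_int (cartan adj i k) * d k)"
      by (simp add: d_def right_diff_distrib sum_subtractf sum_distrib_left mult_ac)
    also have "\<dots> = (\<Sum>k\<in>UNIV. (if k = i then 2 * d k else 0) + (if adj i k then - d k else 0))"
      by (intro sum.cong) (auto simp: cartan_def)
    also have "\<dots> = 2 * d i - (\<Sum>k\<in>{k. adj i k}. d k)"
      by (simp add: sum.distrib sum.delta sum.If_cases sum_negf)
    finally show ?thesis .
  qed
  \<comment> \<open>As d is nonnegative, a zero of d forces zeros at all adjacent colors; NA carries
    this along the covers of P.\<close>
  have step: "d k = 0 \<and> i \<noteq> \<kappa> t" if "d i = 0" "adj i k" for i k
  proof -
    have "d k \<le> (\<Sum>k\<in>{k. adj i k}. d k)" using that(2) d by (intro member_le_sum) auto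
    then show ?thesis using ineq[of i] that(1) d[of k] rpos by (cases "i = \<kappa> t") auto
  qed
  have "d (\<kappa> x) = 0" for x
  proof -
    obtain x0 where x0: "\<kappa> x0 = k0" using surj_color by blast
    have "(x0, x) \<in> {(u, v). covered_by u v \<or> covered_by v u}\<^sup>*"
      using conn by (auto simp: connected_poset_def)
    then show ?thesis
    proof (induction rule: rtrancl_induct)
      case base
      show ?case using k0 x0 by simp
    next
      case (step y z)
      then show ?case using \<open>\<And>k i. d i = 0 \<Longrightarrow> adj i k \<Longrightarrow> d k = 0 \<and> i \<noteq> \<kappa> t\<close> NA adj_sym by blast
    qed
  qed
  then have "d k = 0" for k using surj_color by metis
  \<comment> \<open>Now d = 0 throughout, whereas the row of the color of t would need r to be at
    most 0.\<close>
  then show False using ineq[of "\<kappa> t"] rpos by simp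
qed

lemma cartan_kernel:
  assumes "\<And>i. (\<Sum>k\<in>UNIV. cartan adj i k * u k) = 0"
  shows "u k = 0"
  using cartan_kernel_nonpos[of u k] cartan_kernel_nonpos[of "\<lambda>k. - u k" k] assms
  by (simp add: sum_negf)

text \<open>The multiplicities of the list would be a kernel vector of the Cartan matrix. In terms
  of roots: no nonempty sum of simple roots is zero.\<close>

lemma sum_cartan_list_nonzero:
  assumes "as \<noteq> []"
  shows "\<exists>i. (\<Sum>a\<leftarrow>as. cartan adj i a) \<noteq> 0"
proof (rule ccontr)
  assume *: "\<not> ?thesis"
  have e: "(\<Sum>a\<leftarrow>as. cartan adj i a) = (\<Sum>k\<in>UNIV. cartan adj i k * int (count_list as k))" for i
  proof (induction as)
    case (Cons a as)
    have "(\<Sum>k\<in>UNIV. cartan adj i k * int (count_list (a # as) k)) =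
        (\<Sum>k\<in>UNIV. cartan adj i k * int (count_list as k) + (if k = a then cartan adj i k else 0))"
      by (intro sum.cong) (auto simp: algebra_simps)
    then show ?case using Cons by (simp add: sum.distrib sum.delta)
  qed simp
  have "count_list as k = 0" for k
    using cartan_kernel[of "\<lambda>k. int (count_list as k)" k] * by (simp add: e)
  moreover have "count_list as (hd as) \<noteq> 0" using assms by (cases as) auto
  ultimately show False by metis
qed

text \<open>Elements of one color form a chain by EC, and an ideal meets it in an initial segment,
  which is determined by its size.\<close>

lemma ideal_subset_iff_count:
  assumes I: "I \<in> order_ideals" and J: "J \<in> order_ideals"
  shows "I \<subseteq> J \<longleftrightarrow> (\<forall>k. color_count I k \<le> color_count J k)"
proof
  assume "I \<subseteq> J"
  then show "\<forall>k. color_count I k \<le> color_count J k"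
    by (auto simp: color_count_def intro!: card_mono)
next
  assume le: "\<forall>k. color_count I k \<le> color_count J k"
  show "I \<subseteq> J"
  proof (rule ccontr)
    assume "\<not> I \<subseteq> J"
    then obtain x where x: "x \<in> I" "x \<notin> J" by auto
    have "{y\<in>J. \<kappa> y = \<kappa> x} \<subset> {y\<in>I. \<kappa> y = \<kappa> x}"
      using EC[of x] idealD[OF I x(1)] idealD[OF J] x by auto metis
    then have "color_count J (\<kappa> x) < color_count I (\<kappa> x)"
      by (simp add: color_count_def psubset_card_mono)
    then show False using le by (meson not_less)
  qed
qed

text \<open>The difference of two weights is the Cartan matrix applied to the difference of color
  counts. Injectivity forces the coefficients in \<open>weight_le\<close> to be these
  differences.\<close>

lemma weight_le_iff:
  assumes I: "I \<in> order_ideals" and J: "J \<in> order_ideals"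
  shows "weight_le adj (iw I) (iw J) \<longleftrightarrow> I \<subseteq> J"
proof -
  have "weight_le adj (iw I) (iw J) \<longleftrightarrow>
      (\<exists>n :: 'c \<Rightarrow> nat. \<forall>i. mu i J - mu i I =
        (\<Sum>k\<in>UNIV. cartan adj i k * int (n k)))"
  proof -
    have "of_int (mu i J) - of_int (mu i I) =
          (\<Sum>k\<in>UNIV. of_nat (n k) * simple_root adj k i) \<longleftrightarrow>
        mu i J - mu i I =
        (\<Sum>k\<in>UNIV. cartan adj i k * int (n k))" for n :: "'c \<Rightarrow> nat" and i
    proof -
      have "(\<Sum>k\<in>UNIV. of_nat (n k) * simple_root adj k i) =
          of_int (\<Sum>k\<in>UNIV. cartan adj i k * int (n k))"
        by (simp add: simple_root_def mult.commute)
      then show ?thesis by (simp only: of_int_diff[symmetric] of_int_eq_iff)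
    qed
    then show ?thesis by (simp add: weight_le_def ideal_weight_def)
  qed
  also have "\<dots> \<longleftrightarrow> (\<exists>n :: 'c \<Rightarrow> nat. \<forall>k. color_count J k - color_count I k = int (n k))"
  proof (intro ex_cong1 iffI allI)
    fix n :: "'c \<Rightarrow> nat" and k
    assume "\<forall>i. mu i J - mu i I =
        (\<Sum>k\<in>UNIV. cartan adj i k * int (n k))"
    then have "(\<Sum>k\<in>UNIV. cartan adj i k * (color_count J k - color_count I k - int (n k))) = 0" for i
      by (simp add: ideal_mu_diff right_diff_distrib sum_subtractf)
    from cartan_kernel[OF this] show "color_count J k - color_count I k = int (n k)"
      by (metis eq_iff_diff_eq_0)
  qed (simp add: ideal_mu_diff)
  also have "\<dots> \<longleftrightarrow> (\<forall>k. color_count I k \<le> color_count J k)"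
  proof
    assume "\<forall>k. color_count I k \<le> color_count J k"
    then show "\<exists>n :: 'c \<Rightarrow> nat. \<forall>k. color_count J k - color_count I k = int (n k)"
      by (intro exI[of _ "\<lambda>k. nat (color_count J k - color_count I k)"]) simp
  next
    assume "\<exists>n :: 'c \<Rightarrow> nat. \<forall>k. color_count J k - color_count I k = int (n k)"
    then show "\<forall>k. color_count I k \<le> color_count J k"
      by (metis diff_ge_0_iff_ge of_nat_0_le_iff)
  qed
  finally show ?thesis using ideal_subset_iff_count[OF I J] by simp
qed

lemma ideal_weight_inj:
  assumes "I \<in> order_ideals" "J \<in> order_ideals"
    and "iw I = iw J"
  shows "I = J"
  using weight_le_iff[of I J] weight_le_iff[of J I] weight_le_iff[of I I] assms by auto

end

section \<open>The representation on order ideals\<close>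

context minuscule_poset
begin

text \<open>
  The operators of the representation, extended by zero to the sets that are not order ideals,
  so that the Chevalley--Serre relations hold on all formal combinations of sets.
\<close>

definition yo :: "'c \<Rightarrow> ('p set \<Rightarrow>\<^sub>0 complex) \<Rightarrow> ('p set \<Rightarrow>\<^sub>0 complex)" where
  "yo b = lin_ext (\<lambda>I. if I \<in> order_ideals \<and> (\<exists>x. removable \<kappa> b I x)
     then bas (I - {THE x. removable \<kappa> b I x}) else 0)"

definition xo :: "'c \<Rightarrow> ('p set \<Rightarrow>\<^sub>0 complex) \<Rightarrow> ('p set \<Rightarrow>\<^sub>0 complex)" where
  "xo b = lin_ext (\<lambda>I. if I \<in> order_ideals \<and> (\<exists>x. addable \<kappa> b I x)
     then bas (insert (THE x. addable \<kappa> b I x) I) else 0)"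

definition ho :: "'c \<Rightarrow> ('p set \<Rightarrow>\<^sub>0 complex) \<Rightarrow> ('p set \<Rightarrow>\<^sub>0 complex)" where
  "ho b = lin_ext (\<lambda>I. if I \<in> order_ideals then pscale (of_int (mu b I)) (bas I) else 0)"

lemma plin_ops: "plin (yo b)" "plin (xo b)" "plin (ho b)"
  unfolding yo_def xo_def ho_def by (rule plin_lin_ext)+

lemma adj_above_ex: "x < y \<Longrightarrow> \<exists>c. x < c \<and> c \<le> y \<and> adj (\<kappa> c) (\<kappa> x)"
  by (erule adj_above) blast

lemma removable_not_above: "removable \<kappa> b I x \<Longrightarrow> x < z \<Longrightarrow> z \<notin> I"
  by (simp add: removable_def)

lemma removable_mem: "removable \<kappa> b I x \<Longrightarrow> x \<in> I"
  by (simp add: removable_def)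

lemma removable_color: "removable \<kappa> b I x \<Longrightarrow> \<kappa> x = b"
  by (simp add: removable_def)

lemma removable_unique: "removable \<kappa> b I x \<Longrightarrow> removable \<kappa> b I y \<Longrightarrow> x = y"
  using EC[of x y] by (auto simp: removable_def order.order_iff_strict)

lemma addable_unique: "addable \<kappa> b I x \<Longrightarrow> addable \<kappa> b I y \<Longrightarrow> x = y"
  using EC[of x y] by (auto simp: addable_def order.order_iff_strict)

lemma removable_ideal: "I \<in> order_ideals \<Longrightarrow> removable \<kappa> b I x \<Longrightarrow> I - {x} \<in> order_ideals"
  by (auto simp: order_ideals_def removable_def order.order_iff_strict)

lemma addable_ideal: "I \<in> order_ideals \<Longrightarrow> addable \<kappa> b I x \<Longrightarrow> insert x I \<in> order_ideals"
  by (auto simp: order_ideals_def addable_def order.order_iff_strict)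

lemma removable_addable: "removable \<kappa> b I x \<Longrightarrow> I \<in> order_ideals \<Longrightarrow> addable \<kappa> b (I - {x}) x"
  by (auto simp: removable_def addable_def order_ideals_def dest: less_imp_le)

lemma addable_removable: "addable \<kappa> b I x \<Longrightarrow> I \<in> order_ideals \<Longrightarrow> removable \<kappa> b (insert x I) x"
  by (auto simp: removable_def addable_def order_ideals_def dest: less_imp_le)

text \<open>Above x and strictly below y there would be an element of adjacent color, which lies in
  I because y is addable and not in I because x is removable.\<close>

lemma not_removable_addable: "removable \<kappa> b I x \<Longrightarrow> addable \<kappa> b I y \<Longrightarrow> I \<in> order_ideals \<Longrightarrow> False"
proof -
  assume x: "removable \<kappa> b I x" and y: "addable \<kappa> b I y" and I: "I \<in> order_ideals"
  have "\<not> y \<le> x" using x y idealD[OF I] by (auto simp: removable_def addable_def)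
  then have "x < y" using EC[of x y] x y by (auto simp: removable_def addable_def order.order_iff_strict)
  from adj_above_ex[OF this] obtain c where c: "x < c" "c \<le> y" "adj (\<kappa> c) (\<kappa> x)" by blast
  then have "c \<noteq> y" using x y by (auto simp: removable_def addable_def)
  then show False using c x y by (auto simp: removable_def addable_def order.order_iff_strict)
qed

lemma yo_bas: "I \<in> order_ideals \<Longrightarrow> removable \<kappa> b I x \<Longrightarrow> yo b (bas I) = bas (I - {x})"
  using removable_unique by (auto simp: yo_def the_equality)

lemma xo_bas: "I \<in> order_ideals \<Longrightarrow> addable \<kappa> b I x \<Longrightarrow> xo b (bas I) = bas (insert x I)"
  using addable_unique by (auto simp: xo_def the_equality)

lemma ho_bas: "I \<in> order_ideals \<Longrightarrow> ho b (bas I) = pscale (of_int (mu b I)) (bas I)"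
  by (simp add: ho_def)

lemma yo_bas_0: "\<not> (\<exists>x. removable \<kappa> b I x) \<Longrightarrow> yo b (bas I) = 0"
  by (auto simp: yo_def)

lemma xo_bas_0: "\<not> (\<exists>x. addable \<kappa> b I x) \<Longrightarrow> xo b (bas I) = 0"
  by (auto simp: xo_def)

lemma ops_nonideal:
  "I \<notin> order_ideals \<Longrightarrow> yo b (bas I) = 0" "I \<notin> order_ideals \<Longrightarrow> xo b (bas I) = 0"
  "I \<notin> order_ideals \<Longrightarrow> ho b (bas I) = 0"
  by (simp_all add: yo_def xo_def ho_def)

lemma plin_if: "plin f \<Longrightarrow> plin (\<lambda>v. if b then f v else 0)"
  by (cases b) (simp_all add: plin_const0)

lemma plin_eqI':
  assumes "plin f" "plin g" "\<And>I. I \<in> order_ideals \<Longrightarrow> f (bas I) = g (bas I)"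
    "\<And>I. I \<notin> order_ideals \<Longrightarrow> f (bas I) = g (bas I)"
  shows "f v = g v"
proof (rule plin_eqI[OF assms(1,2)])
  fix I show "f (bas I) = g (bas I)" using assms(3,4) by (cases "I \<in> order_ideals")
qed

lemma lookup_xo: "lk (xo b (bas I)) J =
    of_bool (I \<in> order_ideals \<and> (\<exists>x. addable \<kappa> b I x \<and> J = insert x I))"
proof (cases "I \<in> order_ideals \<and> (\<exists>x. addable \<kappa> b I x)")
  case True
  then obtain x where "addable \<kappa> b I x" "I \<in> order_ideals" by auto
  then show ?thesis using addable_unique by (auto simp: xo_bas lookup_single when_def)
qed (auto simp: xo_bas_0 ops_nonideal)

lemma lookup_yo: "lk (yo b (bas I)) J =
    of_bool (I \<in> order_ideals \<and> (\<exists>x. removable \<kappa> b I x \<and> J = I - {x}))"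
proof (cases "I \<in> order_ideals \<and> (\<exists>x. removable \<kappa> b I x)")
  case True
  then obtain x where "removable \<kappa> b I x" "I \<in> order_ideals" by auto
  then show ?thesis using removable_unique by (auto simp: yo_bas lookup_single when_def)
qed (auto simp: yo_bas_0 ops_nonideal)

text \<open>Removing and adding an element are inverse moves between ideals, so the two matrices are
  transposes of each other.\<close>

lemma herm_yo: "herm (\<lambda>_. 1) (yo b u) v = herm (\<lambda>_. 1) u (xo b v)"
proof (rule herm_adjointI[OF plin_ops(1,2)])
  fix I J
  have "(I \<in> order_ideals \<and> (\<exists>x. removable \<kappa> b I x \<and> J = I - {x})) \<longleftrightarrow>
      (J \<in> order_ideals \<and> (\<exists>x. addable \<kappa> b J x \<and> I = insert x J))"
  proof
    assume "I \<in> order_ideals \<and> (\<exists>x. removable \<kappa> b I x \<and> J = I - {x})"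
    then obtain x where x: "I \<in> order_ideals" "removable \<kappa> b I x" "J = I - {x}" by auto
    then have "I = insert x J" by (auto simp: removable_def)
    moreover have "J \<in> order_ideals" "addable \<kappa> b J x"
      using removable_ideal[OF x(1,2)] removable_addable[OF x(2,1)] x(3) by simp_all
    ultimately show "J \<in> order_ideals \<and> (\<exists>x. addable \<kappa> b J x \<and> I = insert x J)"
      by (intro conjI exI[of _ x])
  next
    assume "J \<in> order_ideals \<and> (\<exists>x. addable \<kappa> b J x \<and> I = insert x J)"
    then obtain x where x: "J \<in> order_ideals" "addable \<kappa> b J x" "I = insert x J" by auto
    then have "J = I - {x}" by (auto simp: addable_def)
    moreover have "I \<in> order_ideals" "removable \<kappa> b I x"
      using addable_ideal[OF x(1,2)] addable_removable[OF x(2,1)] x(3) by simp_all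
    ultimately show "I \<in> order_ideals \<and> (\<exists>x. removable \<kappa> b I x \<and> J = I - {x})"
      by (intro conjI exI[of _ x])
  qed
  then show "herm (\<lambda>_. 1) (yo b (bas I)) (bas J) = herm (\<lambda>_. 1) (bas I) (xo b (bas J))"
    by (simp add: herm_bas_left herm_bas_right lookup_xo lookup_yo)
qed

lemma herm_xo: "herm (\<lambda>_. 1) (xo b u) v = herm (\<lambda>_. 1) u (yo b v)"
  using herm_yo[of b v u] herm_cnj by metis

text \<open>Transfers the relations among the lowering operators to their adjoints.\<close>

lemma eq_by_herm: "(\<And>w. herm (\<lambda>_. 1) u w = herm (\<lambda>_. 1) v w) \<Longrightarrow> u = v"
  by (rule poly_mapping_eqI) (metis herm_bas_right mult_1 of_nat_1)

text \<open>A lower element of the same color has above it an element of adjacent color, hence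
  different from x, that is still in the ideal.\<close>

lemma yo_yo: "yo a (yo a v) = 0"
proof (rule plin_eqI'[of "\<lambda>v. yo a (yo a v)" "\<lambda>_. 0"])
  fix I :: "'p set" assume I: "I \<in> order_ideals"
  show "yo a (yo a (bas I)) = 0"
  proof (cases "\<exists>x. removable \<kappa> a I x")
    case True
    then obtain x where x: "removable \<kappa> a I x" by auto
    have "\<not> removable \<kappa> a (I - {x}) y" for y
    proof
      assume y: "removable \<kappa> a (I - {x}) y"
      then have "y < x" using EC[of x y] x by (auto simp: removable_def order.order_iff_strict)
      from adj_above_ex[OF this] obtain c where c: "y < c" "c \<le> x" "adj (\<kappa> c) (\<kappa> y)" by blast
      have "\<kappa> x = \<kappa> y" using x y by (simp add: removable_def)
      then have "c \<noteq> x" using c(3) adj_irrefl by metis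
      moreover have "x \<in> I" using x by (simp add: removable_def)
      then have "c \<in> I" using idealD[OF I _ c(2)] by simp
      ultimately have "c \<in> I - {x}" by simp
      then show False using removable_not_above[OF y c(1)] by simp
    qed
    then show ?thesis using x I by (simp add: yo_bas yo_bas_0)
  qed (simp add: yo_bas_0 plin_zero[OF plin_ops(1)])
qed (simp_all add: plin_const0 plin_compose plin_ops ops_nonideal plin_zero[OF plin_ops(1)])

text \<open>Between consecutive elements of color a, ICE2 requires two elements of adjacent color to
  be gone, but only one has been removed.\<close>

lemma yo_yo_yo:
  assumes ab: "adj a b"
  shows "yo a (yo b (yo a v)) = 0"
proof (rule plin_eqI'[of "\<lambda>v. yo a (yo b (yo a v))" "\<lambda>_. 0"])
  fix I :: "'p set" assume I: "I \<in> order_ideals"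
  show "yo a (yo b (yo a (bas I))) = 0"
  proof (cases "\<exists>x z. removable \<kappa> a I x \<and> removable \<kappa> b (I - {x}) z")
    case True
    then obtain x z where x: "removable \<kappa> a I x" and z: "removable \<kappa> b (I - {x}) z" by auto
    have "\<not> removable \<kappa> a (I - {x} - {z}) w" for w
    proof
      assume w: "removable \<kappa> a (I - {x} - {z}) w"
      then have wx: "w < x" using EC[of x w] x by (auto simp: removable_def order.order_iff_strict)
      have ba: "a \<noteq> b" using ab by auto
      have mem: "u = z" if "w < u" "u < x" for u
        using idealD[OF I, of x u] that less_imp_le[OF that(2)] x w by (auto simp: removable_def)
      have col: "\<kappa> w = a" "\<kappa> x = a" "\<kappa> z = b" using w x z by (simp_all add: removable_def)
      have "\<kappa> u \<noteq> \<kappa> w" if "w < u" "u < x" for u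
        using mem[OF that] col ba by simp
      then have "card {u. w < u \<and> u < x \<and> adj (\<kappa> u) (\<kappa> w)} = 2"
        using col by (intro ICE2[OF wx]) auto
      moreover have "card {u. w < u \<and> u < x \<and> adj (\<kappa> u) (\<kappa> w)} \<le> card {z}"
        using mem by (intro card_mono) auto
      ultimately show False by simp
    qed
    then show ?thesis using x z I by (simp add: yo_bas yo_bas_0 removable_ideal)
  next
    case False
    show ?thesis
    proof (cases "\<exists>x. removable \<kappa> a I x")
      case True
      then obtain x where x: "removable \<kappa> a I x" by auto
      then show ?thesis using False I by (auto simp: yo_bas yo_bas_0 plin_zero[OF plin_ops(1)])
    qed (simp add: yo_bas_0 plin_zero[OF plin_ops(1)])
  qed
qed (simp_all add: plin_const0 plin_compose[OF plin_ops(1) plin_compose[OF plin_ops(1) plin_ops(1)]]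
    ops_nonideal plin_zero[OF plin_ops(1)])

text \<open>If y were below x, the element covering y on the way to x would have to be x itself, and
  the colors would be adjacent by NA.\<close>

lemma removable_commute:
  assumes I: "I \<in> order_ideals" and ab: "a \<noteq> b" "\<not> adj a b"
    and x: "removable \<kappa> b I x" and y: "removable \<kappa> a (I - {x}) y"
  shows "removable \<kappa> a I y" "removable \<kappa> b (I - {y}) x"
proof -
  have "\<not> y < x"
  proof
    assume "y < x"
    from adj_above_ex[OF this] obtain c where c: "y < c" "c \<le> x" "adj (\<kappa> c) (\<kappa> y)" by blast
    have "c \<in> I" using idealD[OF I removable_mem[OF x] c(2)] .
    then have "c = x" using removable_not_above[OF y c(1)] by simp
    then have "adj b a" using c(3) removable_color[OF x] removable_color[OF y] by simp
    then show False using ab adj_sym by simp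
  qed
  then show "removable \<kappa> a I y" using y by (auto simp: removable_def)
  show "removable \<kappa> b (I - {y}) x" using x y ab by (auto simp: removable_def)
qed

lemma yo_commute:
  assumes ab: "a \<noteq> b" "\<not> adj a b"
  shows "yo a (yo b v) = yo b (yo a v)"
proof (rule plin_eqI'[of "\<lambda>v. yo a (yo b v)" "\<lambda>v. yo b (yo a v)"])
  fix I :: "'p set" assume I: "I \<in> order_ideals"
  have both: "yo a (yo b (bas I)) = bas (I - {x} - {y})"
    if "removable \<kappa> b I x" "removable \<kappa> a (I - {x}) y" for a b x y
    using that I by (simp add: yo_bas removable_ideal)
  have none: "yo a (yo b (bas I)) = 0"
    if no: "\<not> (\<exists>x y. removable \<kappa> b I x \<and> removable \<kappa> a (I - {x}) y)" for a b
  proof (cases "\<exists>x. removable \<kappa> b I x")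
    case True
    then obtain x where x: "removable \<kappa> b I x" by auto
    then show ?thesis using no I by (auto simp: yo_bas yo_bas_0)
  qed (simp add: yo_bas_0 plin_zero[OF plin_ops(1)])
  show "yo a (yo b (bas I)) = yo b (yo a (bas I))"
  proof (cases "\<exists>x y. removable \<kappa> b I x \<and> removable \<kappa> a (I - {x}) y")
    case True
    then obtain x y where xy: "removable \<kappa> b I x" "removable \<kappa> a (I - {x}) y" by auto
    from removable_commute[OF I ab xy] show ?thesis
      using both[OF xy] both[of a y b x] by (simp add: insert_commute Diff_insert[symmetric])
  next
    case False
    moreover have "\<not> (\<exists>x y. removable \<kappa> a I x \<and> removable \<kappa> b (I - {x}) y)"
      using False removable_commute[OF I, of b a] ab adj_sym by metis
    ultimately show ?thesis using none by metis
  qed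
qed (simp_all add: plin_compose plin_ops ops_nonideal plin_zero[OF plin_ops(1)])

lemma xo_xo: "xo a (xo a v) = 0"
  by (rule eq_by_herm) (simp add: herm_xo yo_yo del: One_nat_def)

lemma xo_xo_xo: "adj a b \<Longrightarrow> xo a (xo b (xo a v)) = 0"
  by (rule eq_by_herm) (simp add: herm_xo yo_yo_yo del: One_nat_def)

lemma xo_commute: "a \<noteq> b \<Longrightarrow> \<not> adj a b \<Longrightarrow> xo a (xo b v) = xo b (xo a v)"
  by (rule eq_by_herm) (simp add: herm_xo yo_commute[of a b] del: One_nat_def)

text \<open>For equal colors both products are diagonal and their difference is mu by
  \<open>ideal_mu_eq\<close>. For different colors the two moves can be interchanged: in either
  order they are possible only if x is not below y.\<close>

lemma xo_yo: "xo a (yo b v) - yo b (xo a v) = (if a = b then ho a v else 0)"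
proof (rule plin_eqI'[of "\<lambda>v. xo a (yo b v) - yo b (xo a v)" "\<lambda>v. if a = b then ho a v else 0"])
  fix I :: "'p set" assume I: "I \<in> order_ideals"
  show "xo a (yo b (bas I)) - yo b (xo a (bas I)) = (if a = b then ho a (bas I) else 0)"
  proof (cases "a = b")
    case True
    have 1: "xo a (yo a (bas I)) = pscale (of_bool (\<exists>x. removable \<kappa> a I x)) (bas I)"
    proof (cases "\<exists>x. removable \<kappa> a I x")
      case True
      then obtain x where x: "removable \<kappa> a I x" by auto
      then have "insert x (I - {x}) = I" by (auto simp: removable_def)
      then show ?thesis
        using x I xo_bas[OF removable_ideal removable_addable] by (auto simp: yo_bas)
    qed (simp add: yo_bas_0 plin_zero[OF plin_ops(2)])
    have 2: "yo a (xo a (bas I)) = pscale (of_bool (\<exists>x. addable \<kappa> a I x)) (bas I)"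
    proof (cases "\<exists>x. addable \<kappa> a I x")
      case True
      then obtain x where x: "addable \<kappa> a I x" by auto
      then have "insert x I - {x} = I" by (auto simp: addable_def)
      then show ?thesis
        using x I yo_bas[OF addable_ideal addable_removable] by (auto simp: xo_bas)
    qed (simp add: xo_bas_0 plin_zero[OF plin_ops(1)])
    show ?thesis unfolding True[symmetric] 1 2
      using I by (simp add: ho_bas ideal_mu_eq flip: pm.scale_left_diff_distrib)
  next
    case ab: False
    have eq: "removable \<kappa> b I x \<and> addable \<kappa> a (I - {x}) y \<longleftrightarrow>
        addable \<kappa> a I y \<and> removable \<kappa> b (insert y I) x" for x y
      using ab by (auto simp: removable_def addable_def)
    show ?thesis
    proof (cases "\<exists>x y. removable \<kappa> b I x \<and> addable \<kappa> a (I - {x}) y")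
      case True
      then obtain x y where xy: "removable \<kappa> b I x" "addable \<kappa> a (I - {x}) y" by auto
      with eq have yx: "addable \<kappa> a I y" "removable \<kappa> b (insert y I) x" by auto
      have "insert y (I - {x}) = insert y I - {x}"
        using xy ab by (auto simp: removable_def addable_def)
      then show ?thesis using xy yx I ab
        by (simp add: xo_bas yo_bas removable_ideal addable_ideal)
    next
      case False
      have "xo a (yo b (bas I)) = 0"
      proof (cases "\<exists>x. removable \<kappa> b I x")
        case True
        then obtain x where x: "removable \<kappa> b I x" by auto
        then show ?thesis using False I by (auto simp: yo_bas xo_bas_0)
      qed (simp add: yo_bas_0 plin_zero[OF plin_ops(2)])
      moreover have "yo b (xo a (bas I)) = 0"
      proof (cases "\<exists>x. addable \<kappa> a I x")
        case True
        then obtain x where x: "addable \<kappa> a I x" by auto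
        then have "\<not> (\<exists>z. removable \<kappa> b (insert x I) z)" using False eq by blast
        then show ?thesis using x I by (simp add: xo_bas yo_bas_0)
      qed (simp add: xo_bas_0 plin_zero[OF plin_ops(1)])
      ultimately show ?thesis using ab by simp
    qed
  qed
qed (simp_all add: plin_minus plin_if plin_compose plin_ops ops_nonideal
    plin_zero[OF plin_ops(1)] plin_zero[OF plin_ops(2)])

lemma mu_insert: "y \<notin> I \<Longrightarrow> mu a (insert y I) = mu a I + cartan adj a (\<kappa> y)"
  using ideal_mu_remove[of y I adj \<kappa> "\<kappa> t" a] by (auto simp: cartan_def)

lemma ho_ho: "ho a (ho b v) = ho b (ho a v)"
  by (rule plin_eqI'[of "\<lambda>v. ho a (ho b v)" "\<lambda>v. ho b (ho a v)"])
    (simp_all add: plin_compose plin_ops ops_nonideal plin_zero[OF plin_ops(3)] ho_bas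
      plin_scale[OF plin_ops(3)] mult.commute)

lemma ho_xo: "ho a (xo b v) - xo b (ho a v) = pscale (of_int (cartan adj a b)) (xo b v)"
proof (rule plin_eqI'[of "\<lambda>v. ho a (xo b v) - xo b (ho a v)"])
  fix I :: "'p set" assume I: "I \<in> order_ideals"
  show "ho a (xo b (bas I)) - xo b (ho a (bas I)) = pscale (of_int (cartan adj a b)) (xo b (bas I))"
  proof (cases "\<exists>x. addable \<kappa> b I x")
    case True
    then obtain x where x: "addable \<kappa> b I x" by auto
    then have "mu a (insert x I) = mu a I + cartan adj a b"
      by (subst mu_insert) (auto simp: addable_def)
    then show ?thesis using x I addable_ideal[OF I x]
      by (simp add: xo_bas ho_bas plin_scale[OF plin_ops(2)] pm.scale_left_distrib)
  qed (simp add: xo_bas_0 plin_zero[OF plin_ops(3)] ho_bas[OF I] plin_scale[OF plin_ops(2)])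
qed (simp_all add: plin_minus plin_cscale plin_compose plin_ops ops_nonideal
    plin_zero[OF plin_ops(3)] plin_zero[OF plin_ops(2)])

lemma ho_yo: "ho a (yo b v) - yo b (ho a v) = pscale (- of_int (cartan adj a b)) (yo b v)"
proof (rule plin_eqI'[of "\<lambda>v. ho a (yo b v) - yo b (ho a v)"])
  fix I :: "'p set" assume I: "I \<in> order_ideals"
  show "ho a (yo b (bas I)) - yo b (ho a (bas I)) = pscale (- of_int (cartan adj a b)) (yo b (bas I))"
  proof (cases "\<exists>x. removable \<kappa> b I x")
    case True
    then obtain x where x: "removable \<kappa> b I x" by auto
    then have "mu a I = mu a (I - {x}) + cartan adj a b"
      using mu_insert[of x "I - {x}" a] by (auto simp: removable_def insert_absorb)
    then show ?thesis using x I removable_ideal[OF I x]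
      by (simp add: yo_bas ho_bas plin_scale[OF plin_ops(1)] plin_add[OF plin_ops(1)] pm.scale_left_distrib)
  qed (simp add: yo_bas_0 plin_zero[OF plin_ops(3)] ho_bas[OF I] plin_scale[OF plin_ops(1)])
qed (simp_all add: plin_minus plin_cscale plin_compose plin_ops ops_nonideal
    plin_zero[OF plin_ops(3)] plin_zero[OF plin_ops(1)] del: pm.scale_minus_left)

section \<open>The action of \<open>G\<close> on ideals\<close>

fun term_op :: "'c lie_term \<Rightarrow> ('p set \<Rightarrow>\<^sub>0 complex) \<Rightarrow> ('p set \<Rightarrow>\<^sub>0 complex)" where
  "term_op (TX a) = xo a"
| "term_op (TY a) = yo a"
| "term_op (TH a) = ho a"
| "term_op TZero = (\<lambda>v. 0)"
| "term_op (TAdd s s') = (\<lambda>v. term_op s v + term_op s' v)"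
| "term_op (TScale c s) = (\<lambda>v. pscale c (term_op s v))"
| "term_op (TBrk s s') = (\<lambda>v. term_op s (term_op s' v) - term_op s' (term_op s v))"

lemma plin_term_op: "plin (term_op s)"
  by (induction s) (simp_all add: plin_ops plin_const0 plin_plus plin_cscale plin_minus plin_compose)

lemma term_op_cong: "serre_eq adj s s' \<Longrightarrow> term_op s = term_op s'"
proof (induction rule: serre_eq.induct)
  \<comment> \<open>For adjacent colors each term of the double commutator contains a square or a
    pattern a b a, both zero. Otherwise the relation is a single commutator.\<close>
  case (rel_xx i k)
  then show ?case
    by (cases "adj i k") (auto simp: cartan_def eval_nat_numeral plin_diff[OF plin_ops(2)]
        xo_xo xo_xo_xo plin_zero[OF plin_ops(2)] xo_commute[of i k] fun_eq_iff)
next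
  case (rel_yy i k)
  then show ?case
    by (cases "adj i k") (auto simp: cartan_def eval_nat_numeral plin_diff[OF plin_ops(1)]
        yo_yo yo_yo_yo plin_zero[OF plin_ops(1)] yo_commute[of i k] fun_eq_iff)
next
  case (rel_hh i k)
  then show ?case by (simp add: ho_ho[of i k])
next
  case (rel_xy i k)
  then show ?case by (auto simp: xo_yo)
next
  case (rel_hx i k)
  then show ?case by (simp add: ho_xo)
next
  case (rel_hy i k)
  then show ?case by (simp add: ho_yo)
qed (simp_all add: fun_eq_iff plin_add[OF plin_term_op] plin_diff[OF plin_term_op]
    plin_scale[OF plin_term_op] pm.scale_right_distrib pm.scale_left_distrib
    pm.scale_right_diff_distrib algebra_simps)

text \<open>The choice of a representing term is harmless: equality in \<open>G\<close> is exactly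
  \<open>serre_eq\<close>, and \<open>term_op\<close> respects it.\<close>

definition ideal_rep :: "('c, 'g::ab_group_add) chev_alg \<Rightarrow> 'g \<Rightarrow>
    ('p set \<Rightarrow>\<^sub>0 complex) \<Rightarrow> ('p set \<Rightarrow>\<^sub>0 complex)" where
  "ideal_rep G z = term_op (SOME s. term_val G s = z)"

lemma ideal_rep_term_val:
  assumes "cartan_lie_algebra adj G"
  shows "ideal_rep G (term_val G s) = term_op s"
proof -
  have "term_val G (SOME s'. term_val G s' = term_val G s) = term_val G s"
    by (rule someI_ex) auto
  then show ?thesis
    using assms term_op_cong unfolding cartan_lie_algebra_def ideal_rep_def by blast
qed

lemma plin_ideal_rep: "plin (ideal_rep G z)"
  by (simp add: ideal_rep_def plin_term_op)

lemma ideal_rep_simps: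
  assumes G: "cartan_lie_algebra adj G"
  shows "ideal_rep G (gx G a) = xo a" "ideal_rep G (gy G a) = yo a" "ideal_rep G (gh G a) = ho a"
    "ideal_rep G (z + w) = (\<lambda>v. ideal_rep G z v + ideal_rep G w v)"
    "ideal_rep G (lscale G c z) = (\<lambda>v. pscale c (ideal_rep G z v))"
    "ideal_rep G (brk G z w) = (\<lambda>v. ideal_rep G z (ideal_rep G w v) - ideal_rep G w (ideal_rep G z v))"
proof -
  note r = ideal_rep_term_val[OF G]
  obtain s where s: "z = term_val G s" using G unfolding cartan_lie_algebra_def surj_def by blast
  obtain s' where s': "w = term_val G s'" using G unfolding cartan_lie_algebra_def surj_def by blast
  show "ideal_rep G (gx G a) = xo a" "ideal_rep G (gy G a) = yo a" "ideal_rep G (gh G a) = ho a"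
    using r[of "TX a"] r[of "TY a"] r[of "TH a"] by simp_all
  show "ideal_rep G (z + w) = (\<lambda>v. ideal_rep G z v + ideal_rep G w v)"
    using r[of "TAdd s s'"] r[of s] r[of s'] by (simp add: s s')
  show "ideal_rep G (lscale G c z) = (\<lambda>v. pscale c (ideal_rep G z v))"
    using r[of "TScale c s"] r[of s] by (simp add: s)
  show "ideal_rep G (brk G z w) = (\<lambda>v. ideal_rep G z (ideal_rep G w v) - ideal_rep G w (ideal_rep G z v))"
    using r[of "TBrk s s'"] r[of s] r[of s'] by (simp add: s s')
qed

lemma ideal_space_eq_span: "ideal_space = pm.span (bas ` (order_ideals :: 'p set set))"
proof
  show "ideal_space \<subseteq> pm.span (bas ` (order_ideals :: 'p set set))"
    using in_span_bas by (auto simp: ideal_space_def)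
  have "pm.subspace (ideal_space :: ('p set \<Rightarrow>\<^sub>0 complex) set)"
    unfolding pm.subspace_def ideal_space_def
    by (auto simp: in_keys_iff lookup_pscale lookup_add subset_iff) (metis add_0)
  then show "pm.span (bas ` (order_ideals :: 'p set set)) \<subseteq> ideal_space"
    by (intro pm.span_minimal) (auto simp: ideal_space_def)
qed

lemma term_op_ideal_space: "v \<in> ideal_space \<Longrightarrow> term_op s v \<in> ideal_space"
proof (induction s arbitrary: v)
  case (TX a)
  have "xo a (bas I) \<in> pm.span (bas ` order_ideals)" if "I \<in> order_ideals" for I
    using that addable_ideal[OF that] by (cases "\<exists>x. addable \<kappa> a I x")
      (auto simp: xo_bas xo_bas_0 pm.span_zero intro!: pm.span_base)
  then show ?case using TX plin_span[OF plin_ops(2), of "bas ` order_ideals" a "bas ` order_ideals" v]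
    by (auto simp: ideal_space_eq_span)
next
  case (TY a)
  have "yo a (bas I) \<in> pm.span (bas ` order_ideals)" if "I \<in> order_ideals" for I
    using that removable_ideal[OF that] by (cases "\<exists>x. removable \<kappa> a I x")
      (auto simp: yo_bas yo_bas_0 pm.span_zero intro!: pm.span_base)
  then show ?case using TY plin_span[OF plin_ops(1), of "bas ` order_ideals" a "bas ` order_ideals" v]
    by (auto simp: ideal_space_eq_span)
next
  case (TH a)
  have "ho a (bas I) \<in> pm.span (bas ` order_ideals)" if "I \<in> order_ideals" for I
    using that by (simp add: ho_bas) (intro pm.span_scale pm.span_base imageI, auto)
  then show ?case using TH plin_span[OF plin_ops(3), of "bas ` order_ideals" a "bas ` order_ideals" v]
    by (auto simp: ideal_space_eq_span)
qed (simp_all add: ideal_space_eq_span pm.span_zero pm.span_add pm.span_diff pm.span_scale)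

lemma lie_module_ideal:
  assumes G: "cartan_lie_algebra adj G"
  shows "lie_module G (ideal_module (ideal_rep G))"
proof -
  have "pm.subspace (ideal_space :: ('p set \<Rightarrow>\<^sub>0 complex) set)"
    by (simp add: ideal_space_eq_span)
  moreover have "ideal_rep G z v \<in> ideal_space" if "v \<in> ideal_space" for z v
    using that by (simp add: ideal_rep_def term_op_ideal_space)
  ultimately show ?thesis
    by (simp add: lie_module_def ideal_module_def pm.vector_space_axioms ideal_rep_simps(4-6)[OF G]
        plin_add[OF plin_ideal_rep] plin_scale[OF plin_ideal_rep])
qed

text \<open>By EC at most one element of a given color can be added or removed, so the sums have at
  most one term.\<close>

lemma XY_op_bas:
  assumes I: "I \<in> order_ideals"
  shows "X_op \<kappa> a (bas I) = xo a (bas I)" "Y_op \<kappa> a (bas I) = yo a (bas I)"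
    "H_op adj \<kappa> (\<kappa> t) a (bas I) = ho a (bas I)"
proof -
  have "X_op \<kappa> a (bas I) = (\<Sum>x\<in>Collect (addable \<kappa> a I). bas (insert x I))"
    by (auto simp: X_op_def addable_def intro!: sum.cong)
  also have "\<dots> = xo a (bas I)"
  proof (cases "\<exists>x. addable \<kappa> a I x")
    case True
    then obtain x where x: "addable \<kappa> a I x" by auto
    then have "Collect (addable \<kappa> a I) = {x}" using addable_unique by auto
    then show ?thesis using x I by (simp add: xo_bas)
  next
    case False
    then have e: "Collect (addable \<kappa> a I) = {}" by auto
    show ?thesis unfolding e using False by (simp add: xo_bas_0)
  qed
  finally show "X_op \<kappa> a (bas I) = xo a (bas I)" .
  have "Y_op \<kappa> a (bas I) = (\<Sum>x\<in>Collect (removable \<kappa> a I). bas (I - {x}))"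
    by (auto simp: Y_op_def removable_def intro!: sum.cong)
  also have "\<dots> = yo a (bas I)"
  proof (cases "\<exists>x. removable \<kappa> a I x")
    case True
    then obtain x where x: "removable \<kappa> a I x" by auto
    then have "Collect (removable \<kappa> a I) = {x}" using removable_unique by auto
    then show ?thesis using x I by (simp add: yo_bas)
  next
    case False
    then have e: "Collect (removable \<kappa> a I) = {}" by auto
    show ?thesis unfolding e using False by (simp add: yo_bas_0)
  qed
  finally show "Y_op \<kappa> a (bas I) = yo a (bas I)" .
  show "H_op adj \<kappa> (\<kappa> t) a (bas I) = ho a (bas I)"
    using I by (simp add: H_op_def ho_bas pscale_single)
qed

lemma ideal_action_ideal_rep:
  assumes G: "cartan_lie_algebra adj G"
  shows "ideal_action adj \<kappa> (\<kappa> t) G (ideal_rep G)"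
proof -
  have p: "plin (X_op \<kappa> a)" "plin (Y_op \<kappa> a)" "plin (H_op adj \<kappa> (\<kappa> t) a)" for a
    unfolding X_op_def Y_op_def H_op_def by (rule plin_lin_ext)+
  have "xo a v = X_op \<kappa> a v \<and> yo a v = Y_op \<kappa> a v \<and> ho a v = H_op adj \<kappa> (\<kappa> t) a v"
    if "v \<in> ideal_space" for a v
  proof -
    have k: "I \<in> order_ideals" if "I \<in> Poly_Mapping.keys v" for I
      using that \<open>v \<in> ideal_space\<close> by (auto simp: ideal_space_def)
    show ?thesis
      using plin_eq_onI[OF plin_ops(2) p(1), of v a a] plin_eq_onI[OF plin_ops(1) p(2), of v a a]
        plin_eq_onI[OF plin_ops(3) p(3), of v a a] XY_op_bas[OF k] by simp
  qed
  then show ?thesis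
    by (simp add: ideal_action_def lie_module_ideal[OF G] ideal_rep_simps(1-3)[OF G])
qed

end

section \<open>Highest weight modules\<close>

locale cartan_module =
  fixes adj :: "'c \<Rightarrow> 'c \<Rightarrow> bool" and G :: "('c, 'g::ab_group_add) chev_alg"
    and M :: "('g, 'v::ab_group_add) gmod"
  assumes G: "cartan_lie_algebra adj G" and M: "lie_module G M"
begin

sublocale vs: vector_space "mscale M"
  using M by (simp add: lie_module_def)

lemma subspace_car: "vs.subspace (car M)"
  using M by (simp add: lie_module_def)

lemma act_car: "u \<in> car M \<Longrightarrow> act M z u \<in> car M"
  using M by (simp add: lie_module_def)

lemma act_add: "u \<in> car M \<Longrightarrow> w \<in> car M \<Longrightarrow> act M z (u + w) = act M z u + act M z w"
  using M by (simp add: lie_module_def)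

lemma act_scale: "u \<in> car M \<Longrightarrow> act M z (mscale M c u) = mscale M c (act M z u)"
  using M by (simp add: lie_module_def)

lemma act_plus: "u \<in> car M \<Longrightarrow> act M (z + w) u = act M z u + act M w u"
  using M by (simp add: lie_module_def)

lemma act_lscale: "u \<in> car M \<Longrightarrow> act M (lscale G c z) u = mscale M c (act M z u)"
  using M by (simp add: lie_module_def)

lemma act_brk: "u \<in> car M \<Longrightarrow> act M (brk G z w) u = act M z (act M w u) - act M w (act M z u)"
  using M by (simp add: lie_module_def)

lemma act_0: "u \<in> car M \<Longrightarrow> act M 0 u = 0"
  using act_plus[of u 0 0] by simp

lemma act_zero: "act M z 0 = 0"
  using act_add[of 0 0 z] vs.subspace_0[OF subspace_car] by simp

lemma span_car: "S \<subseteq> car M \<Longrightarrow> vs.span S \<subseteq> car M"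
  using vs.span_minimal subspace_car by blast

lemma act_span:
  assumes S: "S \<subseteq> car M" and U: "vs.subspace U" and a: "\<And>s. s \<in> S \<Longrightarrow> act M z s \<in> U"
    and u: "u \<in> vs.span S"
  shows "act M z u \<in> U"
proof -
  have "vs.subspace {u. u \<in> car M \<and> act M z u \<in> U}"
    using subspace_car U by (auto simp: vs.subspace_def act_zero act_add act_scale)
  then have "vs.span S \<subseteq> {u. u \<in> car M \<and> act M z u \<in> U}"
    using S a by (intro vs.span_minimal) auto
  then show ?thesis using u by blast
qed

lemma term_val_rel: "serre_eq adj s s' \<Longrightarrow> term_val G s = term_val G s'"
  using G unfolding cartan_lie_algebra_def by blast

lemma act_x_y:
  assumes "u \<in> car M"
  shows "act M (gx G a) (act M (gy G b) u) =
    act M (gy G b) (act M (gx G a) u) + (if a = b then act M (gh G a) u else 0)"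
  using term_val_rel[OF serre_eq.rel_xy, of a b] act_brk[OF assms, of "gx G a" "gy G b"]
  by (simp add: act_0[OF assms] algebra_simps split: if_splits)

lemma act_h_y:
  assumes "u \<in> car M"
  shows "act M (gh G a) (act M (gy G b) u) =
    act M (gy G b) (act M (gh G a) u) - mscale M (of_int (cartan adj a b)) (act M (gy G b) u)"
  using term_val_rel[OF serre_eq.rel_hy, of a b] act_brk[OF assms, of "gh G a" "gy G b"]
  by (simp add: act_lscale[OF assms] algebra_simps)

text \<open>Every element of \<open>G\<close> is the value of a Lie expression in the generators;
  stability passes along its structure.\<close>

lemma submoduleI:
  assumes U: "U \<subseteq> car M" "vs.subspace U"
    and x: "\<And>a u. u \<in> U \<Longrightarrow> act M (gx G a) u \<in> U"
    and y: "\<And>a u. u \<in> U \<Longrightarrow> act M (gy G a) u \<in> U"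
    and h: "\<And>a u. u \<in> U \<Longrightarrow> act M (gh G a) u \<in> U"
    and u: "u \<in> U"
  shows "act M z u \<in> U"
proof -
  obtain s where z: "z = term_val G s" using G unfolding cartan_lie_algebra_def surj_def by blast
  show ?thesis unfolding z using u
  proof (induction s arbitrary: u)
    case (TBrk s1 s2)
    then have "u \<in> car M" using U by blast
    then show ?case using TBrk U by (simp add: act_brk vs.subspace_diff)
  next
    case (TAdd s1 s2)
    then have "u \<in> car M" using U by blast
    then show ?case using TAdd U by (simp add: act_plus vs.subspace_add)
  next
    case (TScale c s)
    then have "u \<in> car M" using U by blast
    then show ?case using TScale U by (simp add: act_lscale vs.subspace_scale)
  next
    case TZero
    then have "u \<in> car M" using U by blast
    then show ?case using U by (simp add: act_0 vs.subspace_0)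
  qed (simp_all add: x y h)
qed

definition has_weight :: "('c \<Rightarrow> complex) \<Rightarrow> 'v \<Rightarrow> bool" where
  "has_weight \<nu> u \<longleftrightarrow> u \<in> car M \<and> (\<forall>a. act M (gh G a) u = mscale M (\<nu> a) u)"

lemma has_weight_scale: "has_weight \<nu> u \<Longrightarrow> has_weight \<nu> (mscale M c u)"
  by (simp add: has_weight_def act_scale vs.subspace_scale[OF subspace_car] mult.commute)

lemma has_weight_add: "has_weight \<nu> u \<Longrightarrow> has_weight \<nu> w \<Longrightarrow> has_weight \<nu> (u + w)"
  by (simp add: has_weight_def act_add vs.subspace_add[OF subspace_car] vs.scale_right_distrib)

text \<open>
  Applying \<open>h\<^sub>a - \<nu>(a)\<close> for a coordinate where \<open>\<nu>\<close> differs from \<open>\<nu>\<^sub>0\<close> removes one summand.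
\<close>

lemma weight_component:
  assumes "finite T" and U: "vs.subspace U" "U \<subseteq> car M" "\<And>a u. u \<in> U \<Longrightarrow> act M (gh G a) u \<in> U"
    and "has_weight \<nu>0 u0" and "\<And>w. w \<in> T \<Longrightarrow> \<exists>\<nu>. \<nu> \<noteq> \<nu>0 \<and> has_weight \<nu> (f w)"
    and "u0 + (\<Sum>w\<in>T. f w) \<in> U"
  shows "u0 \<in> U"
  using assms(1,5-7)
proof (induction T arbitrary: u0 f rule: finite_induct)
  case empty
  then show ?case by simp
next
  case (insert k T)
  obtain \<nu> where \<nu>: "\<nu> \<noteq> \<nu>0" "has_weight \<nu> (f k)" using insert.prems(2) by blast
  obtain a where "\<nu> a \<noteq> \<nu>0 a" using \<nu>(1) by blast
  then have a: "\<nu>0 a - \<nu> a \<noteq> 0" by simp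
  define g where "g w = act M (gh G a) (f w) - mscale M (\<nu> a) (f w)" for w
  let ?u = "u0 + (\<Sum>w\<in>insert k T. f w)"
  have fcar: "f w \<in> car M" if "w \<in> insert k T" for w
    using insert.prems(2)[OF that] by (auto simp: has_weight_def)
  have u0car: "u0 \<in> car M" using insert.prems(1) by (simp add: has_weight_def)
  have sumact: "act M (gh G a) (\<Sum>w\<in>S. f w) = (\<Sum>w\<in>S. act M (gh G a) (f w))" if "S \<subseteq> insert k T" for S
    using finite_subset[OF that] insert.hyps(1) that
  proof (induction S rule: infinite_finite_induct)
    case (insert s S)
    then have "(\<Sum>w\<in>S. f w) \<in> car M" using fcar by (intro vs.subspace_sum[OF subspace_car]) auto
    then show ?case using insert fcar by (simp add: act_add)
  qed (auto simp: act_zero)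
  have sumcar: "(\<Sum>w\<in>insert k T. f w) \<in> car M"
    using fcar by (intro vs.subspace_sum[OF subspace_car]) auto
  have gk: "g k = 0" using \<nu>(2) by (simp add: g_def has_weight_def)
  have u0: "act M (gh G a) u0 - mscale M (\<nu> a) u0 = mscale M (\<nu>0 a - \<nu> a) u0"
    using insert.prems(1) by (simp add: has_weight_def vs.scale_left_diff_distrib)
  have "act M (gh G a) ?u - mscale M (\<nu> a) ?u =
      (act M (gh G a) u0 - mscale M (\<nu> a) u0) + (\<Sum>w\<in>insert k T. g w)"
    unfolding act_add[OF u0car sumcar] sumact[OF order_refl] g_def sum_subtractf
    by (simp add: vs.scale_right_distrib vs.scale_sum_right del: sum.insert)
  also have "\<dots> = mscale M (\<nu>0 a - \<nu> a) u0 + (\<Sum>w\<in>T. g w)"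
    using insert.hyps by (simp add: u0 gk)
  finally have "mscale M (\<nu>0 a - \<nu> a) u0 + (\<Sum>w\<in>T. g w) \<in> U"
    using insert.prems(3) U by (metis vs.subspace_diff vs.subspace_scale)
  moreover have "\<exists>\<nu>. \<nu> \<noteq> \<nu>0 \<and> has_weight \<nu> (g w)" if w: "w \<in> T" for w
  proof -
    obtain \<nu>' where \<nu>': "\<nu>' \<noteq> \<nu>0" "has_weight \<nu>' (f w)" using insert.prems(2) w by blast
    then have "g w = mscale M (\<nu>' a - \<nu> a) (f w)"
      by (simp add: g_def has_weight_def vs.scale_left_diff_distrib)
    then show ?thesis using \<nu>' has_weight_scale by auto
  qed
  ultimately have "mscale M (\<nu>0 a - \<nu> a) u0 \<in> U"
    using insert.IH[OF has_weight_scale[OF insert.prems(1)]] by blast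
  then have "mscale M (1 / (\<nu>0 a - \<nu> a)) (mscale M (\<nu>0 a - \<nu> a) u0) \<in> U"
    using U by (simp only: vs.subspace_scale)
  then show ?case using a by simp
qed

section \<open>Words in the lowering operators\<close>

definition yword :: "'c list \<Rightarrow> 'v \<Rightarrow> 'v" where
  "yword as u = foldr (\<lambda>a. act M (gy G a)) as u"

lemma yword_simps [simp]: "yword [] u = u" "yword (a # as) u = act M (gy G a) (yword as u)"
  by (simp_all add: yword_def)

end

text \<open>\<open>no_null\<close> keeps the weight of \<open>v\<close> apart from the weights of
  all nonempty words. It takes the place of linear independence of the simple roots.\<close>

locale highest_weight_module = cartan_module adj G M
  for adj :: "'c \<Rightarrow> 'c \<Rightarrow> bool" and G :: "('c, 'g::ab_group_add) chev_alg"
    and M :: "('g, 'v::ab_group_add) gmod" +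
  fixes v :: 'v and \<mu> :: "'c \<Rightarrow> complex"
  assumes v: "v \<in> car M" and v_x: "\<And>a. act M (gx G a) v = 0"
    and v_h: "\<And>a. act M (gh G a) v = mscale M (\<mu> a) v"
    and no_null: "\<And>as. as \<noteq> [] \<Longrightarrow> \<exists>i. (\<Sum>a\<leftarrow>as. cartan adj i a) \<noteq> 0"
begin

lemma yword_car: "yword as v \<in> car M"
  by (induction as) (simp_all add: v act_car)

lemma has_weight_yword: "has_weight (\<lambda>i. \<mu> i - of_int (\<Sum>a\<leftarrow>as. cartan adj i a)) (yword as v)"
proof (induction as)
  case Nil
  then show ?case by (simp add: has_weight_def v v_h)
next
  case (Cons b as)
  then show ?case
    by (simp add: has_weight_def act_car act_h_y act_scale add.commute[of "of_int (cartan adj _ b)"]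
        diff_diff_eq[symmetric] flip: vs.scale_left_diff_distrib)
qed

lemma weight_yword_neq: "as \<noteq> [] \<Longrightarrow> (\<lambda>i. \<mu> i - of_int (\<Sum>a\<leftarrow>as. cartan adj i a)) \<noteq> \<mu>"
proof
  assume "as \<noteq> []" and eq: "(\<lambda>i. \<mu> i - of_int (\<Sum>a\<leftarrow>as. cartan adj i a)) = \<mu>"
  then obtain i where "(\<Sum>a\<leftarrow>as. cartan adj i a) \<noteq> 0" using no_null by blast
  moreover have "\<mu> i - of_int (\<Sum>a\<leftarrow>as. cartan adj i a) = \<mu> i" using fun_cong[OF eq, of i] by simp
  ultimately show False by simp
qed

definition gen :: "'v set" where
  "gen = vs.span (range (\<lambda>as. yword as v))"

text \<open>Spanned by vectors of weights other than \<mu>, so that \<open>gen\<close> is the line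
  of \<open>v\<close> together with a complement that has no vector of weight \<mu>.\<close>

definition low :: "'v set" where
  "low = vs.span ((\<lambda>as. yword as v) ` {as. as \<noteq> []})"

lemma yword_gen: "yword as v \<in> gen"
  unfolding gen_def by (rule vs.span_base) simp

lemma gen_car: "gen \<subseteq> car M"
  unfolding gen_def using yword_car by (intro span_car) auto

lemma subspace_gen: "vs.subspace gen"
  by (simp add: gen_def)

lemma gen_closed:
  assumes "\<And>as. act M z (yword as v) \<in> gen" "u \<in> gen"
  shows "act M z u \<in> gen"
  using act_span[of "range (\<lambda>as. yword as v)" gen z u] assms subspace_gen yword_car
  by (auto simp: gen_def)

lemma gen_y: "u \<in> gen \<Longrightarrow> act M (gy G a) u \<in> gen"
  by (rule gen_closed) (rule yword_gen[of "_ # _", simplified])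

lemma gen_h: "u \<in> gen \<Longrightarrow> act M (gh G a) u \<in> gen"
  by (rule gen_closed)
    (use has_weight_yword in \<open>auto simp: has_weight_def intro!: vs.subspace_scale[OF subspace_gen] yword_gen\<close>)

text \<open>A raising operator is moved to the right until it kills \<open>v\<close>. Each lowering
  operator passed leaves at most some \<open>gh\<close>, which is a scalar on words. Hence words in
  the lowering operators alone span a submodule.\<close>

lemma yword_x: "act M (gx G a) (yword as v) \<in> gen"
proof (induction as)
  case Nil
  show ?case using vs.subspace_0[OF subspace_gen] by (simp add: v_x)
next
  case (Cons b as)
  have "act M (gy G b) (act M (gx G a) (yword as v)) \<in> gen" using Cons gen_y by blast
  moreover have "(if a = b then act M (gh G a) (yword as v) else 0) \<in> gen"
    using gen_h[OF yword_gen] vs.subspace_0[OF subspace_gen] by simp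
  ultimately show ?case
    using vs.subspace_add[OF subspace_gen] by (simp add: act_x_y yword_car)
qed

lemma gen_x: "u \<in> gen \<Longrightarrow> act M (gx G a) u \<in> gen"
  by (rule gen_closed) (rule yword_x)

lemma gen_act: "u \<in> gen \<Longrightarrow> act M z u \<in> gen"
  by (rule submoduleI[OF gen_car subspace_gen gen_x gen_y gen_h])

lemma gen_decompose:
  assumes "u \<in> gen" obtains c where "u - mscale M c v \<in> low"
proof -
  have "range (\<lambda>as. yword as v) = insert v ((\<lambda>as. yword as v) ` {as. as \<noteq> []})"
    by (auto intro: range_eqI[of _ _ "[]"])
  then have "gen = {x. \<exists>k. x - mscale M k v \<in> low}"
    unfolding gen_def low_def by (simp only: vs.span_insert)
  then show thesis using assms that by blast
qed

text \<open>The terms of r have weights other than \<mu>, so \<open>weight_component\<close>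
  extracts \<open>u0\<close> from the sum.\<close>

lemma top_component:
  assumes U: "vs.subspace U" "U \<subseteq> car M" "\<And>a u. u \<in> U \<Longrightarrow> act M (gh G a) u \<in> U"
    and u0: "has_weight \<mu> u0" and r: "r \<in> low" and "u0 + r \<in> U"
  shows "u0 \<in> U"
proof -
  define Q where "Q T q \<longleftrightarrow> r = (\<Sum>w\<in>T. mscale M (q w) w) \<and> finite T \<and>
    T \<subseteq> (\<lambda>as. yword as v) ` {as. as \<noteq> []}" for T q
  have "\<exists>T q. Q T q"
    using r unfolding low_def vs.span_explicit mem_Collect_eq Q_def .
  then obtain T q where Q: "Q T q" by blast
  have r': "r = (\<Sum>w\<in>T. mscale M (q w) w)" and T: "finite T" "T \<subseteq> (\<lambda>as. yword as v) ` {as. as \<noteq> []}"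
    using Q unfolding Q_def by simp_all
  have other: "\<exists>\<nu>. \<nu> \<noteq> \<mu> \<and> has_weight \<nu> (mscale M (q w) w)" if "w \<in> T" for w
  proof -
    have "w \<in> (\<lambda>as. yword as v) ` {as. as \<noteq> []}" using T(2) that by (rule subsetD)
    then obtain as where as: "as \<noteq> []" "w = yword as v" by auto
    show ?thesis unfolding as(2)
      by (intro exI conjI, rule weight_yword_neq[OF as(1)], rule has_weight_scale[OF has_weight_yword])
  qed
  show ?thesis
  proof (rule weight_component[OF T(1) U(1,2) _ u0, where f = "\<lambda>w. mscale M (q w) w"])
    show "act M (gh G a) u \<in> U" if "u \<in> U" for a u using that by (rule U(3))
    show "\<exists>\<nu>. \<nu> \<noteq> \<mu> \<and> has_weight \<nu> (mscale M (q w) w)" if "w \<in> T" for w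
      using that by (rule other)
    show "u0 + (\<Sum>w\<in>T. mscale M (q w) w) \<in> U" using assms(6) unfolding r' .
  qed
qed

text \<open>Extract the component of weight \<mu> from u + (- u) = 0 in the zero submodule.\<close>

lemma low_weight_zero:
  assumes "u \<in> low" "has_weight \<mu> u" shows "u = 0"
proof -
  have "u \<in> {0}"
    by (rule top_component[of "{0}" u "- u"])
      (use assms vs.subspace_0[OF subspace_car] in
        \<open>auto simp: vs.subspace_single_0 act_zero low_def vs.span_neg\<close>)
  then show ?thesis by simp
qed

lemma has_weight_v: "has_weight \<mu> v"
  by (simp add: has_weight_def v v_h)

lemma submodule_eq_car:
  assumes "car M = gen" and U: "vs.subspace U" "U \<subseteq> car M" "\<And>z u. u \<in> U \<Longrightarrow> act M z u \<in> U" and "v \<in> U"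
  shows "U = car M"
proof -
  have "yword as v \<in> U" for as
    by (induction as) (use assms in auto)
  then have "gen \<subseteq> U" unfolding gen_def using U(1) by (intro vs.span_minimal) auto
  then show ?thesis using assms by auto
qed

text \<open>
  A contravariant definite form makes a cyclic highest weight module irreducible: a submodule
  not containing \<open>v\<close> has no component along \<open>v\<close>, hence is orthogonal to everything.
\<close>

lemma irreducible_by_form:
  fixes B :: "'v \<Rightarrow> 'v \<Rightarrow> complex"
  assumes cyclic: "car M = gen" and v0: "v \<noteq> 0"
    and left: "\<And>w. vs.subspace {u. B u w = 0}" and right: "\<And>u. vs.subspace {w. B u w = 0}"
    and adj_y: "\<And>a u w. u \<in> car M \<Longrightarrow> w \<in> car M \<Longrightarrow> B (act M (gy G a) u) w = B u (act M (gx G a) w)"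
    and adj_x: "\<And>a u w. u \<in> car M \<Longrightarrow> w \<in> car M \<Longrightarrow> B (act M (gx G a) u) w = B u (act M (gy G a) w)"
    and definite: "\<And>u. B u u = 0 \<Longrightarrow> u = 0"
  shows "irreducible_module G M"
  unfolding irreducible_module_def
proof (intro conjI allI impI)
  show "lie_module G M" by (rule M)
  show "car M \<noteq> {0}" using v v0 by auto
  fix U assume "U \<subseteq> car M \<and> vs.subspace U \<and> (\<forall>z. \<forall>v\<in>U. act M z v \<in> U)"
  then have U: "U \<subseteq> car M" "vs.subspace U" "\<And>z u. u \<in> U \<Longrightarrow> act M z u \<in> U" by auto
  show "U = {0} \<or> U = car M"
  proof (cases "v \<in> U")
    case True
    then show ?thesis using submodule_eq_car[OF cyclic U(2,1,3)] by blast
  next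
    case False
    \<comment> \<open>The component along v of an element of U lies in U again, so it must
      vanish.\<close>
    have low: "u \<in> low" if u: "u \<in> U" for u
    proof -
      have "u \<in> gen" using u U cyclic by blast
      then obtain c where c: "u - mscale M c v \<in> low" using gen_decompose by blast
      have "mscale M c v \<in> U"
        by (rule top_component[OF U(2,1,3) has_weight_scale[OF has_weight_v] c]) (simp_all add: u)
      then have "mscale M (1 / c) (mscale M c v) \<in> U" using U(2) by (simp only: vs.subspace_scale)
      then have "c = 0" using False by (cases "c = 0") auto
      then show ?thesis using c by simp
    qed
    have "B 0 w = 0" for w using vs.subspace_0[OF left[of w]] by simp
    \<comment> \<open>The first lowering operator of the word moves over to v as a raising operator
      and kills it.\<close>
    then have "B v (yword as v) = 0" if "as \<noteq> []" for as
      using that adj_x[OF v yword_car, symmetric] by (cases as) (simp_all add: v_x)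
    then have "low \<subseteq> {w. B v w = 0}"
      unfolding low_def by (intro vs.span_minimal right) auto
    then have vU: "B v u = 0" if "u \<in> U" for u using low that by blast
    \<comment> \<open>The word is shifted letter by letter onto u, which remains in U and finally
      meets v alone.\<close>
    have "B (yword as v) u = 0" if "u \<in> U" for as u
      using that
    proof (induction as arbitrary: u)
      case Nil
      then show ?case using vU by simp
    next
      case (Cons a as)
      then have "B (yword as v) (act M (gx G a) u) = 0" using U(3) by blast
      moreover have "u \<in> car M" using Cons.prems U(1) by blast
      ultimately show ?case by (simp add: adj_y yword_car)
    qed
    then have "gen \<subseteq> {w. B w u = 0}" if "u \<in> U" for u
      unfolding gen_def using that by (intro vs.span_minimal left) auto
    then have "B u u = 0" if "u \<in> U" for u using that U(1) cyclic by blast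
    then have "U \<subseteq> {0}" using definite by blast
    then show ?thesis using vs.subspace_0[OF U(2)] by blast
  qed
qed

end

section \<open>Uniqueness of irreducible highest weight modules\<close>

definition prod_module :: "('g, 'v) gmod \<Rightarrow> ('g, 'w) gmod \<Rightarrow> ('g, 'v \<times> 'w) gmod" where
  "prod_module M N = \<lparr>car = car M \<times> car N,
     mscale = (\<lambda>c p. (mscale M c (fst p), mscale N c (snd p))),
     act = (\<lambda>z p. (act M z (fst p), act N z (snd p)))\<rparr>"

lemma prod_module_simps [simp]:
  "car (prod_module M N) = car M \<times> car N"
  "mscale (prod_module M N) c p = (mscale M c (fst p), mscale N c (snd p))"
  "act (prod_module M N) z p = (act M z (fst p), act N z (snd p))"
  by (simp_all add: prod_module_def)

lemma lie_module_prod: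
  assumes "lie_module G M" "lie_module G N"
  shows "lie_module G (prod_module M N)"
proof -
  interpret M: vector_space "mscale M" using assms(1) by (simp add: lie_module_def)
  interpret N: vector_space "mscale N" using assms(2) by (simp add: lie_module_def)
  interpret P: vector_space "mscale (prod_module M N)"
    by unfold_locales (simp_all add: prod_eq_iff M.scale_right_distrib M.scale_left_distrib
        N.scale_right_distrib N.scale_left_distrib)
  have M: "M.subspace (car M)" and N: "N.subspace (car N)"
    using assms by (simp_all add: lie_module_def)
  have "P.subspace (car (prod_module M N))"
    using M N by (auto simp: P.subspace_def M.subspace_def N.subspace_def zero_prod_def)
  then show ?thesis
    using assms P.vector_space_axioms unfolding lie_module_def by auto
qed

text \<open>The isomorphism is the submodule of the product generated by the pair of highest weight
  vectors: it is the graph of a bijection.\<close>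

theorem highest_weight_irrep_unique:
  fixes M :: "('g::ab_group_add, 'v::ab_group_add) gmod" and N :: "('g, 'w::ab_group_add) gmod"
  assumes G: "cartan_lie_algebra adj G"
    and no_null: "\<And>as. as \<noteq> [] \<Longrightarrow> \<exists>i. (\<Sum>a\<leftarrow>as. cartan adj i a) \<noteq> 0"
    and M: "highest_weight_irrep G M \<mu>" and N: "highest_weight_irrep G N \<mu>"
  shows "module_iso M N"
proof -
  have lM: "lie_module G M" and lN: "lie_module G N"
    using M N by (simp_all add: highest_weight_irrep_def irreducible_module_def)
  interpret M: cartan_module adj G M by unfold_locales (fact G lM)+
  interpret N: cartan_module adj G N by unfold_locales (fact G lN)+
  obtain v where v: "v \<in> car M" "v \<noteq> 0" "\<forall>a. act M (gx G a) v = 0"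
    "\<forall>a. act M (gh G a) v = mscale M (\<mu> a) v" using M unfolding highest_weight_irrep_def by blast
  obtain w where w: "w \<in> car N" "w \<noteq> 0" "\<forall>a. act N (gx G a) w = 0"
    "\<forall>a. act N (gh G a) w = mscale N (\<mu> a) w" using N unfolding highest_weight_irrep_def by blast
  have irrM: "U = {0} \<or> U = car M"
    if "U \<subseteq> car M" "M.vs.subspace U" "\<And>z u. u \<in> U \<Longrightarrow> act M z u \<in> U" for U
    using M that unfolding highest_weight_irrep_def irreducible_module_def by blast
  have irrN: "U = {0} \<or> U = car N"
    if "U \<subseteq> car N" "N.vs.subspace U" "\<And>z u. u \<in> U \<Longrightarrow> act N z u \<in> U" for U
    using N that unfolding highest_weight_irrep_def irreducible_module_def by blast
  interpret P: highest_weight_module adj G "prod_module M N" "(v, w)" \<mu>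
    by unfold_locales (use G lie_module_prod[OF lM lN] v w no_null in \<open>simp_all add: zero_prod_def\<close>)
  let ?K = P.gen
  have Kcar: "a \<in> car M" "b \<in> car N" if "(a, b) \<in> ?K" for a b using P.gen_car that by auto
  have K0: "(0, 0) \<in> ?K" using P.vs.subspace_0[OF P.subspace_gen] by (simp add: zero_prod_def)
  have Kadd: "(a + a', b + b') \<in> ?K" if "(a, b) \<in> ?K" "(a', b') \<in> ?K" for a b a' b'
    using P.vs.subspace_add[OF P.subspace_gen that] by simp
  have Kscale: "(mscale M c a, mscale N c b) \<in> ?K" if "(a, b) \<in> ?K" for a b c
    using P.vs.subspace_scale[OF P.subspace_gen that, of c] by simp
  have Kact: "(act M z a, act N z b) \<in> ?K" if "(a, b) \<in> ?K" for a b z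
    using P.gen_act[OF that, of z] by simp
  have vK: "(v, w) \<in> ?K" using P.yword_gen[of "[]"] by simp
  have weight: "P.has_weight \<mu> (a, b)" if "(a, b) \<in> {(0, w), (v, 0)}" for a b
    using that v w M.vs.subspace_0[OF M.subspace_car] N.vs.subspace_0[OF N.subspace_car]
    by (auto simp: P.has_weight_def M.act_zero N.act_zero)
  \<comment> \<open>These pairs have weight \<mu>, and the only such vectors in the cyclic submodule
    are the multiples of (v, w).\<close>
  have notK: "(a, b) \<notin> ?K" if ab: "(a, b) \<in> {(0, w), (v, 0)}" for a b
  proof
    assume "(a, b) \<in> ?K"
    then obtain c where c: "(a, b) - mscale (prod_module M N) c (v, w) \<in> P.low"
      using P.gen_decompose by blast
    have "P.has_weight \<mu> ((a, b) + mscale (prod_module M N) (- c) (v, w))"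
      by (intro P.has_weight_add weight ab P.has_weight_scale P.has_weight_v)
    then have "(a, b) - mscale (prod_module M N) c (v, w) = 0"
      using P.low_weight_zero[OF c] by (simp only: P.vs.scale_minus_left diff_conv_add_uminus)
    then have "a = mscale M c v" "b = mscale N c w" by (simp_all add: zero_prod_def)
    then show False using ab v(2) w(2) by auto
  qed
  \<comment> \<open>The elements paired with 0 form a submodule. It does not contain v, so
    irreducibility makes it zero.\<close>
  have ker1: "a = 0" if "(a, 0) \<in> ?K" for a
  proof -
    let ?U = "{a. (a, 0) \<in> ?K}"
    have "?U = {0} \<or> ?U = car M"
      by (rule irrM) (use Kcar K0 Kadd[of _ 0 _ 0] Kscale[of _ 0] Kact[of _ 0] N.act_zero in
        \<open>auto simp: M.vs.subspace_def\<close>)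
    then show ?thesis using that notK[of v 0] v(1) by auto
  qed
  have ker2: "b = 0" if "(0, b) \<in> ?K" for b
  proof -
    let ?U = "{b. (0, b) \<in> ?K}"
    have "?U = {0} \<or> ?U = car N"
      by (rule irrN) (use Kcar K0 Kadd[of 0 _ 0] Kscale[of 0] Kact[of 0] M.act_zero in
        \<open>auto simp: N.vs.subspace_def\<close>)
    then show ?thesis using that notK[of 0 w] w(1) by auto
  qed
  \<comment> \<open>Both projections of the cyclic submodule are nonzero submodules, hence
    onto.\<close>
  let ?A = "{a. \<exists>b. (a, b) \<in> ?K}" and ?B = "{b. \<exists>a. (a, b) \<in> ?K}"
  have "?A = {0} \<or> ?A = car M"
  proof (rule irrM)
    show "?A \<subseteq> car M" using Kcar(1) by auto
    show "M.vs.subspace ?A"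
    proof (rule M.vs.subspaceI)
      show "0 \<in> ?A" using K0 by auto
      show "x + y \<in> ?A" if x: "x \<in> ?A" and y: "y \<in> ?A" for x y
      proof -
        obtain b where "(x, b) \<in> ?K" using x by auto
        moreover obtain b' where "(y, b') \<in> ?K" using y by auto
        ultimately have "(x + y, b + b') \<in> ?K" by (rule Kadd)
        then show ?thesis by auto
      qed
      show "mscale M c x \<in> ?A" if "x \<in> ?A" for c x using that Kscale[of x _ c] by auto
    qed
    show "act M z u \<in> ?A" if "u \<in> ?A" for z u using that Kact[of u _ z] by auto
  qed
  then have sur1: "\<exists>b. (a, b) \<in> ?K" if "a \<in> car M" for a
  proof
    assume "?A = {0}"
    then show ?thesis using vK v(2) by auto
  next
    assume "?A = car M"
    then show ?thesis using that by auto
  qed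
  have "?B = {0} \<or> ?B = car N"
  proof (rule irrN)
    show "?B \<subseteq> car N" using Kcar(2) by auto
    show "N.vs.subspace ?B"
    proof (rule N.vs.subspaceI)
      show "0 \<in> ?B" using K0 by auto
      show "x + y \<in> ?B" if x: "x \<in> ?B" and y: "y \<in> ?B" for x y
      proof -
        obtain b where "(b, x) \<in> ?K" using x by auto
        moreover obtain b' where "(b', y) \<in> ?K" using y by auto
        ultimately have "(b + b', x + y) \<in> ?K" by (rule Kadd)
        then show ?thesis by auto
      qed
      show "mscale N c x \<in> ?B" if "x \<in> ?B" for c x using that Kscale[of _ x c] by auto
    qed
    show "act N z u \<in> ?B" if "u \<in> ?B" for z u using that Kact[of _ u z] by auto
  qed
  then have sur2: "\<exists>a. (a, b) \<in> ?K" if "b \<in> car N" for b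
  proof
    assume "?B = {0}"
    then show ?thesis using vK w(2) by auto
  next
    assume "?B = car N"
    then show ?thesis using that by auto
  qed
  have Kdiff: "(a - a', b - b') \<in> ?K" if "(a, b) \<in> ?K" "(a', b') \<in> ?K" for a b a' b'
    using P.vs.subspace_diff[OF P.subspace_gen that] by simp
  have fun1: "b = b'" if "(a, b) \<in> ?K" "(a, b') \<in> ?K" for a b b'
    using ker2[of "b - b'"] Kdiff[OF that] by simp
  have fun2: "a = a'" if "(a, b) \<in> ?K" "(a', b) \<in> ?K" for a a' b
    using ker1[of "a - a'"] Kdiff[OF that] by simp
  define f where "f a = (SOME b. (a, b) \<in> ?K)" for a
  have f: "(a, f a) \<in> ?K" if "a \<in> car M" for a
    unfolding f_def using sur1[OF that] by (rule someI_ex)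
  have fI: "f a = b" if "(a, b) \<in> ?K" for a b
    using fun1 f Kcar(1) that by blast
  have "bij_betw f (car M) (car N)"
    unfolding bij_betw_def
  proof (intro conjI inj_onI set_eqI iffI)
    fix a a' assume "a \<in> car M" "a' \<in> car M" "f a = f a'"
    then show "a = a'" using fun2 f by metis
  next
    fix b assume "b \<in> f ` car M"
    then show "b \<in> car N" using f Kcar(2) by blast
  next
    fix b assume "b \<in> car N"
    then obtain a where "(a, b) \<in> ?K" using sur2 by blast
    then show "b \<in> f ` car M" using fI Kcar(1) by blast
  qed
  moreover have "f (a + a') = f a + f a'" if "a \<in> car M" "a' \<in> car M" for a a'
    using fI[OF Kadd[OF f f]] that by blast
  moreover have "f (mscale M c a) = mscale N c (f a)" if "a \<in> car M" for a c
    using fI[OF Kscale[OF f]] that by blast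
  moreover have "f (act M z a) = act N z (f a)" if "a \<in> car M" for a z
    using fI[OF Kact[OF f]] that by blast
  ultimately show ?thesis unfolding module_iso_def by blast
qed

lemma weights_module_iso:
  assumes "lie_module G M" "lie_module G N" "module_iso M N"
  shows "weights G M = weights G N"
proof -
  interpret M: vector_space "mscale M" using assms(1) by (simp add: lie_module_def)
  obtain f where f: "bij_betw f (car M) (car N)" "\<And>u v. u \<in> car M \<Longrightarrow> v \<in> car M \<Longrightarrow> f (u + v) = f u + f v"
    "\<And>c v. v \<in> car M \<Longrightarrow> f (mscale M c v) = mscale N c (f v)"
    "\<And>z v. v \<in> car M \<Longrightarrow> f (act M z v) = act N z (f v)"
    using assms(3) unfolding module_iso_def by blast
  have z: "0 \<in> car M" and sub: "M.subspace (car M)"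
    using assms(1) by (simp_all add: lie_module_def M.subspace_0)
  have f0: "f 0 = 0" using f(2)[OF z z] by simp
  have inj: "f u = f u' \<longleftrightarrow> u = u'" if "u \<in> car M" "u' \<in> car M" for u u'
    using f(1) that by (auto simp: bij_betw_def inj_on_def)
  have actM: "act M z u \<in> car M" if "u \<in> car M" for z u
    using assms(1) that by (simp add: lie_module_def)
  have iff: "(u \<noteq> 0 \<and> (\<forall>a. act M (gh G a) u = mscale M (\<nu> a) u)) \<longleftrightarrow>
      (f u \<noteq> 0 \<and> (\<forall>a. act N (gh G a) (f u) = mscale N (\<nu> a) (f u)))" if u: "u \<in> car M" for u \<nu>
  proof -
    have "f u = 0 \<longleftrightarrow> u = 0" using inj[OF u z] f0 by simp
    moreover have "act N (gh G a) (f u) = mscale N (\<nu> a) (f u) \<longleftrightarrow>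
        act M (gh G a) u = mscale M (\<nu> a) u" for a
      using inj[OF actM[OF u] M.subspace_scale[OF sub u], of "gh G a" "\<nu> a"] f(3,4)[OF u] by simp
    ultimately show ?thesis by simp
  qed
  have "car N = f ` car M" using f(1) by (simp add: bij_betw_def)
  then show ?thesis using iff by (auto simp: weights_def)
qed

section \<open>Exchange relations for Serre pairs of operators\<close>

text \<open>C is the commutator of B and A. That it commutes with both is the Serre relation of type
  A_2; the three operators satisfy the relations of a Heisenberg algebra.\<close>

locale serre_pair =
  fixes A B C :: "('a \<Rightarrow>\<^sub>0 complex) \<Rightarrow> ('a \<Rightarrow>\<^sub>0 complex)"
  assumes A: "plin A" and B: "plin B" and C: "plin C"
    and BA: "\<And>u. B (A u) = A (B u) + C u"
    and CA: "\<And>u. C (A u) = A (C u)" and CB: "\<And>u. C (B u) = B (C u)"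
begin

lemma C_B_pow: "C ((B ^^ c) u) = (B ^^ c) (C u)"
  by (induction c) (simp_all add: CB)

lemma C_A_pow: "C ((A ^^ c) u) = (A ^^ c) (C u)"
  by (induction c) (simp_all add: CA)

lemma B_A_pow: "B ((A ^^ Suc n) u) = (A ^^ Suc n) (B u) + pscale (of_nat (Suc n)) ((A ^^ n) (C u))"
proof (induction n)
  case 0
  show ?case by (simp add: BA)
next
  case (Suc n)
  have "B ((A ^^ Suc (Suc n)) u) = A (B ((A ^^ Suc n) u)) + C ((A ^^ Suc n) u)"
    by (simp add: BA)
  also have "\<dots> = (A ^^ Suc (Suc n)) (B u) + (pscale (of_nat (Suc n)) ((A ^^ Suc n) (C u)) + (A ^^ Suc n) (C u))"
    unfolding Suc C_A_pow plin_add[OF A] plin_scale[OF A] by (simp add: add.assoc)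
  also have "\<dots> = (A ^^ Suc (Suc n)) (B u) + pscale (of_nat (Suc (Suc n))) ((A ^^ Suc n) (C u))"
    unfolding of_nat_Suc[of "Suc n"] pm.scale_left_distrib by (simp add: add.commute)
  finally show ?case .
qed

lemma B_pow_A: "(B ^^ Suc c) (A u) = A ((B ^^ Suc c) u) + pscale (of_nat (Suc c)) ((B ^^ c) (C u))"
proof (induction c)
  case 0
  show ?case by (simp add: BA)
next
  case (Suc c)
  have "(B ^^ Suc (Suc c)) (A u) = B ((B ^^ Suc c) (A u))" by simp
  also have "\<dots> = A ((B ^^ Suc (Suc c)) u) + (C ((B ^^ Suc c) u) + pscale (of_nat (Suc c)) ((B ^^ Suc c) (C u)))"
    unfolding Suc plin_add[OF B] plin_scale[OF B] BA by (simp add: add.assoc)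
  also have "\<dots> = A ((B ^^ Suc (Suc c)) u) + pscale (of_nat (Suc (Suc c))) ((B ^^ Suc c) (C u))"
    unfolding of_nat_Suc[of "Suc c"] pm.scale_left_distrib C_B_pow by simp
  finally show ?case .
qed

text \<open>C is eliminated: \<open>B_A_pow\<close> yields n + 1 times A^n B^c C u, and
  \<open>B_pow_A\<close> expresses c + 1 times B^c C u through B^(c+1) A u. Hence the
  quotient.\<close>

lemma B_A_pow_B_pow:
  "B ((A ^^ Suc n) ((B ^^ c) u)) = (A ^^ Suc n) ((B ^^ Suc c) u) +
     pscale (of_nat (Suc n) / of_nat (Suc c))
       ((A ^^ n) ((B ^^ Suc c) (A u)) - (A ^^ Suc n) ((B ^^ Suc c) u))"
proof -
  have "(A ^^ n) ((B ^^ Suc c) (A u)) =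
      (A ^^ n) (A ((B ^^ Suc c) u)) + pscale (of_nat (Suc c)) ((A ^^ n) ((B ^^ c) (C u)))"
    unfolding B_pow_A plin_add[OF plin_funpow[OF A]] plin_scale[OF plin_funpow[OF A]] ..
  then have "(A ^^ n) ((B ^^ Suc c) (A u)) - (A ^^ Suc n) ((B ^^ Suc c) u) =
      pscale (of_nat (Suc c)) ((A ^^ n) ((B ^^ c) (C u)))"
    by (simp add: funpow_swap1)
  moreover have "of_nat (Suc n) / of_nat (Suc c) * of_nat (Suc c) = (of_nat (Suc n) :: complex)"
    by (simp only: nonzero_eq_divide_eq[symmetric] of_nat_neq_0 not_False_eq_True times_divide_eq_left
      nonzero_mult_div_cancel_right)
  ultimately have "pscale (of_nat (Suc n) / of_nat (Suc c))
       ((A ^^ n) ((B ^^ Suc c) (A u)) - (A ^^ Suc n) ((B ^^ Suc c) u)) =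
      pscale (of_nat (Suc n)) ((A ^^ n) ((B ^^ c) (C u)))"
    by (simp only: pm.scale_scale)
  then show ?thesis unfolding B_A_pow C_B_pow by (simp add: funpow_swap1)
qed

end

definition strings :: "(('a \<Rightarrow>\<^sub>0 complex) \<Rightarrow> ('a \<Rightarrow>\<^sub>0 complex)) \<Rightarrow> ('a \<Rightarrow>\<^sub>0 complex) set \<Rightarrow>
    ('a \<Rightarrow>\<^sub>0 complex) set" where
  "strings A U = pm.span (\<Union>k. (A ^^ k) ` U)"

lemma stringsI: "u \<in> U \<Longrightarrow> (A ^^ k) u \<in> strings A U"
  unfolding strings_def by (intro pm.span_base) blast

lemma subspace_strings: "pm.subspace (strings A U)"
  by (simp add: strings_def)

lemma strings_map:
  assumes "plin f" "pm.subspace T" "\<And>k u. u \<in> U \<Longrightarrow> f ((A ^^ k) u) \<in> T" "x \<in> strings A U"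
  shows "f x \<in> T"
  using assms(4) unfolding strings_def by (rule plin_span_subspace[OF assms(1,2), rotated]) (use assms(3) in auto)

lemma strings_closed: "plin A \<Longrightarrow> x \<in> strings A U \<Longrightarrow> A x \<in> strings A U"
proof (rule strings_map[OF _ subspace_strings, where f = A and A = A and U = U])
  show "A ((A ^^ k) u) \<in> strings A U" if "u \<in> U" for k u
    using stringsI[OF that, where A = A and k = "Suc k"] by simp
qed

text \<open>The preceding formula uses only words A^i B^j applied to u and to A u, which is why U
  has to be stable under A.\<close>

lemma (in serre_pair) strings_exchange:
  assumes U: "\<And>u. u \<in> U \<Longrightarrow> A u \<in> U" and x: "x \<in> strings A (strings B U)"
  shows "B x \<in> strings A (strings B U)"
proof (rule strings_map[OF B subspace_strings _ x])
  fix k y assume y: "y \<in> strings B U"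
  show "B ((A ^^ k) y) \<in> strings A (strings B U)"
  proof (rule strings_map[OF plin_compose[OF B plin_funpow[OF A]] subspace_strings _ y])
    fix c u assume u: "u \<in> U"
    have mem: "(A ^^ n) ((B ^^ c) u) \<in> strings A (strings B U)" if "u \<in> U" for n c u
      by (intro stringsI that)
    show "B ((A ^^ k) ((B ^^ c) u)) \<in> strings A (strings B U)"
    proof (cases k)
      case 0
      then show ?thesis using mem[OF u, of 0 "Suc c"] by simp
    next
      case (Suc n)
      show ?thesis unfolding Suc B_A_pow_B_pow
        by (intro pm.subspace_add[OF subspace_strings] pm.subspace_scale[OF subspace_strings]
            pm.subspace_diff[OF subspace_strings] mem u U)
    qed
  qed
qed

section \<open>Iterated commutators\<close>

primrec ad_pow :: "('v \<Rightarrow> 'v) \<Rightarrow> nat \<Rightarrow> ('v \<Rightarrow> 'v::ab_group_add) \<Rightarrow> 'v \<Rightarrow> 'v" where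
  "ad_pow B 0 T = T"
| "ad_pow B (Suc k) T = (\<lambda>u. B (ad_pow B k T u) - ad_pow B k T (B u))"

text \<open>The binomial expansion of ad(B)^k, of which only this is kept: the single term with no B
  on the right has coefficient 1.\<close>

lemma ad_pow_expand:
  assumes B: "plin B"
  shows "ad_pow B k T u - (B ^^ k) (T u) \<in> pm.span ((\<lambda>i. (B ^^ (k - i)) (T ((B ^^ i) u))) ` {1..k})"
proof (induction k arbitrary: u)
  case 0
  show ?case by (simp add: pm.span_zero)
next
  case (Suc k)
  let ?S = "\<lambda>k u. (\<lambda>i. (B ^^ (k - i)) (T ((B ^^ i) u))) ` {1..k}"
  have mem: "(B ^^ (Suc k - i)) (T ((B ^^ i) u)) \<in> pm.span (?S (Suc k) u)" if "i \<in> {1..Suc k}" for i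
    using that by (intro pm.span_base imageI)
  have 1: "B (ad_pow B k T u - (B ^^ k) (T u)) \<in> pm.span (?S (Suc k) u)"
  proof (rule plin_span[OF B _ Suc])
    fix s assume "s \<in> ?S k u"
    then obtain i where i: "i \<in> {1..k}" "s = (B ^^ (k - i)) (T ((B ^^ i) u))" by auto
    then have "B s = (B ^^ (Suc k - i)) (T ((B ^^ i) u))" by (simp add: Suc_diff_le)
    then show "B s \<in> pm.span (?S (Suc k) u)" using mem[of i] i by simp
  qed
  have "pm.span (?S k (B u)) \<subseteq> pm.span (?S (Suc k) u)"
  proof (rule pm.span_minimal)
    show "?S k (B u) \<subseteq> pm.span (?S (Suc k) u)"
    proof
      fix s assume "s \<in> ?S k (B u)"
      then obtain i where i: "i \<in> {1..k}" "s = (B ^^ (k - i)) (T ((B ^^ i) (B u)))" by auto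
      then have "s = (B ^^ (Suc k - Suc i)) (T ((B ^^ Suc i) u))" by (simp add: funpow_swap1)
      then show "s \<in> pm.span (?S (Suc k) u)" using mem[of "Suc i"] i by simp
    qed
  qed simp
  then have 2: "ad_pow B k T (B u) - (B ^^ k) (T (B u)) \<in> pm.span (?S (Suc k) u)"
    using Suc[of "B u"] by blast
  have 3: "(B ^^ k) (T (B u)) \<in> pm.span (?S (Suc k) u)" using mem[of 1] by simp
  have eq: "ad_pow B (Suc k) T u - (B ^^ Suc k) (T u) =
      B (ad_pow B k T u - (B ^^ k) (T u)) - ((ad_pow B k T (B u) - (B ^^ k) (T (B u))) + (B ^^ k) (T (B u)))"
    by (simp add: plin_diff[OF B])
  show ?case unfolding eq by (rule pm.span_diff[OF 1 pm.span_add[OF 2 3]])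
qed

context serre_pair
begin

text \<open>ad(B) is a derivation that sends A to C and C to 0, so Leibniz' formula stops after two
  terms.\<close>

lemma ad_pow_A:
  "ad_pow B (Suc k) (\<lambda>u. A (T u)) u = A (ad_pow B (Suc k) T u) + pscale (of_nat (Suc k)) (C (ad_pow B k T u))"
proof (induction k arbitrary: u)
  case 0
  show ?case by (simp add: BA plin_diff[OF A])
next
  case (Suc k)
  let ?a = "ad_pow B (Suc k) T u" and ?a' = "ad_pow B (Suc k) T (B u)"
  let ?b = "ad_pow B k T u" and ?b' = "ad_pow B k T (B u)"
  have "ad_pow B (Suc (Suc k)) (\<lambda>u. A (T u)) u =
      B (ad_pow B (Suc k) (\<lambda>u. A (T u)) u) - ad_pow B (Suc k) (\<lambda>u. A (T u)) (B u)"
    by simp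
  also have "\<dots> = (A (B ?a) + C ?a + pscale (of_nat (Suc k)) (C (B ?b)))
      - (A ?a' + pscale (of_nat (Suc k)) (C ?b'))"
    unfolding Suc plin_add[OF B] plin_scale[OF B] BA CB ..
  also have "\<dots> = A (B ?a - ?a') + (C ?a + pscale (of_nat (Suc k)) (C (B ?b - ?b')))"
    unfolding plin_diff[OF A] plin_diff[OF C] pm.scale_right_diff_distrib by (simp only: algebra_simps)
  also have "\<dots> = A (ad_pow B (Suc (Suc k)) T u) + pscale (of_nat (Suc (Suc k))) (C ?a)"
    unfolding of_nat_Suc[of "Suc k"] pm.scale_left_distrib by simp
  finally show ?case .
qed

text \<open>Each factor A can absorb one commutator, by turning into C; with more commutators than
  factors nothing survives.\<close>

lemma ad_pow_A_pow: "n < k \<Longrightarrow> ad_pow B k (A ^^ n) u = 0"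
proof (induction n arbitrary: k u)
  case 0
  have "ad_pow B (Suc k) (\<lambda>u. u) u = 0" for k u
    by (induction k arbitrary: u) (simp_all add: plin_zero[OF B])
  then show ?case using 0 by (cases k) (simp_all add: id_def del: ad_pow.simps)
next
  case (Suc n)
  then obtain k' where k': "k = Suc k'" "n < k'" by (cases k) auto
  have "A ^^ Suc n = (\<lambda>u. A ((A ^^ n) u))" by auto
  then show ?case
    using Suc.IH[of k' u] Suc.IH[of k u] k' by (simp add: ad_pow_A plin_zero[OF A] plin_zero[OF C] del: ad_pow.simps funpow.simps)
qed

text \<open>The vanishing of ad(B)^k A^n, solved for its one term with no B on the right.\<close>

lemma B_pow_A_pow_straighten:
  assumes "n < k"
  shows "(B ^^ k) ((A ^^ n) u) \<in> pm.span ((\<lambda>i. (B ^^ (k - i)) ((A ^^ n) ((B ^^ i) u))) ` {1..k})"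
proof -
  have "- ((B ^^ k) ((A ^^ n) u)) \<in> pm.span ((\<lambda>i. (B ^^ (k - i)) ((A ^^ n) ((B ^^ i) u))) ` {1..k})"
    using ad_pow_expand[OF B, of k "A ^^ n" u] ad_pow_A_pow[OF assms, of u] by simp
  then show ?thesis using pm.span_neg by force
qed

end

section \<open>Lowering operators on the symmetric power\<close>

lemma sym_op_zero: "sym_op (\<lambda>v. 0) u = 0"
  by (rule plin_eqI[OF plin_sym_op plin_const0]) (simp add: sym_op_bas plin_zero[OF plin_emb])

lemma sym_op_comm:
  assumes "plin f" "plin g" "\<And>v. f (g v) = g (f v)"
  shows "sym_op f (sym_op g u) = sym_op g (sym_op f u)"
  using sym_op_commutator[OF assms(1,2), of u] by (simp add: assms(3) sym_op_zero)

context minuscule_poset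
begin

abbreviation Ya :: "'c \<Rightarrow> ('p set multiset \<Rightarrow>\<^sub>0 complex) \<Rightarrow> ('p set multiset \<Rightarrow>\<^sub>0 complex)" where
  "Ya b \<equiv> sym_op (yo b)"

definition topv :: "nat \<Rightarrow> ('p set multiset \<Rightarrow>\<^sub>0 complex)" where
  "topv m = bas (replicate_mset m UNIV)"

lemma Ya_comm: "\<not> adj a b \<Longrightarrow> Ya a (Ya b u) = Ya b (Ya a u)"
  using sym_op_comm[OF plin_ops(1,1), of a b u] yo_commute[of a b] by (cases "a = b") auto

text \<open>On a single ideal the commutator multiplied by \<open>yo a\<close> or
  \<open>yo b\<close>, on either side, consists of terms that are zero by \<open>yo_yo\<close> and
  \<open>yo_yo_yo\<close>.\<close>

lemma serre_pair_Ya: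
  assumes ab: "adj a b"
  shows "serre_pair (Ya a) (Ya b) (sym_op (\<lambda>v. yo b (yo a v) - yo a (yo b v)))"
proof
  let ?c = "\<lambda>v. yo b (yo a v) - yo a (yo b v)"
  have c: "plin ?c" by (rule plin_minus[OF plin_compose[OF plin_ops(1,1)] plin_compose[OF plin_ops(1,1)]])
  have "sym_op ?c u = Ya b (Ya a u) - Ya a (Ya b u)" for u
    by (rule sym_op_commutator[OF plin_ops(1,1)])
  then show "Ya b (Ya a u) = Ya a (Ya b u) + sym_op ?c u" for u by simp
  have ba: "adj b a" using ab adj_sym by simp
  have ca: "?c (yo a v) = yo a (?c v)" for v
    by (simp add: yo_yo yo_yo_yo[OF ab] plin_diff[OF plin_ops(1)] plin_zero[OF plin_ops(1)])
  have cb: "?c (yo b v) = yo b (?c v)" for v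
    by (simp add: yo_yo yo_yo_yo[OF ba] plin_diff[OF plin_ops(1)] plin_zero[OF plin_ops(1)])
  show "sym_op ?c (Ya a u) = Ya a (sym_op ?c u)" for u using ca by (rule sym_op_comm[where f = ?c and g = "yo a", OF c plin_ops(1)])
  show "sym_op ?c (Ya b u) = Ya b (sym_op ?c u)" for u using cb by (rule sym_op_comm[where f = ?c and g = "yo b", OF c plin_ops(1)])
qed (rule plin_sym_op)+

lemma topv_Suc: "topv (Suc m) = bas {#UNIV#} * topv m"
  by (simp add: topv_def bas_mult)

lemma removable_UNIV: "removable \<kappa> b UNIV x \<longleftrightarrow> x = t \<and> b = \<kappa> t"
proof
  assume r: "removable \<kappa> b UNIV x"
  then have "\<not> x < t" by (auto simp: removable_def)
  then have "x = t" using le_t[of x] by (simp add: order.order_iff_strict)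
  then show "x = t \<and> b = \<kappa> t" using r by (simp add: removable_def)
qed (use t_max in \<open>simp add: removable_def\<close>)

lemma Ya_topv: "b \<noteq> \<kappa> t \<Longrightarrow> Ya b (topv m) = 0"
proof (induction m)
  case 0
  show ?case unfolding topv_def using sym_op_empty by simp
next
  case (Suc m)
  have "yo b (bas UNIV) = 0" using Suc.prems by (intro yo_bas_0) (simp add: removable_UNIV)
  then show ?case using Suc by (simp add: topv_Suc sym_op_mult sym_op_gen plin_zero[OF plin_emb])
qed

lemma Ya_Ya_gen: "Ya b (Ya b (bas {#I#})) = 0"
  by (simp add: sym_op_gen sym_op_emb plin_ops yo_yo plin_zero[OF plin_emb])

text \<open>Each of the m factors can be hit at most once.\<close>

lemma Ya_pow_topv: "m < k \<Longrightarrow> (Ya b ^^ k) (topv m) = 0"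
proof (induction m arbitrary: k)
  case 0
  then obtain k' where "k = Suc k'" by (cases k) auto
  moreover have "Ya b (topv 0) = 0" unfolding topv_def using sym_op_empty by simp
  ultimately show ?case
    by (simp add: funpow_Suc_right plin_zero[OF plin_funpow[OF plin_sym_op]] del: funpow.simps)
next
  case (Suc m)
  then obtain k' where k': "k = Suc k'" "m < k'" by (cases k) auto
  show ?case
    unfolding k'(1) topv_Suc sym_op_funpow_mult[OF Ya_Ya_gen]
    using Suc.IH[of k'] Suc.IH[of "Suc k'"] k' by simp
qed

section \<open>Monomials along filters\<close>

text \<open>A linear extension of a filter, listed downwards; initial segments are again of this
  kind.\<close>

definition flist :: "'p list \<Rightarrow> bool" where
  "flist xs \<longleftrightarrow> distinct xs \<and> set xs \<in> order_filters \<and> sorted_wrt (\<lambda>u v. \<not> u < v) xs"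

text \<open>The head of the list acts first. Undivided powers suffice as long as only spans matter;
  \<open>stackwise_vector_mon\<close> restores the factorials.\<close>

definition mon :: "'p list \<Rightarrow> ('p \<Rightarrow> nat) \<Rightarrow> ('p set multiset \<Rightarrow>\<^sub>0 complex) \<Rightarrow>
    ('p set multiset \<Rightarrow>\<^sub>0 complex)" where
  "mon xs n = fold (\<lambda>y. Ya (\<kappa> y) ^^ n y) xs"

lemma mon_simps [simp]: "mon [] n u = u" "mon (x # xs) n u = mon xs n ((Ya (\<kappa> x) ^^ n x) u)"
  "mon (xs @ zs) n u = mon zs n (mon xs n u)"
  by (simp_all add: mon_def)

lemma plin_mon: "plin (mon xs n)"
proof (induction xs)
  case Nil
  then show ?case by (simp add: mon_def plin_id id_def)
next
  case (Cons x xs)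
  have "mon (x # xs) n = (\<lambda>u. mon xs n ((Ya (\<kappa> x) ^^ n x) u))" by auto
  then show ?case using plin_compose[OF Cons plin_funpow[OF plin_sym_op]] by simp
qed

lemma mon_cong: "(\<And>x. x \<in> set xs \<Longrightarrow> n x = n' x) \<Longrightarrow> mon xs n u = mon xs n' u"
  by (induction xs arbitrary: u) auto

lemma mon_commute:
  assumes "\<And>z. z \<in> set xs \<Longrightarrow> \<not> adj b (\<kappa> z)"
  shows "mon xs n ((Ya b ^^ k) u) = (Ya b ^^ k) (mon xs n u)"
proof -
  have 1: "Ya c ((Ya b ^^ k) u) = (Ya b ^^ k) (Ya c u)" if "\<not> adj b c" for c u
    using that by (induction k) (simp_all add: Ya_comm[of b c, symmetric])
  have 2: "(Ya c ^^ l) ((Ya b ^^ k) u) = (Ya b ^^ k) ((Ya c ^^ l) u)" if "\<not> adj b c" for c u l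
    by (induction l) (simp_all add: 1[OF that])
  show ?thesis using assms by (induction xs arbitrary: u) (simp_all add: 2)
qed

lemma flist_butlast:
  assumes "flist (xs @ zs)" shows "flist xs"
proof -
  have "y \<in> set xs" if x: "x \<in> set xs" and "x \<le> y" for x y
  proof (rule ccontr)
    assume y: "y \<notin> set xs"
    then have "x < y" using that by (auto simp: order.order_iff_strict)
    have "y \<in> set (xs @ zs)" using assms x \<open>x \<le> y\<close> filterD[of "set (xs @ zs)" x y] by (simp add: flist_def)
    then show False using y x \<open>x < y\<close> assms by (auto simp: flist_def sorted_wrt_append)
  qed
  then show ?thesis using assms by (auto simp: flist_def order_filters_def sorted_wrt_append)
qed

lemma flist_snoc:
  assumes "flist xs" "x \<notin> set xs" "\<And>z. x < z \<Longrightarrow> z \<in> set xs"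
  shows "flist (xs @ [x])"
proof -
  have F: "set xs \<in> order_filters" using assms(1) by (simp add: flist_def)
  have "\<not> y < x" if "y \<in> set xs" for y
    using filterD[OF F that, of x] assms(2) less_imp_le by blast
  moreover have "set (xs @ [x]) \<in> order_filters"
    unfolding order_filters_def
  proof (intro CollectI ballI allI impI)
    fix a y assume a: "a \<in> set (xs @ [x])" and y: "a \<le> y"
    show "y \<in> set (xs @ [x])"
    proof (cases "a \<in> set xs")
      case True
      then show ?thesis using filterD[OF F True y] by simp
    next
      case False
      then have "a = x" using a by simp
      then have "y = x \<or> x < y" using y by (simp add: order.order_iff_strict) auto
      then show ?thesis using assms(3)[of y] by auto
    qed
  qed
  ultimately show ?thesis
    using assms(1,2) by (simp add: flist_def sorted_wrt_append)
qed

lemma filter_remove: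
  assumes F: "F \<in> order_filters" and m: "\<forall>b\<in>F. \<not> b < x"
  shows "F - {x} \<in> order_filters"
  unfolding order_filters_def
proof (intro CollectI ballI allI impI)
  fix a y assume a: "a \<in> F - {x}" and y: "a \<le> y"
  have "y \<noteq> x" using a y m by (auto simp: order.order_iff_strict)
  then show "y \<in> F - {x}" using filterD[OF F _ y] a by simp
qed

lemma flist_remove:
  assumes F: "F \<in> order_filters" and x: "x \<in> F" and xs: "flist xs" "set xs = F - {x}"
  shows "flist (xs @ [x])" "set (xs @ [x]) = F"
proof -
  have "z \<in> set xs" if "x < z" for z
    using filterD[OF F x, of z] that xs(2) by (auto simp: order.strict_iff_order)
  then show "flist (xs @ [x])" using flist_snoc[OF xs(1), of x] xs(2) by simp
  show "set (xs @ [x]) = F" using xs(2) x by auto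
qed

lemma flist_exists: "F \<in> order_filters \<Longrightarrow> \<exists>xs. flist xs \<and> set xs = F"
proof (induction "card F" arbitrary: F)
  case 0
  then have "F = {}" by simp
  then show ?case by (intro exI[of _ "[]"]) (simp add: flist_def order_filters_def)
next
  case (Suc n)
  then obtain x0 where "x0 \<in> F" by (metis card.empty ex_in_conv nat.distinct(1))
  then obtain x where x: "x \<in> F" "\<forall>b\<in>F. \<not> b < x" using finite_minimal[of x0 F] by auto
  have "F - {x} \<in> order_filters"
    using filter_remove[OF Suc.prems x(2)] .
  moreover have "n = card (F - {x})" using Suc.hyps(2) x by simp
  ultimately obtain xs where xs: "flist xs" "set xs = F - {x}" using Suc.hyps(1)[of "F - {x}"] by blast
  show ?case using flist_remove[OF Suc.prems x(1) xs] by blast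
qed

text \<open>The last element of one list is incomparable to everything that follows it in the other.
  By AC the colors are then not adjacent, so its operator can be moved to the end.\<close>

lemma mon_permute:
  "flist xs \<Longrightarrow> flist zs \<Longrightarrow> set xs = set zs \<Longrightarrow> mon xs n u = mon zs n u"
proof (induction zs arbitrary: xs rule: rev_induct)
  case Nil
  then show ?case by simp
next
  case (snoc z zs)
  then have "z \<in> set xs" by simp
  then obtain xs1 xs2 where xs: "xs = xs1 @ z # xs2" by (auto dest: split_list)
  have z: "z \<notin> set zs" "z \<notin> set xs1" "z \<notin> set xs2" using snoc.prems by (auto simp: xs flist_def)
  have set: "set (xs1 @ xs2) = set zs" using snoc.prems(3) z by (auto simp: xs)
  have inc: "\<not> z < w" "\<not> w < z" if "w \<in> set xs2" for w
    using snoc.prems set that by (auto simp: xs flist_def sorted_wrt_append)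
  have nadj: "\<not> adj (\<kappa> z) (\<kappa> w)" if "w \<in> set xs2" for w
    using AC[of z w] inc[OF that] by blast
  have "flist zs" using snoc.prems(2) by (rule flist_butlast)
  moreover have "flist (xs1 @ xs2)"
    using snoc.prems(1) \<open>flist zs\<close> unfolding flist_def set by (auto simp: xs sorted_wrt_append)
  ultimately have "mon (xs1 @ xs2) n u = mon zs n u" using snoc.IH set by blast
  then show ?case by (simp add: xs mon_commute[OF nadj])
qed

text \<open>Ranging over all lists makes the space depend on F alone; by \<open>mon_permute\<close>
  one list yields all generators.\<close>

definition cell :: "nat \<Rightarrow> 'p set \<Rightarrow> ('p set multiset \<Rightarrow>\<^sub>0 complex) set" where
  "cell m F = pm.span {mon xs n (topv m) |xs n. flist xs \<and> set xs = F}"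

lemma subspace_cell: "pm.subspace (cell m F)"
  by (simp add: cell_def)

lemma mon_cell: "flist xs \<Longrightarrow> mon xs n (topv m) \<in> cell m (set xs)"
  unfolding cell_def by (intro pm.span_base) auto

lemma cell_map:
  assumes xs: "flist xs" and f: "plin f" and T: "pm.subspace T"
    and m: "\<And>n. f (mon xs n (topv m)) \<in> T" and x: "x \<in> cell m (set xs)"
  shows "f x \<in> T"
proof (rule plin_span_subspace[OF f T])
  show "x \<in> pm.span {mon xs' n (topv m) |xs' n. flist xs' \<and> set xs' = set xs}"
    using x by (simp add: cell_def)
  fix s assume "s \<in> {mon xs' n (topv m) |xs' n. flist xs' \<and> set xs' = set xs}"
  then obtain xs' n where "s = mon xs' n (topv m)" "flist xs'" "set xs' = set xs" by auto
  then show "f s \<in> T" using m mon_permute[OF xs] by metis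
qed

lemma mon_cell_append:
  assumes "flist (xs @ zs)" "u \<in> cell m (set xs)"
  shows "mon zs n u \<in> cell m (set (xs @ zs))"
proof (rule cell_map[OF flist_butlast[OF assms(1)] plin_mon subspace_cell _ assms(2)])
  fix n'
  \<comment> \<open>The two exponent functions live on disjoint parts of a distinct list and can be
    merged.\<close>
  let ?n = "\<lambda>y. if y \<in> set zs then n y else n' y"
  have "mon xs n' (topv m) = mon xs ?n (topv m)"
    using assms(1) by (intro mon_cong) (auto simp: flist_def)
  moreover have "mon zs n u = mon zs ?n u" for u by (intro mon_cong) auto
  ultimately have "mon zs n (mon xs n' (topv m)) = mon (xs @ zs) ?n (topv m)" by simp
  then show "mon zs n (mon xs n' (topv m)) \<in> cell m (set (xs @ zs))"
    using mon_cell[OF assms(1)] by simp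
qed

lemma cell_snoc:
  assumes xs: "flist (xs @ [x])"
  shows "cell m (set (xs @ [x])) = strings (Ya (\<kappa> x)) (cell m (set xs))"
proof
  show "cell m (set (xs @ [x])) \<subseteq> strings (Ya (\<kappa> x)) (cell m (set xs))"
  proof
    fix u assume u: "u \<in> cell m (set (xs @ [x]))"
    have "mon (xs @ [x]) n (topv m) \<in> strings (Ya (\<kappa> x)) (cell m (set xs))" for n
      using stringsI[OF mon_cell[OF flist_butlast[OF xs]]] by simp
    from cell_map[OF xs plin_id subspace_strings this u]
    show "u \<in> strings (Ya (\<kappa> x)) (cell m (set xs))" .
  qed
  show "strings (Ya (\<kappa> x)) (cell m (set xs)) \<subseteq> cell m (set (xs @ [x]))"
  proof
    fix u assume u: "u \<in> strings (Ya (\<kappa> x)) (cell m (set xs))"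
    have "(Ya (\<kappa> x) ^^ k) u \<in> cell m (set (xs @ [x]))" if "u \<in> cell m (set xs)" for k u
      using mon_cell_append[OF xs that, of "\<lambda>_. k"] by simp
    from strings_map[OF plin_id subspace_cell this u] show "u \<in> cell m (set (xs @ [x]))" .
  qed
qed

section \<open>Stability of cells under lowering operators\<close>

text \<open>The top element x of color b lies outside F and would be below g. As x cannot be added
  to F, some element of adjacent color above x is outside F too; together with g it violates
  UCB1.\<close>

lemma neighbor_free:
  assumes F: "F \<in> order_filters" and nb: "\<And>x. x \<in> F \<Longrightarrow> \<kappa> x \<noteq> b"
    and na: "\<And>x. x \<notin> F \<Longrightarrow> \<kappa> x = b \<Longrightarrow> \<exists>z>x. z \<notin> F" and g: "g \<in> F"
  shows "\<not> adj b (\<kappa> g)"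
proof
  assume "adj b (\<kappa> g)"
  then have gb: "adj (\<kappa> g) b" using adj_sym by simp
  obtain x where x: "\<kappa> x = b" "\<not> (\<exists>z. x < z \<and> \<kappa> z = \<kappa> x)" using top_color .
  have xF: "x \<notin> F" using nb x(1) by auto
  have "\<not> g < x" using filterD[OF F g] xF by (auto dest: less_imp_le)
  then have xg: "x < g" using AC[of g x] gb x(1) by simp
  obtain z where z: "x < z" "z \<notin> F" using na[OF xF x(1)] by blast
  from adj_above_ex[OF z(1)] obtain c where c: "x < c" "c \<le> z" "adj (\<kappa> c) (\<kappa> x)" by blast
  have "c \<notin> F" using filterD[OF F _ c(2)] z(2) by blast
  then have "c \<noteq> g" using g by auto
  moreover have "card {c, g} \<le> card {z. x < z \<and> adj (\<kappa> z) (\<kappa> x)}"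
    using c xg gb x(1) by (intro card_mono) auto
  ultimately show False using UCB1[OF x(2)] by simp
qed

text \<open>Two elements of adjacent color in F below z would exhaust the two that ICE2 places
  between z and the preceding y of color b. But y cannot be added to F, so one of those is outside
  F. If there is no y, LCB1 applies.\<close>

lemma unique_neighbor_below:
  assumes F: "F \<in> order_filters" and z: "z \<in> F" "\<kappa> z = b" and low: "\<And>y. y \<in> F \<Longrightarrow> \<kappa> y = b \<Longrightarrow> \<not> y < z"
    and na: "\<And>x. x \<notin> F \<Longrightarrow> \<kappa> x = b \<Longrightarrow> \<exists>z>x. z \<notin> F" and g0: "g0 \<in> F" "g0 < z"
  shows "\<exists>w\<in>F. w < z \<and> adj (\<kappa> w) b \<and> (\<forall>g\<in>F. g < z \<longrightarrow> adj (\<kappa> g) b \<longrightarrow> g = w) \<and>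
    (\<forall>g\<in>F. g < z \<longrightarrow> g \<le> w)"
proof -
  have cov: "\<exists>w. w \<in> F \<and> w < z \<and> g \<le> w \<and> adj (\<kappa> w) b" if g: "g \<in> F" "g < z" for g
  proof -
    obtain c where c: "covered_by c z" "c < z" "g \<le> c" "adj (\<kappa> c) (\<kappa> z)" by (rule adj_below[OF g(2)])
    then show ?thesis using filterD[OF F g(1) c(3)] z(2) by blast
  qed
  have uniq: "w1 = w2"
    if w1: "w1 \<in> F" "w1 < z" "adj (\<kappa> w1) b" and w2: "w2 \<in> F" "w2 < z" "adj (\<kappa> w2) b" for w1 w2
  proof (rule ccontr)
    assume neq: "w1 \<noteq> w2"
    show False
    proof (cases "\<exists>y. y < z \<and> \<kappa> y = \<kappa> z")
      case False
      have "card {w1, w2} \<le> card {y. y < z \<and> adj (\<kappa> y) (\<kappa> z)}"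
        using w1 w2 z by (intro card_mono) auto
      then show False using LCB1[OF False] neq by simp
    next
      case True
      then obtain y0 where "y0 < z" "\<kappa> y0 = \<kappa> z" by blast
      then obtain y where y: "y < z" "\<kappa> y = \<kappa> z" "\<not> (\<exists>u. y < u \<and> u < z \<and> \<kappa> u = \<kappa> z)"
        by (rule previous_color)
      have yF: "y \<notin> F" using low[of y] y z by auto
      have above: "y < w" if "w \<in> F" "adj (\<kappa> w) b" for w
        using AC[of w y] that y(2) z(2) filterD[OF F that(1)] yF by (auto dest: less_imp_le)
      let ?A = "{u. y < u \<and> u < z \<and> adj (\<kappa> u) (\<kappa> y)}"
      have "card ?A = 2" using ICE2[OF y(1,2)] y by simp
      moreover have "{w1, w2} \<subseteq> ?A" using w1 w2 above y(2) z(2) by auto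
      ultimately have A: "{w1, w2} = ?A" using neq by (intro card_subset_eq) auto
      obtain c0 where c0: "y < c0" "c0 \<notin> F" using na[OF yF] y(2) z(2) by auto
      from adj_above_ex[OF c0(1)] obtain c where c: "y < c" "c \<le> c0" "adj (\<kappa> c) (\<kappa> y)" by blast
      have cF: "c \<notin> F" using filterD[OF F _ c(2)] c0(2) by blast
      have "\<not> z < c" using filterD[OF F z(1)] cF by (auto dest: less_imp_le)
      then have "c < z" using AC[of c z] c(3) y(2) by simp
      then have "c \<in> {w1, w2}" unfolding A using c by simp
      then show False using cF w1(1) w2(1) by auto
    qed
  qed
  obtain w where w: "w \<in> F" "w < z" "adj (\<kappa> w) b" using cov[OF g0] by blast
  have "g \<le> w" if g: "g \<in> F" "g < z" for g
  proof -
    obtain w' where w': "w' \<in> F" "w' < z" "g \<le> w'" "adj (\<kappa> w') b" using cov[OF g] by blast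
    then show ?thesis using uniq[OF w'(1,2,4) w] by simp
  qed
  then show ?thesis using w uniq by blast
qed

text \<open>
  If \<open>b\<close> occurs in \<open>F\<close> but its lowest element \<open>z\<close> there is not minimal in \<open>F\<close>, a single neighbor \<open>w\<close>
  lies below \<open>z\<close>, and the exchange relation of type \<open>A\<^sub>2\<close> moves \<open>Y\<^sub>b\<close> past \<open>w\<close> and \<open>z\<close>, leaving behind
  at most a factor \<open>Y\<^sub>w\<close> that acts on a smaller filter.
\<close>

theorem cell_stable:
  assumes "F \<in> order_filters" and "\<And>x. x \<notin> F \<Longrightarrow> \<kappa> x = b \<Longrightarrow> \<exists>z>x. z \<notin> F"
    and "u \<in> cell m F"
  shows "Ya b u \<in> cell m F"
  using assms
proof (induction "card F" arbitrary: F b u rule: less_induct)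
  case less
  note F = less.prems(1) and na = less.prems(2)
  consider (rem) x where "x \<in> F" "\<kappa> x = b" "\<And>z. z \<in> F \<Longrightarrow> \<not> z < x"
    | (none) "\<And>x. x \<in> F \<Longrightarrow> \<kappa> x \<noteq> b"
    | (neutral) z g0 where "z \<in> F" "\<kappa> z = b" "\<And>y. y \<in> F \<Longrightarrow> \<kappa> y = b \<Longrightarrow> \<not> y < z" "g0 \<in> F" "g0 < z"
  proof (cases "\<exists>x\<in>F. \<kappa> x = b")
    case True
    then obtain x0 where "x0 \<in> {x\<in>F. \<kappa> x = b}" by auto
    from finite_minimal[OF this] obtain z where "z \<in> F" "\<kappa> z = b" "\<And>y. y \<in> F \<Longrightarrow> \<kappa> y = b \<Longrightarrow> \<not> y < z"
      by auto
    then show thesis using rem neutral by blast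
  qed (use none in blast)
  then show ?case
  proof cases
    case rem
    have F': "F - {x} \<in> order_filters" using filter_remove[OF F] rem(3) by blast
    then obtain xs where xs: "flist xs" "set xs = F - {x}" using flist_exists by blast
    have "cell m F = strings (Ya b) (cell m (F - {x}))"
      using cell_snoc[OF flist_remove(1)[OF F rem(1) xs], of m] xs(2) rem(2)
      unfolding flist_remove(2)[OF F rem(1) xs] by simp
    then show ?thesis using strings_closed[OF plin_sym_op] less.prems(3) by simp
  next
    case none
    obtain xs where xs: "flist xs" "set xs = F" using flist_exists F by blast
    \<comment> \<open>Otherwise \<open>t\<close> could be added to F.\<close>
    have "b \<noteq> \<kappa> t" using na[of t] none[of t] t_max by auto
    moreover have "\<not> adj b (\<kappa> g)" if "g \<in> set xs" for g
      using neighbor_free[OF F none na] that xs(2) by blast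
    ultimately have "Ya b (mon xs n (topv m)) = 0" for n
      using mon_commute[of xs b n 1 "topv m"] Ya_topv[of b m] by (simp add: plin_zero[OF plin_mon])
    then have "Ya b u \<in> cell m F"
      using cell_map[OF xs(1) plin_sym_op subspace_cell] less.prems(3) pm.subspace_0[OF subspace_cell]
      unfolding xs(2) by metis
    then show ?thesis .
  next
    case neutral
    define Q where "Q w \<longleftrightarrow> w < z \<and> adj (\<kappa> w) b \<and> (\<forall>g\<in>F. g < z \<longrightarrow> adj (\<kappa> g) b \<longrightarrow> g = w) \<and>
      (\<forall>g\<in>F. g < z \<longrightarrow> g \<le> w)" for w
    have "\<exists>w\<in>F. Q w"
      unfolding Q_def by (rule unique_neighbor_below[OF F neutral(1,2,3) na neutral(4,5)])
    then obtain w where wF: "w \<in> F" and Q: "Q w" by blast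
    have w: "w \<in> F" "w < z" "adj (\<kappa> w) b" "\<And>g. g \<in> F \<Longrightarrow> g < z \<Longrightarrow> adj (\<kappa> g) b \<Longrightarrow> g = w"
      "\<And>g. g \<in> F \<Longrightarrow> g < z \<Longrightarrow> g \<le> w"
      using wF Q unfolding Q_def by blast+
    obtain xs where xs: "flist xs" "set xs = F" using flist_exists F by blast
    \<comment> \<open>The list is rearranged so that z and w become consecutive: elements not below
      z, then z, w, and the rest, which lies below w.\<close>
    define xz where "xz = filter (\<lambda>g. \<not> g \<le> z) xs"
    define rs where "rs = filter (\<lambda>g. g < w) xs"
    have xz: "set xz = {g\<in>F. \<not> g \<le> z}" and rs: "set rs = {g\<in>F. g < w}"
      using xs by (auto simp: xz_def rs_def)
    have below: "g \<le> z" if "g < w" for g using that w(2) by (meson less_imp_le order.trans)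
    have nzw: "\<not> z < w" "\<not> w = z" "w \<le> z" using w(2) by auto
    have setF: "set ((xz @ [z] @ [w]) @ rs) = F"
      using xz rs neutral(1) w(1,5) by (auto simp: order.order_iff_strict)
    have nrs: "\<not> z < r" "\<not> w < r" "r \<noteq> z" "r \<noteq> w" if "r < w" for r
      using that w(2) by (auto dest: order.strict_trans)
    have nxz: "\<not> g < r" if "\<not> g \<le> z" "r \<le> z" for g r
      using that by (meson less_imp_le order.trans)
    have fl: "flist ((xz @ [z] @ [w]) @ rs)"
    proof -
      have "sorted_wrt (\<lambda>u v. \<not> u < v) xz" "sorted_wrt (\<lambda>u v. \<not> u < v) rs" "distinct xz" "distinct rs"
        using xs(1) by (simp_all add: flist_def xz_def rs_def sorted_wrt_filter)
      then show ?thesis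
        unfolding flist_def setF
        using F nzw nrs nxz below by (auto simp: sorted_wrt_append xz rs)
    qed
    have fl1: "flist (xz @ [z] @ [w])" using fl by (rule flist_butlast)
    have fl2: "flist (xz @ [z])" using flist_butlast[of "xz @ [z]" "[w]"] fl1 by simp
    have fl3: "flist xz" using fl2 by (rule flist_butlast)
    let ?U = "cell m (set xz)"
    have cellw: "cell m (set (xz @ [z] @ [w])) = strings (Ya (\<kappa> w)) (strings (Ya b) ?U)"
      using cell_snoc[of "xz @ [z]" w m] cell_snoc[of xz z m] fl1 fl2 neutral(2) by simp
    \<comment> \<open>The induction hypothesis at the smaller filter: an element of the color of w
      cannot be added to it, since z is above that element and missing as well.\<close>
    have U: "Ya (\<kappa> w) u \<in> ?U" if "u \<in> ?U" for u
    proof (rule less.hyps)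
      have "set xz \<subset> F" using xz neutral(1) by auto
      then show "card (set xz) < card F" by (simp add: psubset_card_mono)
      show "set xz \<in> order_filters" using fl3 by (simp add: flist_def)
      show "u \<in> ?U" by (rule that)
      fix x assume x: "x \<notin> set xz" "\<kappa> x = \<kappa> w"
      have "x \<le> w"
      proof (rule ccontr)
        assume n: "\<not> x \<le> w"
        then have "w \<le> x" using EC[OF x(2)] by blast
        then have xF: "x \<in> F" using filterD[OF F w(1)] by blast
        then have "x \<le> z" using x(1) xz by auto
        moreover have "x \<noteq> z" using x(2) w(3) neutral(2) by auto
        ultimately have "x < z" by (simp add: order.order_iff_strict)
        then show False using w(5)[OF xF] n by blast
      qed
      then have "x < z" using w(2) by (rule order.strict_trans1)
      moreover have "z \<notin> set xz" using xz by auto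
      ultimately show "\<exists>z>x. z \<notin> set xz" by blast
    qed
    \<comment> \<open>w is the only element of F below z with color adjacent to b, so
      \<open>Ya b\<close> passes all the remaining operators.\<close>
    have nadj: "\<not> adj b (\<kappa> r)" if r: "r \<in> set rs" for r
    proof
      assume "adj b (\<kappa> r)"
      then have "adj (\<kappa> r) b" using adj_sym by simp
      moreover have "r \<in> F" "r < w" "r < z" using r rs w(2) by (auto dest: order.strict_trans)
      ultimately show False using w(4)[of r] by simp
    qed
    interpret serre_pair "Ya (\<kappa> w)" "Ya b" "sym_op (\<lambda>v. yo b (yo (\<kappa> w) v) - yo (\<kappa> w) (yo b v))"
      using serre_pair_Ya[OF w(3)] .
    have "Ya b (mon ((xz @ [z] @ [w]) @ rs) n (topv m)) \<in> cell m F" for n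
    proof -
      let ?x = "mon (xz @ [z] @ [w]) n (topv m)"
      have "Ya b ?x \<in> cell m (set (xz @ [z] @ [w]))"
        unfolding cellw
        by (rule strings_exchange[OF U mon_cell[OF fl1, of n m, unfolded cellw]])
      then have "mon rs n (Ya b ?x) \<in> cell m F"
        using mon_cell_append[OF fl] setF by simp
      then show ?thesis using mon_commute[OF nadj, of rs n 1 ?x] by simp
    qed
    then show ?thesis
      using cell_map[OF fl plin_sym_op subspace_cell] less.prems(3) unfolding setF by blast
  qed
qed

end

section \<open>Straightening\<close>

context minuscule_poset
begin

text \<open>
  The relation \<open>ad(Y\<^sub>x)\<^sup>k (Y\<^sub>z\<^sup>n) = 0\<close> for \<open>k > n\<close> trades powers of \<open>Y\<^sub>x\<close> on the left of \<open>Y\<^sub>z\<close> for powers on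
  its right, which are absorbed by the span of the filter obtained by removing everything below \<open>z\<close>.
\<close>

theorem straighten:
  assumes xs: "flist xs" and x: "x \<notin> set xs" and cov: "covered_by x z" and z: "z \<in> set xs" and k: "n z < k"
  shows "(Ya (\<kappa> x) ^^ k) (mon xs n (topv m)) \<in> pm.span (\<Union>k'\<in>{..<k}. (Ya (\<kappa> x) ^^ k') ` cell m (set xs))"
proof -
  define F where "F = set xs"
  have F: "F \<in> order_filters" using xs by (simp add: flist_def F_def)
  have zF: "z \<in> F" and xF: "x \<notin> F" using z x by (simp_all add: F_def)
  have xz_adj: "adj (\<kappa> z) (\<kappa> x)" using NA[OF cov] adj_sym by simp
  have xltz: "x < z" and nobetween: "\<And>u. x < u \<Longrightarrow> u < z \<Longrightarrow> False" using cov by (auto simp: covered_by_def)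
  \<comment> \<open>Elements not below z come first, then z, then those below z.\<close>
  define xz where "xz = filter (\<lambda>g. \<not> g \<le> z) xs"
  define rs where "rs = filter (\<lambda>g. g < z) xs"
  have xz: "set xz = {g\<in>F. \<not> g \<le> z}" and rs: "set rs = {g\<in>F. g < z}"
    by (auto simp: xz_def rs_def F_def)
  have setF: "set ((xz @ [z]) @ rs) = F"
    using xz rs zF by (auto simp: order.order_iff_strict)
  have nxz: "\<not> g < r" if "\<not> g \<le> z" "r \<le> z" for g r
    using that by (meson less_imp_le order.trans)
  have fl: "flist ((xz @ [z]) @ rs)"
  proof -
    have "sorted_wrt (\<lambda>u v. \<not> u < v) xz" "sorted_wrt (\<lambda>u v. \<not> u < v) rs" "distinct xz" "distinct rs"
      using xs by (simp_all add: flist_def xz_def rs_def sorted_wrt_filter)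
    then show ?thesis
      unfolding flist_def setF
      using F nxz by (auto simp: sorted_wrt_append xz rs)
  qed
  have fl1: "flist (xz @ [z])" using fl by (rule flist_butlast)
  have fl2: "flist xz" using fl1 by (rule flist_butlast)
  let ?A = "Ya (\<kappa> z)" and ?B = "Ya (\<kappa> x)"
  let ?u = "mon xz n (topv m)"
  let ?T = "pm.span (\<Union>k'\<in>{..<k}. (?B ^^ k') ` cell m F)"
  \<comment> \<open>Every element of the color of x outside \<open>set xz\<close> lies below z, so
    none can be added and powers of the operator of x are absorbed.\<close>
  have stable: "(?B ^^ i) ?u \<in> cell m (set xz)" for i
  proof (induction i)
    case 0
    show ?case using mon_cell[OF fl2] by simp
  next
    case (Suc i)
    have "?B ((?B ^^ i) ?u) \<in> cell m (set xz)"
    proof (rule cell_stable)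
      show "set xz \<in> order_filters" using fl2 by (simp add: flist_def)
      show "(?B ^^ i) ?u \<in> cell m (set xz)" by (rule Suc)
      fix y assume y: "y \<notin> set xz" "\<kappa> y = \<kappa> x"
      have "y \<le> x"
      proof (rule ccontr)
        assume n: "\<not> y \<le> x"
        then have xy: "x < y" using EC[of y x] y(2) by (auto simp: order.order_iff_strict)
        have yz: "y \<noteq> z" using y(2) xz_adj by auto
        then have "\<not> y \<le> z" using nobetween[OF xy] by (auto simp: order.order_iff_strict)
        then have "y \<notin> F" using y(1) xz by auto
        then have "\<not> z < y" using filterD[OF F zF] less_imp_le by blast
        moreover have "z < y \<or> y < z" using AC[of z y] xz_adj y(2) by simp
        ultimately show False using nobetween[OF xy] by blast
      qed
      then have "y < z" using xltz by (rule order.strict_trans1)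
      moreover have "z \<notin> set xz" using xz by auto
      ultimately show "\<exists>z>y. z \<notin> set xz" by blast
    qed
    then show ?case by simp
  qed
  \<comment> \<open>r lies below z and is not below x; were its color adjacent to that of x, it
    would lie strictly between x and z.\<close>
  have nadj: "\<not> adj (\<kappa> x) (\<kappa> r)" if r: "r \<in> set rs" for r
  proof
    assume "adj (\<kappa> x) (\<kappa> r)"
    then have "x < r \<or> r < x" by (rule AC)
    moreover have rF: "r \<in> F" "r < z" using r rs by auto
    moreover have "\<not> r < x" using filterD[OF F rF(1)] xF less_imp_le by blast
    ultimately show False using nobetween by blast
  qed
  have comm: "mon rs n ((?B ^^ i) w) = (?B ^^ i) (mon rs n w)" for i w
    by (rule mon_commute[OF nadj])
  interpret serre_pair ?A ?B "sym_op (\<lambda>v. yo (\<kappa> x) (yo (\<kappa> z) v) - yo (\<kappa> z) (yo (\<kappa> x) v))"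
    using serre_pair_Ya[OF xz_adj] .
  have "mon rs n ((?B ^^ k) ((?A ^^ n z) ?u)) \<in> ?T"
  proof (rule plin_span[OF plin_mon _ B_pow_A_pow_straighten[OF k]])
    fix s assume "s \<in> (\<lambda>i. (?B ^^ (k - i)) ((?A ^^ n z) ((?B ^^ i) ?u))) ` {1..k}"
    then obtain i where i: "i \<in> {1..k}" "s = (?B ^^ (k - i)) ((?A ^^ n z) ((?B ^^ i) ?u))" by auto
    have "mon ([z] @ rs) n ((?B ^^ i) ?u) \<in> cell m F"
      using mon_cell_append[of xz "[z] @ rs" _ m n] fl stable setF by simp
    then have "mon rs n ((?A ^^ n z) ((?B ^^ i) ?u)) \<in> cell m F" by simp
    then have "(?B ^^ (k - i)) (mon rs n ((?A ^^ n z) ((?B ^^ i) ?u))) \<in> ?T"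
      using i(1) by (intro pm.span_base UN_I[of "k - i"] imageI) auto
    then show "mon rs n s \<in> ?T" unfolding i(2) comm .
  qed
  moreover have "mon xs n (topv m) = mon rs n ((?A ^^ n z) ?u)"
    using mon_permute[OF xs fl] setF by (simp add: F_def)
  ultimately show ?thesis unfolding comm F_def by simp
qed

lemma flist_decreasing: "decreasing_linear_extension ys \<longleftrightarrow> flist ys \<and> set ys = UNIV"
  by (auto simp: decreasing_linear_extension_def flist_def order_filters_def)

lemma mono_covers:
  fixes f :: "'p \<Rightarrow> nat"
  assumes c: "\<And>x z. covered_by x z \<Longrightarrow> f x \<le> f z"
  shows "mono f"
proof -
  have "x \<le> y \<Longrightarrow> f x \<le> f y" for x y
  proof (induction "card {w. x < w}" arbitrary: x rule: less_induct)
    case less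
    show ?case
    proof (cases "x = y")
      case False
      then have "x < y" using less.prems by (simp add: order.strict_iff_order)
      then obtain d where d: "covered_by x d" "d \<le> y" by (rule covered_by_above)
      then have "x < d" by (simp add: covered_by_def)
      then have "{w. d < w} \<subset> {w. x < w}" by (auto intro: order.strict_trans)
      then have "f d \<le> f y" using less.hyps[of d] d by (simp add: psubset_card_mono)
      then show ?thesis using c[OF d(1)] by simp
    qed simp
  qed
  then show ?thesis by (rule monoI)
qed

text \<open>Induction on the exponents read from the last position to the first, hence
  \<open>rev\<close>: straightening lowers the exponent at x, keeps those after x, and may change
  the earlier ones arbitrarily.\<close>

theorem cell_UNIV_span:
  assumes ys: "decreasing_linear_extension ys"
  shows "cell m UNIV = pm.span ((\<lambda>\<phi>. mon ys \<phi> (topv m)) ` bounded_mono_maps m)"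
proof
  have fl: "flist ys" and set: "set ys = UNIV" using ys by (simp_all add: flist_decreasing)
  let ?S = "pm.span ((\<lambda>\<phi>. mon ys \<phi> (topv m)) ` bounded_mono_maps m)"
  show "?S \<subseteq> cell m UNIV"
    using mon_cell[OF fl] set by (intro pm.span_minimal subspace_cell) auto
  have "\<forall>n. l = rev (map n ys) \<longrightarrow> mon ys n (topv m) \<in> ?S" for l :: "nat list"
  proof (induction l rule: wf_induct_rule[OF wf_lex[OF wf_less_than]])
    case (1 l)
    show ?case
    proof (intro allI impI)
      fix n assume l: "l = rev (map n ys)"
      consider (basis) "n \<in> bounded_mono_maps m" | (big) "m < n t"
        | (cover) x z where "covered_by x z" "n z < n x"
      proof (cases "mono n")
        case True
        show thesis
        proof (cases "n t \<le> m")
          case nt: True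
          have "n y \<le> m" for y using monoD[OF True le_t[of y]] nt by simp
          then show thesis using basis True by (simp add: bounded_mono_maps_def)
        qed (use big in simp)
      next
        case False
        then obtain x z where "covered_by x z" "\<not> n x \<le> n z" using mono_covers by blast
        then show thesis using cover by simp
      qed
      then show "mon ys n (topv m) \<in> ?S"
      proof cases
        case basis
        then show ?thesis by (intro pm.span_base imageI)
      next
        case big
        \<comment> \<open>\<open>t\<close> heads the list, and more than m applications annihilate
          {P,...,P}.\<close>
        obtain xs zs where yst: "ys = xs @ t # zs" using set by (metis UNIV_I split_list)
        have "xs = []"
        proof (rule ccontr)
          assume "xs \<noteq> []"
          then have "hd xs \<in> set xs" by simp
          then have "\<not> hd xs < t" "hd xs \<noteq> t" using fl by (auto simp: yst flist_def sorted_wrt_append)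
          then show False using le_t[of "hd xs"] by (simp add: order.strict_iff_order)
        qed
        then have "mon ys n (topv m) = 0"
          using Ya_pow_topv[OF big] by (simp add: yst plin_zero[OF plin_mon])
        then show ?thesis by (simp add: pm.span_zero)
      next
        case cover
        obtain xs zs where ysx: "ys = xs @ x # zs" using set by (metis UNIV_I split_list)
        have x: "x \<notin> set xs" "x \<notin> set zs" using fl by (auto simp: ysx flist_def)
        have dis: "set xs \<inter> set zs = {}" using fl by (auto simp: ysx flist_def)
        have xltz: "x < z" using cover(1) by (simp add: covered_by_def)
        have "z \<notin> set zs" using fl xltz by (auto simp: ysx flist_def sorted_wrt_append)
        then have z: "z \<in> set xs" using set xltz by (auto simp: ysx)
        have flx: "flist xs" using flist_butlast fl ysx by simp
        have sub: "mon zs n ((Ya (\<kappa> x) ^^ k) u) \<in> ?S" if k: "k < n x" and u: "u \<in> cell m (set xs)" for k u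
        proof (rule cell_map[OF flx plin_compose[OF plin_mon plin_funpow[OF plin_sym_op]] pm.subspace_span _ u])
          fix n'
          define n'' where "n'' y = (if y \<in> set zs then n y else if y = x then k else n' y)" for y
          have "rev (map n'' ys) = rev (map n zs) @ k # rev (map n'' xs)"
            using x(2) by (simp add: ysx n''_def)
          moreover have "l = rev (map n zs) @ n x # rev (map n xs)" by (simp add: l ysx)
          ultimately have "(rev (map n'' ys), l) \<in> lex less_than"
            using k by (auto simp: lex_conv)
          then have "mon ys n'' (topv m) \<in> ?S" using 1 by blast
          moreover have "mon xs n'' (topv m) = mon xs n' (topv m)"
            using x dis by (intro mon_cong) (auto simp: n''_def)
          moreover have "mon zs n'' u = mon zs n u" for u by (intro mon_cong) (simp add: n''_def)
          moreover have "n'' x = k" using x(2) by (simp add: n''_def)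
          ultimately show "mon zs n ((Ya (\<kappa> x) ^^ k) (mon xs n' (topv m))) \<in> ?S" by (simp add: ysx)
        qed
        have "mon zs n ((Ya (\<kappa> x) ^^ n x) (mon xs n (topv m))) \<in> ?S"
          by (rule plin_span[OF plin_mon _ straighten[where n = n and z = z and k = "n x", OF flx x(1) cover(1) z cover(2)]]) (use sub in auto)
        then show ?thesis by (simp add: ysx)
      qed
    qed
  qed
  then have m: "mon ys n (topv m) \<in> ?S" for n by blast
  show "cell m UNIV \<subseteq> ?S"
  proof
    fix u assume "u \<in> cell m UNIV"
    then have "u \<in> cell m (set ys)" using set by simp
    then show "u \<in> ?S" by (rule cell_map[OF fl plin_id pm.subspace_span m])
  qed
qed

section \<open>Downward vectors\<close>

text \<open>\<open>Y_op\<close> and \<open>yo\<close> agree on ideals only. Downward vectors never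
  leave this span, where the induced operators coincide.\<close>

definition sym_space :: "('p set multiset \<Rightarrow>\<^sub>0 complex) set" where
  "sym_space = pm.span (bas ` {M. set_mset M \<subseteq> order_ideals})"

lemma bas_sym_space: "set_mset M \<subseteq> order_ideals \<Longrightarrow> bas M \<in> sym_space"
  unfolding sym_space_def by (intro pm.span_base imageI) simp

lemma sym_space_keys:
  assumes "u \<in> sym_space" "M \<in> Poly_Mapping.keys u" "I \<in># M" shows "I \<in> order_ideals"
proof -
  let ?T = "{u :: 'p set multiset \<Rightarrow>\<^sub>0 complex. \<forall>M. \<not> set_mset M \<subseteq> order_ideals \<longrightarrow> lk u M = 0}"
  have "pm.span (bas ` {M. set_mset M \<subseteq> order_ideals}) \<subseteq> ?T"
    by (rule pm.span_minimal) (auto simp: pm.subspace_def lookup_add lookup_pscale lookup_single when_def split: if_splits)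
  then show ?thesis using assms unfolding sym_space_def in_keys_iff by blast
qed

lemma subspace_sym_space: "pm.subspace sym_space"
  by (simp add: sym_space_def)

lemma gen_mult_sym_space:
  assumes "I \<in> order_ideals" "u \<in> sym_space" shows "bas {#I#} * u \<in> sym_space"
proof (rule plin_span_subspace[OF plin_mult_left subspace_sym_space])
  show "u \<in> pm.span (bas ` {M. set_mset M \<subseteq> order_ideals})" using assms(2) by (simp add: sym_space_def)
  fix s assume "s \<in> bas ` {M :: 'p set multiset. set_mset M \<subseteq> order_ideals}"
  then obtain M where "s = bas M" "set_mset M \<subseteq> order_ideals" by auto
  then show "bas {#I#} * s \<in> sym_space"
    using assms(1) bas_sym_space[of "add_mset I M"] by (simp add: bas_mult)
qed

lemma yo_bas_cases:
  assumes "I \<in> order_ideals"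
  obtains "yo b (bas I) = 0" | J where "J \<in> order_ideals" "yo b (bas I) = bas J"
  using yo_bas[OF assms] removable_ideal[OF assms] yo_bas_0 by metis

lemma Ya_sym_space:
  assumes "u \<in> sym_space" shows "Ya b u \<in> sym_space"
proof -
  have M: "Ya b (bas M) \<in> sym_space" if "set_mset M \<subseteq> order_ideals" for M
    using that
  proof (induction M)
    case empty
    show ?case unfolding sym_op_empty by (rule pm.subspace_0[OF subspace_sym_space])
  next
    case (add I M)
    then have I: "I \<in> order_ideals" and M: "set_mset M \<subseteq> order_ideals" by auto
    have "emb (yo b (bas I)) * bas M \<in> sym_space"
      using I
    proof (cases rule: yo_bas_cases[of I b])
      case 1
      then show ?thesis using pm.subspace_0[OF subspace_sym_space] by (simp add: plin_zero[OF plin_emb])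
    next
      case (2 J)
      then show ?thesis using gen_mult_sym_space[OF 2(1) bas_sym_space[OF M]] by simp
    qed
    moreover have "bas {#I#} * Ya b (bas M) \<in> sym_space"
      using gen_mult_sym_space[OF I add.IH[OF M]] .
    ultimately show ?case
      unfolding bas_add_mset[of I M] sym_op_mult sym_op_gen by (rule pm.subspace_add[OF subspace_sym_space])
  qed
  show ?thesis
    using assms unfolding sym_space_def
    by (rule plin_span_subspace[OF plin_sym_op pm.subspace_span, rotated])
      (use M in \<open>auto simp flip: sym_space_def\<close>)
qed

lemma topv_sym_space: "topv m \<in> sym_space"
  unfolding topv_def by (rule bas_sym_space) (auto simp: order_ideals_def)

lemma down_power_Ya:
  assumes u: "u \<in> sym_space"
  shows "down_power \<kappa> b k u = dpow (Ya b) k u" "dpow (Ya b) k u \<in> sym_space"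
proof -
  have "(sym_op (Y_op \<kappa> b) ^^ k) u = (Ya b ^^ k) u \<and> (Ya b ^^ k) u \<in> sym_space"
  proof (induction k)
    case (Suc k)
    then have s: "(Ya b ^^ k) u \<in> sym_space" by simp
    have "sym_op (Y_op \<kappa> b) ((Ya b ^^ k) u) = Ya b ((Ya b ^^ k) u)"
      by (rule sym_op_cong_on) (use sym_space_keys[OF s] XY_op_bas(2) in blast)
    then show ?case using Suc Ya_sym_space[OF s] by simp
  qed (simp add: u)
  then show "down_power \<kappa> b k u = dpow (Ya b) k u" "dpow (Ya b) k u \<in> sym_space"
    by (simp_all add: down_power_def dpow_def pm.subspace_scale[OF subspace_sym_space])
qed

lemma down_vector_Ya: "down_vector \<kappa> m bs = fold (\<lambda>(b, k). dpow (Ya b) k) bs (topv m)"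
proof -
  have "fold (\<lambda>(b, k). down_power \<kappa> b k) bs u = fold (\<lambda>(b, k). dpow (Ya b) k) bs u" if "u \<in> sym_space" for u
    using that by (induction bs arbitrary: u) (auto simp: down_power_Ya)
  then show ?thesis using topv_sym_space by (simp add: down_vector_def topv_def)
qed

lemma stackwise_vector_mon:
  "stackwise_vector \<kappa> m xs \<phi> = pscale (\<Prod>y\<leftarrow>xs. 1 / fact (\<phi> y)) (mon xs \<phi> (topv m))"
proof -
  have "fold (\<lambda>(b, k). dpow (Ya b) k) (map (\<lambda>y. (\<kappa> y, \<phi> y)) xs) u =
      pscale (\<Prod>y\<leftarrow>xs. 1 / fact (\<phi> y)) (mon xs \<phi> u)" for u
    by (induction xs arbitrary: u)
      (simp_all add: dpow_def plin_scale[OF plin_mon] mult.commute)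
  then show ?thesis by (simp add: stackwise_vector_def down_vector_Ya)
qed

lemma stack_factor_nonzero: "(\<Prod>y\<leftarrow>xs. 1 / fact (\<phi> y) :: complex) \<noteq> 0"
  by (induction xs) auto

lemma stackwise_span:
  "pm.span (stackwise_vector \<kappa> m xs ` S) = pm.span ((\<lambda>\<phi>. mon xs \<phi> (topv m)) ` S)"
proof
  show "pm.span (stackwise_vector \<kappa> m xs ` S) \<subseteq> pm.span ((\<lambda>\<phi>. mon xs \<phi> (topv m)) ` S)"
    by (intro pm.span_minimal pm.subspace_span)
      (auto simp: stackwise_vector_mon intro!: pm.span_scale[OF pm.span_base])
  show "pm.span ((\<lambda>\<phi>. mon xs \<phi> (topv m)) ` S) \<subseteq> pm.span (stackwise_vector \<kappa> m xs ` S)"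
  proof (intro pm.span_minimal pm.subspace_span subsetI)
    fix u assume "u \<in> (\<lambda>\<phi>. mon xs \<phi> (topv m)) ` S"
    then obtain \<phi> where \<phi>: "\<phi> \<in> S" "u = mon xs \<phi> (topv m)" by auto
    let ?c = "\<Prod>y\<leftarrow>xs. 1 / fact (\<phi> y) :: complex"
    have "u = pscale (1 / ?c) (stackwise_vector \<kappa> m xs \<phi>)"
      using stack_factor_nonzero[of \<phi> xs] by (simp only: \<phi>(2) stackwise_vector_mon pm.scale_scale) simp
    then show "u \<in> pm.span (stackwise_vector \<kappa> m xs ` S)"
      using \<phi>(1) by (simp add: pm.span_scale pm.span_base)
  qed
qed

lemma stackwise_down: "stackwise_vector \<kappa> m ys ` S \<subseteq> down_vectors \<kappa> m"
  by (auto simp: stackwise_vector_def down_vectors_def)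

theorem down_span:
  assumes ys: "decreasing_linear_extension ys"
  shows "pm.span (down_vectors \<kappa> m) = cell m UNIV"
    and "pm.span (stackwise_vector \<kappa> m ys ` bounded_mono_maps m) = pm.span (down_vectors \<kappa> m)"
proof -
  have fl: "flist ys" "set ys = UNIV" using ys by (simp_all add: flist_decreasing)
  have st: "Ya b u \<in> cell m UNIV" if "u \<in> cell m UNIV" for b u
    using that by (intro cell_stable) (simp_all add: order_filters_def)
  have dp: "dpow (Ya b) k u \<in> cell m UNIV" if "u \<in> cell m UNIV" for b k u
  proof -
    have "(Ya b ^^ k) u \<in> cell m UNIV" using that st by (induction k) simp_all
    then show ?thesis unfolding dpow_def by (rule pm.subspace_scale[OF subspace_cell])
  qed
  have "fold (\<lambda>(b, k). dpow (Ya b) k) bs u \<in> cell m UNIV" if "u \<in> cell m UNIV" for bs u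
    using that by (induction bs arbitrary: u) (auto simp: dp)
  moreover have "topv m \<in> cell m UNIV"
  proof -
    have "mon xs (\<lambda>_. 0) u = u" for xs u by (induction xs) simp_all
    then show ?thesis using mon_cell[OF fl(1), of "\<lambda>_. 0" m] fl(2) by simp
  qed
  ultimately have "down_vectors \<kappa> m \<subseteq> cell m UNIV"
    by (auto simp: down_vectors_def down_vector_Ya)
  then have 1: "pm.span (down_vectors \<kappa> m) \<subseteq> cell m UNIV"
    by (rule pm.span_minimal[OF _ subspace_cell])
  have 2: "cell m UNIV = pm.span (stackwise_vector \<kappa> m ys ` bounded_mono_maps m)"
    by (simp add: cell_UNIV_span[OF ys] stackwise_span)
  have 3: "pm.span (stackwise_vector \<kappa> m ys ` bounded_mono_maps m) \<subseteq> pm.span (down_vectors \<kappa> m)"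
    by (rule pm.span_mono[OF stackwise_down])
  show "pm.span (down_vectors \<kappa> m) = cell m UNIV"
    "pm.span (stackwise_vector \<kappa> m ys ` bounded_mono_maps m) = pm.span (down_vectors \<kappa> m)"
    using 1 2 3 by auto
qed

end

section \<open>Triangularity\<close>

lemma dpow_0 [simp]: "dpow D 0 w = w"
  by (simp add: dpow_def)

lemma dpow_gen_mult:
  assumes "sym_op f (sym_op f a) = 0"
  shows "dpow (sym_op f) k (a * w) =
    a * dpow (sym_op f) k w + (if k = 0 then 0 else sym_op f a * dpow (sym_op f) (k - 1) w)"
  using dpow_mult[OF assms] by (cases k) simp_all

lemma plin_range:
  assumes "plin f" "pm.subspace T" "\<And>k. f (bas k) \<in> T"
  shows "f u \<in> T"
  using plin_span_subspace[OF assms(1,2), of "range bas" u] assms(3) in_span_bas[of u UNIV] by auto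

definition int_coeffs :: "('a \<Rightarrow>\<^sub>0 complex) \<Rightarrow> bool" where
  "int_coeffs w \<longleftrightarrow> (\<forall>N. lk w N \<in> \<int>)"

lemma int_coeffs_add: "int_coeffs u \<Longrightarrow> int_coeffs w \<Longrightarrow> int_coeffs (u + w)"
  by (simp add: int_coeffs_def lookup_add)

lemma int_coeffs_0: "int_coeffs 0"
  by (simp add: int_coeffs_def)

lemma int_coeffs_bas: "int_coeffs (bas M)"
  by (simp add: int_coeffs_def lookup_single when_def)

lemma int_coeffs_plin:
  assumes f: "plin f" and b: "\<And>k. int_coeffs (f (bas k))" and w: "int_coeffs w"
  shows "int_coeffs (f w)"
  unfolding plin_eq_lin_ext[OF f, of w] lin_ext_def int_coeffs_def lookup_sum lookup_pscale
  using b w by (auto simp: int_coeffs_def intro!: Ints_sum Ints_mult)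

lemma int_coeffs_gen_mult: "int_coeffs w \<Longrightarrow> int_coeffs (bas {#I#} * w)"
  by (rule int_coeffs_plin[OF plin_mult_left]) (simp_all add: bas_mult int_coeffs_bas)

context minuscule_poset
begin

abbreviation Xa :: "'c \<Rightarrow> ('p set multiset \<Rightarrow>\<^sub>0 complex) \<Rightarrow> ('p set multiset \<Rightarrow>\<^sub>0 complex)" where
  "Xa b \<equiv> sym_op (xo b)"

lemma Xa_Xa_gen: "Xa b (Xa b (bas {#I#})) = 0"
  by (simp add: sym_op_gen sym_op_emb plin_ops xo_xo plin_zero[OF plin_emb])

lemma Xa_gen_cases:
  "Xa b (bas {#I#}) = 0 \<or> (\<exists>x. I \<in> order_ideals \<and> addable \<kappa> b I x \<and> Xa b (bas {#I#}) = bas {#insert x I#})"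
proof (cases "I \<in> order_ideals \<and> (\<exists>x. addable \<kappa> b I x)")
  case True
  then obtain x where x: "I \<in> order_ideals" "addable \<kappa> b I x" by blast
  then show ?thesis by (intro disjI2 exI[of _ x]) (simp add: sym_op_gen xo_bas)
next
  case False
  then have "xo b (bas I) = 0" using xo_bas_0[of b I] ops_nonideal(2)[of I b] by blast
  then show ?thesis by (simp add: sym_op_gen plin_zero[OF plin_emb])
qed

lemma dpow_Xa_empty: "dpow (Xa b) (Suc k) (bas {#}) = 0"
proof -
  have "(Xa b ^^ Suc k) (bas {#}) = (Xa b ^^ k) (Xa b (bas {#}))" by (simp only: funpow_Suc_right o_apply)
  also have "\<dots> = 0" by (simp only: sym_op_empty plin_zero[OF plin_funpow[OF plin_sym_op]])
  finally show ?thesis by (simp only: dpow_def pm.scale_zero_right)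
qed

text \<open>Peeling off one factor at a time, the two-term product rule for divided powers
  introduces no denominators.\<close>

lemma int_coeffs_dpow_Xa:
  assumes "int_coeffs w" shows "int_coeffs (dpow (Xa b) k w)"
proof (rule int_coeffs_plin[OF plin_dpow[OF plin_sym_op] _ assms])
  fix M
  show "int_coeffs (dpow (Xa b) k (bas M))"
  proof (induction M arbitrary: k)
    case empty
    show ?case
    proof (cases k)
      case 0
      show ?thesis unfolding 0 dpow_0 by (rule int_coeffs_bas)
    next
      case (Suc k)
      show ?thesis unfolding Suc dpow_Xa_empty by (rule int_coeffs_0)
    qed
  next
    case (add I M)
    have "int_coeffs (Xa b (bas {#I#}) * dpow (Xa b) (k - 1) (bas M))"
      using Xa_gen_cases[of b I] by (auto simp: int_coeffs_0 intro!: int_coeffs_gen_mult add.IH)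
    then show ?case
      unfolding bas_add_mset[of I M] dpow_gen_mult[OF Xa_Xa_gen]
      using add by (auto intro!: int_coeffs_add int_coeffs_gen_mult simp: int_coeffs_0 int_coeffs_bas)
  qed
qed

section \<open>Raising a multichain back to {P,...,P}\<close>

lemma color_count_insert: "x \<notin> I \<Longrightarrow> color_count (insert x I) b = color_count I b + of_bool (\<kappa> x = b)"
proof -
  assume "x \<notin> I"
  then have "{y \<in> insert x I. \<kappa> y = b} = (if \<kappa> x = b then insert x {y\<in>I. \<kappa> y = b} else {y\<in>I. \<kappa> y = b})"
    by auto
  then show ?thesis using \<open>x \<notin> I\<close> by (simp add: color_count_def)
qed

text \<open>
  Each divided power of a raising operator adds at most one element to each factor, so a monomial
  with a factor missing too many elements of one color never reaches \<open>{P,\<dots>,P}\<close>.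
\<close>

definition deficient :: "'c \<Rightarrow> int \<Rightarrow> ('p set multiset \<Rightarrow>\<^sub>0 complex) set" where
  "deficient b d = pm.span (bas ` {M. \<exists>I\<in>#M. color_count I b \<le> d})"

lemma subspace_deficient: "pm.subspace (deficient b d)"
  by (simp add: deficient_def)

lemma bas_deficient: "I \<in># M \<Longrightarrow> color_count I b \<le> d \<Longrightarrow> bas M \<in> deficient b d"
  unfolding deficient_def by (intro pm.span_base) auto

lemma gen_mult_deficient: "color_count I b \<le> d \<Longrightarrow> bas {#I#} * u \<in> deficient b d"
  by (rule plin_range[OF plin_mult_left subspace_deficient])
    (auto simp: bas_mult intro!: bas_deficient[of I])

lemma dpow_deficient:
  assumes "u \<in> deficient b d"
  shows "dpow (Xa b') k u \<in> deficient b (d + of_bool (b' = b))"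
proof (rule plin_span_subspace[OF plin_dpow[OF plin_sym_op] subspace_deficient _ assms[unfolded deficient_def]])
  fix s assume "s \<in> bas ` {M. \<exists>I\<in>#M. color_count I b \<le> d}"
  then obtain M I where s: "s = bas M" and I: "I \<in># M" "color_count I b \<le> d" by auto
  then obtain N where N: "M = add_mset I N" by (auto dest: multi_member_split)
  have 1: "bas {#I#} * u \<in> deficient b (d + of_bool (b' = b))" for u
    using I(2) by (intro gen_mult_deficient) simp
  have 2: "Xa b' (bas {#I#}) * u \<in> deficient b (d + of_bool (b' = b))" for u
    using Xa_gen_cases[of b' I]
  proof
    assume "Xa b' (bas {#I#}) = 0"
    then show ?thesis using pm.subspace_0[OF subspace_deficient] by simp
  next
    assume "\<exists>x. I \<in> order_ideals \<and> addable \<kappa> b' I x \<and> Xa b' (bas {#I#}) = bas {#insert x I#}"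
    then obtain x where x: "addable \<kappa> b' I x" "Xa b' (bas {#I#}) = bas {#insert x I#}" by blast
    then have "color_count (insert x I) b \<le> d + of_bool (b' = b)"
      using I(2) by (subst color_count_insert) (auto simp: addable_def)
    then show ?thesis unfolding x(2) by (rule gen_mult_deficient)
  qed
  show "dpow (Xa b') k s \<in> deficient b (d + of_bool (b' = b))"
    unfolding s N bas_add_mset[of I N] dpow_gen_mult[OF Xa_Xa_gen]
    using 1 2 pm.subspace_0[OF subspace_deficient] by (auto intro!: pm.subspace_add[OF subspace_deficient])
qed

lemma deficient_top:
  assumes "u \<in> deficient b d" "d < color_count UNIV b"
  shows "lk u (replicate_mset m UNIV) = 0"
proof -
  have "pm.span (bas ` {M. \<exists>I\<in>#M. color_count I b \<le> d}) \<subseteq> {u. lk u (replicate_mset m UNIV) = 0}"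
    by (rule pm.span_minimal)
      (use assms(2) in \<open>auto simp: pm.subspace_def lookup_add lookup_pscale lookup_single when_def
        split: if_splits\<close>)
  then show ?thesis using assms(1) unfolding deficient_def by blast
qed

text \<open>The adjoint of the stackwise product, hence the reversed order: the last element of the
  list acts first.\<close>

definition raise :: "'p list \<Rightarrow> ('p \<Rightarrow> nat) \<Rightarrow> ('p set multiset \<Rightarrow>\<^sub>0 complex) \<Rightarrow> ('p set multiset \<Rightarrow>\<^sub>0 complex)" where
  "raise xs \<phi> = foldr (\<lambda>y. dpow (Xa (\<kappa> y)) (\<phi> y)) xs"

lemma plin_raise: "plin (raise xs \<phi>)"
proof (induction xs)
  case Nil
  then show ?case by (simp add: raise_def plin_id id_def)
next
  case (Cons x xs)
  have "raise (x # xs) \<phi> = (\<lambda>u. dpow (Xa (\<kappa> x)) (\<phi> x) (raise xs \<phi> u))" by (auto simp: raise_def)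
  then show ?case using plin_compose[OF plin_dpow[OF plin_sym_op] Cons] by simp
qed

lemma raise_snoc: "raise (xs @ [x]) \<phi> u = raise xs \<phi> (dpow (Xa (\<kappa> x)) (\<phi> x) u)"
  by (simp add: raise_def)

lemma raise_deficient:
  "distinct xs \<Longrightarrow> u \<in> deficient b d \<Longrightarrow> raise xs \<phi> u \<in> deficient b (d + color_count (set xs) b)"
proof (induction xs)
  case Nil
  then show ?case by (simp add: raise_def color_count_def)
next
  case (Cons x xs)
  then have "raise xs \<phi> u \<in> deficient b (d + color_count (set xs) b)" by simp
  from dpow_deficient[OF this, of "\<kappa> x" "\<phi> x"]
  have "raise (x # xs) \<phi> u \<in> deficient b (d + color_count (set xs) b + of_bool (\<kappa> x = b))"
    by (simp add: raise_def)
  moreover have "color_count (set (x # xs)) b = color_count (set xs) b + of_bool (\<kappa> x = b)"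
    using Cons.prems(1) by (simp add: color_count_insert)
  ultimately show ?case by (simp add: add.assoc)
qed

text \<open>Spanned by the monomials that can no longer contribute once the operator at
  \<open>x\<close> has acted.\<close>

definition lacking :: "'p \<Rightarrow> ('p set multiset \<Rightarrow>\<^sub>0 complex) set" where
  "lacking x = pm.span (bas ` {N. \<exists>I\<in>#N. I \<in> order_ideals \<and> x \<notin> I})"

lemma subspace_lacking: "pm.subspace (lacking x)"
  by (simp add: lacking_def)

lemma gen_mult_lacking: "I \<in> order_ideals \<Longrightarrow> x \<notin> I \<Longrightarrow> bas {#I#} * u \<in> lacking x"
  by (rule plin_range[OF plin_mult_left subspace_lacking])
    (auto simp: bas_mult lacking_def intro!: pm.span_base[OF imageI])

lemma mult_lacking:
  assumes "u \<in> lacking x" shows "bas {#I#} * u \<in> lacking x"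
  by (rule plin_span_subspace[OF plin_mult_left subspace_lacking _ assms[unfolded lacking_def]])
    (auto simp: bas_mult lacking_def intro!: pm.span_base[OF imageI])

text \<open>The k applications hit k different factors. If k is at most the number of factors
  without x, each of those receives x only when k equals that number and no application is spent
  elsewhere; in all other terms some factor still lacks x.\<close>

lemma dpow_Xa_lacking:
  fixes M :: "'p set multiset"
  assumes "\<And>I. I \<in># M \<Longrightarrow> I \<in> order_ideals" and "\<And>I. I \<in># M \<Longrightarrow> x \<notin> I \<Longrightarrow> addable \<kappa> (\<kappa> x) I x"
  shows "(k < size {#I\<in>#M. x \<notin> I#} \<longrightarrow> dpow (Xa (\<kappa> x)) k (bas M) \<in> lacking x) \<and>
    (k = size {#I\<in>#M. x \<notin> I#} \<longrightarrow>
      dpow (Xa (\<kappa> x)) k (bas M) - bas (image_mset (insert x) M) \<in> lacking x)"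
  using assms
proof (induction M arbitrary: k)
  case empty
  show ?case using pm.subspace_0[OF subspace_lacking] by simp
next
  case (add I M)
  let ?X = "Xa (\<kappa> x)"
  let ?r = "size {#I\<in>#M. x \<notin> I#}"
  have I: "I \<in> order_ideals" using add.prems(1) by simp
  have IH: "(k < ?r \<longrightarrow> dpow ?X k (bas M) \<in> lacking x) \<and>
    (k = ?r \<longrightarrow> dpow ?X k (bas M) - bas (image_mset (insert x) M) \<in> lacking x)" for k
    using add by simp
  have exp: "dpow ?X k (bas (add_mset I M)) = bas {#I#} * dpow ?X k (bas M) +
      (if k = 0 then 0 else ?X (bas {#I#}) * dpow ?X (k - 1) (bas M))" for k
    unfolding bas_add_mset[of I M] by (rule dpow_gen_mult[OF Xa_Xa_gen])
  have mX: "?X (bas {#I#}) * u \<in> lacking x" if "u \<in> lacking x" for u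
    using Xa_gen_cases[of "\<kappa> x" I] mult_lacking[OF that] pm.subspace_0[OF subspace_lacking] by auto
  show ?case
  proof (cases "x \<in> I")
    case True
    then have size: "size {#I\<in>#add_mset I M. x \<notin> I#} = ?r" by simp
    have img: "bas (image_mset (insert x) (add_mset I M)) = bas {#I#} * bas (image_mset (insert x) M)"
      using True by (simp add: bas_mult insert_absorb)
    have 2: "(if k = 0 then 0 else ?X (bas {#I#}) * dpow ?X (k - 1) (bas M)) \<in> lacking x"
      if "k \<le> ?r"
      using that mX IH[of "k - 1"] pm.subspace_0[OF subspace_lacking] by (cases k) auto
    show ?thesis unfolding size
    proof (intro conjI impI)
      assume "k < ?r"
      then show "dpow ?X k (bas (add_mset I M)) \<in> lacking x"
        unfolding exp using IH[of k] 2 by (intro pm.subspace_add[OF subspace_lacking] mult_lacking) auto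
    next
      assume k: "k = ?r"
      have "bas {#I#} * (dpow ?X k (bas M) - bas (image_mset (insert x) M)) +
          (if k = 0 then 0 else ?X (bas {#I#}) * dpow ?X (k - 1) (bas M)) \<in> lacking x"
        using IH[of k] 2 k by (intro pm.subspace_add[OF subspace_lacking] mult_lacking) auto
      then show "dpow ?X k (bas (add_mset I M)) - bas (image_mset (insert x) (add_mset I M)) \<in> lacking x"
        unfolding exp img by (simp only: right_diff_distrib add_diff_eq diff_add_eq)
    qed
  next
    case False
    then have size: "size {#I\<in>#add_mset I M. x \<notin> I#} = Suc ?r" by simp
    have img: "bas (image_mset (insert x) (add_mset I M)) = bas {#insert x I#} * bas (image_mset (insert x) M)"
      by (simp add: bas_mult)
    have X: "?X (bas {#I#}) = bas {#insert x I#}"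
      using add.prems(2)[of I] False I by (simp add: sym_op_gen xo_bas)
    have 1: "bas {#I#} * u \<in> lacking x" for u using gen_mult_lacking[OF I False] .
    show ?thesis unfolding size
    proof (intro conjI impI)
      assume "k < Suc ?r"
      then have "(if k = 0 then 0 else ?X (bas {#I#}) * dpow ?X (k - 1) (bas M)) \<in> lacking x"
        using mX IH[of "k - 1"] pm.subspace_0[OF subspace_lacking] by (cases k) auto
      then show "dpow ?X k (bas (add_mset I M)) \<in> lacking x"
        unfolding exp by (intro pm.subspace_add[OF subspace_lacking] 1)
    next
      assume k: "k = Suc ?r"
      have "bas {#I#} * dpow ?X k (bas M) +
          bas {#insert x I#} * (dpow ?X ?r (bas M) - bas (image_mset (insert x) M)) \<in> lacking x"
        using IH[of ?r] by (intro pm.subspace_add[OF subspace_lacking] mult_lacking 1) auto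
      then show "dpow ?X k (bas (add_mset I M)) - bas (image_mset (insert x) (add_mset I M)) \<in> lacking x"
        unfolding exp img X k by (simp add: right_diff_distrib add_diff_eq)
    qed
  qed
qed

text \<open>Induction from the lowest element: the assumption on M says that everything outside
  \<open>xs\<close> is already filled in. If the exponent at x is the number of ideals lacking x,
  then up to lost terms x is inserted into all of them and the argument continues. If it is smaller,
  all terms are lost.\<close>

lemma raise_triangular:
  assumes "flist xs" and "\<And>I. I \<in># M \<Longrightarrow> I \<in> order_ideals" and "\<And>I. I \<in># M \<Longrightarrow> - set xs \<subseteq> I"
  shows "((\<forall>y\<in>set xs. \<phi> y = size {#I\<in>#M. y \<notin> I#}) \<longrightarrow>
      lk (raise xs \<phi> (bas M)) (replicate_mset (size M) UNIV) = 1) \<and>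
    (\<forall>xs1 y xs2. xs = xs1 @ y # xs2 \<longrightarrow> \<phi> y < size {#I\<in>#M. y \<notin> I#} \<longrightarrow>
      (\<forall>z\<in>set xs2. \<phi> z = size {#I\<in>#M. z \<notin> I#}) \<longrightarrow>
      lk (raise xs \<phi> (bas M)) (replicate_mset (size M) UNIV) = 0)"
  using assms
proof (induction xs arbitrary: M rule: rev_induct)
  case Nil
  have "M = replicate_mset (size M) UNIV"
  proof (rule multiset_eqI)
    fix I
    show "count M I = count (replicate_mset (size M) UNIV) I"
    proof (cases "I = UNIV")
      case True
      have "filter_mset (\<lambda>J. J = UNIV) M = M" using Nil(3) by (auto simp: filter_mset_eq_conv)
      then have "size M = count M UNIV" by (metis filter_eq_replicate_mset size_replicate_mset)
      then show ?thesis using True by simp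
    next
      case False
      then have "I \<notin># M" using Nil(3)[of I] by auto
      then show ?thesis using False by (simp add: not_in_iff)
    qed
  qed
  then have "lk (bas M) (replicate_mset (size M) UNIV) = 1" by (simp add: lookup_single)
  then show ?case by (simp add: raise_def)
next
  case (snoc x xs)
  have fl: "flist xs" using snoc.prems(1) by (rule flist_butlast)
  have dis: "distinct (xs @ [x])" and x: "x \<notin> set xs" using snoc.prems(1) by (auto simp: flist_def)
  have notbelow: "\<not> y < x" if "y \<in> set (xs @ [x])" for y
    using snoc.prems(1) that by (auto simp: flist_def sorted_wrt_append)
  have ad: "addable \<kappa> (\<kappa> x) I x" if "I \<in># M" "x \<notin> I" for I
    using snoc.prems(3)[OF that(1)] that(2) notbelow unfolding addable_def by blast
  let ?X = "Xa (\<kappa> x)" and ?r = "size {#I\<in>#M. x \<notin> I#}"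
  let ?top = "replicate_mset (size M) (UNIV :: 'p set)"
  note step = dpow_Xa_lacking[of M x, OF snoc.prems(2) ad]
  let ?b = "\<kappa> x"
  \<comment> \<open>An ideal without x contains no element of the color of x from the list. The
    operators that remain can restore one element fewer of that color than is missing.\<close>
  have bad: "lk (raise xs \<phi> u) ?top = 0" if u: "u \<in> lacking x" for u
  proof -
    let ?d = "color_count UNIV ?b - color_count (set (xs @ [x])) ?b"
    have "bas ` {N. \<exists>I\<in>#N. I \<in> order_ideals \<and> x \<notin> I} \<subseteq> deficient ?b ?d"
    proof
      fix s assume "s \<in> bas ` {N. \<exists>I\<in>#N. I \<in> order_ideals \<and> x \<notin> I}"
      then obtain N I where N: "s = bas N" "I \<in># N" "I \<in> order_ideals" "x \<notin> I" by auto
      have "y \<notin> set (xs @ [x])" if "y \<in> I" "\<kappa> y = ?b" for y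
        using EC[OF that(2)] notbelow[of y] N(4) idealD[OF N(3) that(1)] that(1)
        by (auto simp: order.order_iff_strict)
      then have "{y\<in>I. \<kappa> y = ?b} \<inter> {y\<in>set (xs @ [x]). \<kappa> y = ?b} = {}" by auto
      then have "card {y\<in>I. \<kappa> y = ?b} + card {y\<in>set (xs @ [x]). \<kappa> y = ?b} =
          card ({y\<in>I. \<kappa> y = ?b} \<union> {y\<in>set (xs @ [x]). \<kappa> y = ?b})"
        by (intro card_Un_disjoint[symmetric]) auto
      also have "\<dots> \<le> card {y\<in>UNIV. \<kappa> y = ?b}" by (rule card_mono) auto
      finally have "color_count I ?b \<le> ?d" by (simp add: color_count_def)
      then show "s \<in> deficient ?b ?d" unfolding N(1) by (rule bas_deficient[OF N(2)])
    qed
    then have "lacking x \<subseteq> deficient ?b ?d"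
      unfolding lacking_def by (rule pm.span_minimal[OF _ subspace_deficient])
    then have "raise xs \<phi> u \<in> deficient ?b (?d + color_count (set xs) ?b)"
      using u dis by (intro raise_deficient) auto
    moreover have "color_count (set (xs @ [x])) ?b = color_count (set xs) ?b + 1"
      using color_count_insert[OF x, of ?b] by simp
    ultimately show ?thesis by (intro deficient_top) auto
  qed
  let ?M' = "image_mset (insert x) M"
  have IH: "((\<forall>y\<in>set xs. \<phi> y = size {#I\<in>#?M'. y \<notin> I#}) \<longrightarrow>
      lk (raise xs \<phi> (bas ?M')) (replicate_mset (size ?M') UNIV) = 1) \<and>
    (\<forall>xs1 y xs2. xs = xs1 @ y # xs2 \<longrightarrow> \<phi> y < size {#I\<in>#?M'. y \<notin> I#} \<longrightarrow>
      (\<forall>z\<in>set xs2. \<phi> z = size {#I\<in>#?M'. z \<notin> I#}) \<longrightarrow>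
      lk (raise xs \<phi> (bas ?M')) (replicate_mset (size ?M') UNIV) = 0)"
  proof (rule snoc.IH[OF fl])
    fix J assume "J \<in># ?M'"
    then obtain I where I: "I \<in># M" "J = insert x I" by auto
    show "J \<in> order_ideals"
      using snoc.prems(2)[OF I(1)] ad[OF I(1)] addable_ideal by (cases "x \<in> I") (auto simp: I(2) insert_absorb)
    show "- set xs \<subseteq> J" using snoc.prems(3)[OF I(1)] I(2) by auto
  qed
  have same: "size {#I\<in>#?M'. y \<notin> I#} = size {#I\<in>#M. y \<notin> I#}" if "y \<noteq> x" for y
    using that by (simp add: filter_mset_image_mset)
  have eq: "lk (raise (xs @ [x]) \<phi> (bas M)) ?top = lk (raise xs \<phi> (bas ?M')) ?top" if "\<phi> x = ?r"
  proof -
    have "dpow ?X (\<phi> x) (bas M) - bas ?M' \<in> lacking x" using step[of "\<phi> x"] that by simp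
    then have "lk (raise xs \<phi> (dpow ?X (\<phi> x) (bas M)) - raise xs \<phi> (bas ?M')) ?top = 0"
      using bad by (simp flip: plin_diff[OF plin_raise])
    then show ?thesis by (simp add: raise_snoc lookup_minus)
  qed
  show ?case
  proof (intro conjI impI allI)
    assume a: "\<forall>y\<in>set (xs @ [x]). \<phi> y = size {#I\<in>#M. y \<notin> I#}"
    have "\<forall>y\<in>set xs. \<phi> y = size {#I\<in>#?M'. y \<notin> I#}"
    proof
      fix y assume "y \<in> set xs"
      then have "y \<noteq> x" using x by auto
      then show "\<phi> y = size {#I\<in>#?M'. y \<notin> I#}" using a \<open>y \<in> set xs\<close> same[of y] by simp
    qed
    then have "lk (raise xs \<phi> (bas ?M')) ?top = 1" using IH by simp
    then show "lk (raise (xs @ [x]) \<phi> (bas M)) ?top = 1" using eq a by simp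
  next
    fix xs1 y xs2
    assume spl: "xs @ [x] = xs1 @ y # xs2" and y: "\<phi> y < size {#I\<in>#M. y \<notin> I#}"
      and zs: "\<forall>z\<in>set xs2. \<phi> z = size {#I\<in>#M. z \<notin> I#}"
    show "lk (raise (xs @ [x]) \<phi> (bas M)) ?top = 0"
    proof (cases xs2 rule: rev_cases)
      case Nil
      then have "y = x" using spl by simp
      then have "dpow ?X (\<phi> x) (bas M) \<in> lacking x" using step[of "\<phi> x"] y by simp
      then show ?thesis using bad by (simp add: raise_snoc)
    next
      case (snoc xs2' x')
      then have spl': "xs = xs1 @ y # xs2'" "x' = x" using spl by auto
      have nx: "z \<noteq> x" if "z \<in> insert y (set xs2')" for z using that x spl' by auto
      have "\<phi> x = ?r" using zs snoc spl' by simp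
      moreover have "lk (raise xs \<phi> (bas ?M')) ?top = 0"
      proof -
        have "\<phi> y < size {#I\<in>#?M'. y \<notin> I#}" using y same[OF nx[of y]] by simp
        moreover have "\<forall>z\<in>set xs2'. \<phi> z = size {#I\<in>#?M'. z \<notin> I#}"
        proof
          fix z assume z: "z \<in> set xs2'"
          then show "\<phi> z = size {#I\<in>#?M'. z \<notin> I#}" using zs same[OF nx[of z]] snoc by simp
        qed
        ultimately show ?thesis using IH spl'(1) by simp
      qed
      ultimately show ?thesis using eq by simp
    qed
  qed
qed

text \<open>
  In a downward vector the coefficient of a multiset is divisible by the number of its
  arrangements; the normalization divides this factor out.
\<close>

definition evalm :: "nat \<Rightarrow> 'p set multiset \<Rightarrow> ('p set multiset \<Rightarrow>\<^sub>0 complex) \<Rightarrow> complex" where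
  "evalm m M u = herm fact_weight u (bas M) / of_nat (fact_weight (replicate_mset m (UNIV :: 'p set)))"

text \<open>By adjointness all operators move onto M as raising operators. Pairing with {P,...,P}
  then reads off one coefficient, times the factor by which \<open>evalm\<close> divides.\<close>

lemma evalm_down:
  "evalm m M (fold (\<lambda>(b, k). dpow (Ya b) k) bs (topv m)) =
     cnj (lk (foldr (\<lambda>(b, k). dpow (Xa b) k) bs (bas M)) (replicate_mset m UNIV))"
proof -
  have 1: "herm fact_weight (Ya b u) w = herm fact_weight u (Xa b w)" for b u w
    by (rule sym_op_adjoint[OF plin_ops(1,2) herm_yo])
  have 2: "herm fact_weight ((Ya b ^^ k) u) w = herm fact_weight u ((Xa b ^^ k) w)" for b k u w
  proof (induction k arbitrary: w)
    case (Suc k)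
    show ?case unfolding funpow.simps(2) o_apply 1 Suc by (simp only: funpow_swap1)
  qed simp
  have 3: "herm fact_weight (dpow (Ya b) k u) w = herm fact_weight u (dpow (Xa b) k w)" for b k u w
    by (simp add: dpow_def herm_scale_left herm_scale_right 2)
  have "herm fact_weight (fold (\<lambda>(b, k). dpow (Ya b) k) bs u) w =
      herm fact_weight u (foldr (\<lambda>(b, k). dpow (Xa b) k) bs w)" for u w
    by (induction bs arbitrary: u) (auto simp: 3)
  then show ?thesis
    using fact_weight_pos[of "replicate_mset m (UNIV :: 'p set)"] by (simp add: evalm_def topv_def herm_bas_left)
qed

lemma evalm_down_int: "v \<in> down_vectors \<kappa> m \<Longrightarrow> evalm m M v \<in> \<int>"
proof -
  assume "v \<in> down_vectors \<kappa> m"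
  then obtain bs where v: "v = fold (\<lambda>(b, k). dpow (Ya b) k) bs (topv m)"
    by (auto simp: down_vectors_def down_vector_Ya)
  have "int_coeffs (foldr (\<lambda>(b, k). dpow (Xa b) k) bs (bas M))"
    by (induction bs) (auto simp: int_coeffs_bas int_coeffs_dpow_Xa)
  then have "lk (foldr (\<lambda>(b, k). dpow (Xa b) k) bs (bas M)) (replicate_mset m UNIV) \<in> \<int>"
    by (simp add: int_coeffs_def)
  then show ?thesis unfolding v evalm_down by (elim Ints_cases) simp
qed

lemma evalm_stack:
  "evalm m M (stackwise_vector \<kappa> m ys \<phi>) = cnj (lk (raise ys \<phi> (bas M)) (replicate_mset m UNIV))"
proof -
  have "foldr (\<lambda>(b, k). dpow (Xa b) k) (map (\<lambda>y. (\<kappa> y, \<phi> y)) ys) = raise ys \<phi>"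
    by (simp add: raise_def foldr_map comp_def fun_eq_iff)
  then show ?thesis by (simp add: stackwise_vector_def down_vector_Ya evalm_down)
qed

text \<open>The complements of the flag of \<psi>; an element y with \<psi> y at most m is missing
  from exactly \<psi> y of these ideals.\<close>

definition chain_mset :: "nat \<Rightarrow> ('p \<Rightarrow> nat) \<Rightarrow> 'p set multiset" where
  "chain_mset m \<psi> = mset (map (\<lambda>k. {y. \<psi> y < k}) [1..<m+1])"

lemma size_chain_mset: "size (chain_mset m \<psi>) = m"
  by (simp add: chain_mset_def)

lemma size_filter_chain_mset:
  assumes "\<psi> y \<le> m" shows "size {#I\<in>#chain_mset m \<psi>. y \<notin> I#} = \<psi> y"
proof -
  have "size {#I\<in>#chain_mset m \<psi>. y \<notin> I#} = length (filter (\<lambda>k. k \<le> \<psi> y) [1..<m+1])"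
    by (simp add: chain_mset_def mset_filter[symmetric] filter_map comp_def not_less del: mset_filter mset_map)
  also have "\<dots> = card (set (filter (\<lambda>k. k \<le> \<psi> y) [1..<m+1]))"
    by (rule distinct_card[symmetric]) simp
  also have "set (filter (\<lambda>k. k \<le> \<psi> y) [1..<m+1]) = {1..\<psi> y}" using assms by auto
  finally show ?thesis by simp
qed

lemma chain_mset_ideals: "mono \<psi> \<Longrightarrow> I \<in># chain_mset m \<psi> \<Longrightarrow> I \<in> order_ideals"
  by (auto simp: chain_mset_def order_ideals_def dest: monoD order.strict_trans1)

lemma evalm_stack_eq:
  assumes ys: "decreasing_linear_extension ys" and \<psi>: "\<psi> \<in> bounded_mono_maps m"
  shows "evalm m (chain_mset m \<psi>) (stackwise_vector \<kappa> m ys \<psi>) = 1"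
    and "ys = xs1 @ y # xs2 \<Longrightarrow> \<phi> y < \<psi> y \<Longrightarrow> (\<And>z. z \<in> set xs2 \<Longrightarrow> \<phi> z = \<psi> z) \<Longrightarrow>
      evalm m (chain_mset m \<psi>) (stackwise_vector \<kappa> m ys \<phi>) = 0"
proof -
  have fl: "flist ys" "set ys = UNIV" using ys by (simp_all add: flist_decreasing)
  have b: "mono \<psi>" "\<And>y. \<psi> y \<le> m" using \<psi> by (auto simp: bounded_mono_maps_def)
  have "- set ys \<subseteq> I" for I using fl by simp
  note tri = raise_triangular[OF fl(1) chain_mset_ideals[OF b(1)] this, where M = "chain_mset m \<psi>",
      unfolded size_chain_mset size_filter_chain_mset[OF b(2)]]
  show "evalm m (chain_mset m \<psi>) (stackwise_vector \<kappa> m ys \<psi>) = 1"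
    using tri[where \<phi> = \<psi>] by (simp add: evalm_stack)
  show "evalm m (chain_mset m \<psi>) (stackwise_vector \<kappa> m ys \<phi>) = 0"
    if "ys = xs1 @ y # xs2" "\<phi> y < \<psi> y" "\<And>z. z \<in> set xs2 \<Longrightarrow> \<phi> z = \<psi> z"
    using tri[where \<phi> = \<phi>] that by (simp add: evalm_stack)
qed

section \<open>Independence and integral expansions\<close>

lemma evalm_sum: "evalm m M (\<Sum>i\<in>A. pscale (c i) (f i)) = (\<Sum>i\<in>A. c i * evalm m M (f i))"
  by (simp add: evalm_def herm_sum_left herm_scale_left sum_divide_distrib)

lemma finite_bounded_mono_maps: "finite (bounded_mono_maps m :: ('p \<Rightarrow> nat) set)"
proof (rule finite_subset)
  show "bounded_mono_maps m \<subseteq> PiE (UNIV :: 'p set) (\<lambda>_. {..m})"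
    by (auto simp: bounded_mono_maps_def PiE_def extensional_def)
  show "finite (PiE (UNIV :: 'p set) (\<lambda>_. {..m}))" by (rule finite_PiE) simp_all
qed

text \<open>Applied with \<open>Z = \<int>\<close> for integrality and with \<open>Z = {0}\<close> for independence.\<close>

lemma stack_coeffs:
  assumes ys: "decreasing_linear_extension ys"
    and Z: "0 \<in> Z" "\<And>a b. a \<in> Z \<Longrightarrow> b \<in> Z \<Longrightarrow> a - b \<in> Z" "\<And>a n. a \<in> Z \<Longrightarrow> n \<in> \<int> \<Longrightarrow> a * n \<in> Z"
    and ev: "\<And>\<psi>. \<psi> \<in> bounded_mono_maps m \<Longrightarrow>
      evalm m (chain_mset m \<psi>) (\<Sum>\<phi>\<in>bounded_mono_maps m. pscale (c \<phi>) (stackwise_vector \<kappa> m ys \<phi>)) \<in> Z"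
    and \<psi>: "\<psi> \<in> bounded_mono_maps m"
  shows "c \<psi> \<in> Z"
proof (rule ccontr)
  let ?S = "bounded_mono_maps m :: ('p \<Rightarrow> nat) set"
  let ?B = "{\<psi>\<in>?S. c \<psi> \<notin> Z}"
  \<comment> \<open>Exponents are compared from the end of the list. Consider the largest index
    whose coefficient is not in Z and evaluate there: an index smaller at the last difference
    evaluates to 0, and a larger one has its coefficient in Z.\<close>
  define rk where "rk \<phi> = rev (map \<phi> ys)" for \<phi> :: "'p \<Rightarrow> nat"
  have set: "set ys = UNIV" using ys by (simp add: flist_decreasing)
  assume "c \<psi> \<notin> Z"
  then have "rk ` ?B \<noteq> {}" and fin: "finite (rk ` ?B)" using \<psi> finite_bounded_mono_maps by auto
  then have "Max (rk ` ?B) \<in> rk ` ?B" by (intro Max_in)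
  then obtain \<chi> where \<chi>: "\<chi> \<in> ?S" "c \<chi> \<notin> Z" "rk \<chi> = Max (rk ` ?B)" by auto
  let ?e = "\<lambda>\<phi>. evalm m (chain_mset m \<chi>) (stackwise_vector \<kappa> m ys \<phi>)"
  have termZ: "c \<phi> * ?e \<phi> \<in> Z" if \<phi>: "\<phi> \<in> ?S - {\<chi>}" for \<phi>
  proof -
    obtain x where "\<phi> x \<noteq> \<chi> x" using \<phi> by auto
    then have "\<exists>x\<in>set ys. \<phi> x \<noteq> \<chi> x" using set by auto
    from split_list_last_prop[OF this] obtain xs1 y xs2 where
      y: "ys = xs1 @ y # xs2" "\<phi> y \<noteq> \<chi> y" "\<forall>z\<in>set xs2. \<not> \<phi> z \<noteq> \<chi> z" by blast
    show ?thesis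
    proof (cases "\<phi> y < \<chi> y")
      case True
      then have "?e \<phi> = 0" using evalm_stack_eq(2)[OF ys \<chi>(1) y(1)] y(3) by simp
      then show ?thesis using Z(1) by simp
    next
      case False
      then have gt: "\<chi> y < \<phi> y" using y(2) by simp
      have e1: "rk \<chi> = rev (map \<phi> xs2) @ \<chi> y # rev (map \<chi> xs1)"
        unfolding rk_def y(1) using y(3) by simp
      have e2: "rk \<phi> = rev (map \<phi> xs2) @ \<phi> y # rev (map \<phi> xs1)"
        unfolding rk_def y(1) by simp
      have "rk \<chi> < rk \<phi>"
        unfolding e1 e2 list_less_def by (rule lexord_append_left_rightI) (use gt in simp)
      then have "rk \<phi> \<notin> rk ` ?B" using Max_ge[OF fin] \<chi>(3) by (metis leD)
      then have "c \<phi> \<in> Z" using \<phi> by blast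
      moreover have "?e \<phi> \<in> \<int>"
        using stackwise_down[of m ys "{\<phi>}"] by (intro evalm_down_int) auto
      ultimately show ?thesis by (rule Z(3))
    qed
  qed
  have Zadd: "a + b \<in> Z" if "a \<in> Z" "b \<in> Z" for a b
    using Z(2)[OF that(1) Z(2)[OF Z(1) that(2)]] by simp
  have Zsum: "(\<Sum>\<phi>\<in>A. f \<phi>) \<in> Z" if "\<And>\<phi>. \<phi> \<in> A \<Longrightarrow> f \<phi> \<in> Z" for A :: "('p \<Rightarrow> nat) set" and f
    using that by (induction A rule: infinite_finite_induct) (auto simp: Z(1) Zadd)
  have "(\<Sum>\<phi>\<in>?S. c \<phi> * ?e \<phi>) = c \<chi> * ?e \<chi> + (\<Sum>\<phi>\<in>?S - {\<chi>}. c \<phi> * ?e \<phi>)"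
    by (rule sum.remove[OF finite_bounded_mono_maps \<chi>(1)])
  then have ec: "c \<chi> = (\<Sum>\<phi>\<in>?S. c \<phi> * ?e \<phi>) - (\<Sum>\<phi>\<in>?S - {\<chi>}. c \<phi> * ?e \<phi>)"
    using evalm_stack_eq(1)[OF ys \<chi>(1)] by simp
  have 1: "(\<Sum>\<phi>\<in>?S. c \<phi> * ?e \<phi>) \<in> Z" using ev[OF \<chi>(1)] by (simp add: evalm_sum)
  have 2: "(\<Sum>\<phi>\<in>?S - {\<chi>}. c \<phi> * ?e \<phi>) \<in> Z" using termZ by (rule Zsum)
  have "c \<chi> \<in> Z" by (subst ec) (rule Z(2)[OF 1 2])
  then show False using \<chi>(2) by simp
qed

lemma stackwise_inj:
  assumes ys: "decreasing_linear_extension ys"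
  shows "inj_on (stackwise_vector \<kappa> m ys) (bounded_mono_maps m)"
proof (rule inj_onI, rule ccontr)
  fix \<phi> \<psi> :: "'p \<Rightarrow> nat"
  assume \<phi>: "\<phi> \<in> bounded_mono_maps m" and \<psi>: "\<psi> \<in> bounded_mono_maps m"
    and eq: "stackwise_vector \<kappa> m ys \<phi> = stackwise_vector \<kappa> m ys \<psi>" and "\<phi> \<noteq> \<psi>"
  have set: "set ys = UNIV" using ys by (simp add: flist_decreasing)
  obtain x where "\<phi> x \<noteq> \<psi> x" using \<open>\<phi> \<noteq> \<psi>\<close> by auto
  then have "\<exists>x\<in>set ys. \<phi> x \<noteq> \<psi> x" using set by auto
  from split_list_last_prop[OF this] obtain xs1 y xs2 where
    y: "ys = xs1 @ y # xs2" "\<phi> y \<noteq> \<psi> y" "\<forall>z\<in>set xs2. \<not> \<phi> z \<noteq> \<psi> z" by blast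
  then consider "\<phi> y < \<psi> y" | "\<psi> y < \<phi> y" by linarith
  then show False
  proof cases
    case 1
    then have "evalm m (chain_mset m \<psi>) (stackwise_vector \<kappa> m ys \<phi>) = 0"
      using evalm_stack_eq(2)[OF ys \<psi> y(1)] y(3) by simp
    then show False using evalm_stack_eq(1)[OF ys \<psi>] eq by simp
  next
    case 2
    then have "evalm m (chain_mset m \<phi>) (stackwise_vector \<kappa> m ys \<psi>) = 0"
      using evalm_stack_eq(2)[OF ys \<phi> y(1)] y(3) by simp
    then show False using evalm_stack_eq(1)[OF ys \<phi>] eq by simp
  qed
qed

lemma stackwise_independent:
  assumes ys: "decreasing_linear_extension ys"
  shows "pm.independent (stackwise_vector \<kappa> m ys ` bounded_mono_maps m)"
proof (rule pm.independent_if_scalars_zero)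
  let ?s = "stackwise_vector \<kappa> m ys" and ?S = "bounded_mono_maps m :: ('p \<Rightarrow> nat) set"
  show "finite (?s ` ?S)" using finite_bounded_mono_maps by simp
  fix f u assume f: "(\<Sum>x\<in>?s ` ?S. pscale (f x) x) = 0" and "u \<in> ?s ` ?S"
  then obtain \<psi> where \<psi>: "\<psi> \<in> ?S" "u = ?s \<psi>" by auto
  have 0: "(\<Sum>\<phi>\<in>?S. pscale (f (?s \<phi>)) (?s \<phi>)) = 0"
    using f by (simp add: sum.reindex[OF stackwise_inj[OF ys]])
  have "f (?s \<psi>) \<in> {0}"
    by (rule stack_coeffs[OF ys _ _ _ _ \<psi>(1), where c = "\<lambda>\<phi>. f (?s \<phi>)"]) (simp_all add: 0, simp add: evalm_def)
  then show "f u = 0" using \<psi>(2) by simp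
qed

lemma down_vector_expand:
  assumes ys: "decreasing_linear_extension ys" and v: "v \<in> down_vectors \<kappa> m"
  shows "\<exists>c :: ('p \<Rightarrow> nat) \<Rightarrow> int.
    v = (\<Sum>\<phi>\<in>bounded_mono_maps m. pscale (of_int (c \<phi>)) (stackwise_vector \<kappa> m ys \<phi>))"
proof -
  let ?s = "stackwise_vector \<kappa> m ys" and ?S = "bounded_mono_maps m :: ('p \<Rightarrow> nat) set"
  have "v \<in> pm.span (?s ` ?S)" using down_span(2)[OF ys] v pm.span_base by blast
  then obtain f where "v = (\<Sum>x\<in>?s ` ?S. pscale (f x) x)"
    using pm.span_finite[OF finite_imageI[OF finite_bounded_mono_maps]] by blast
  then have v': "v = (\<Sum>\<phi>\<in>?S. pscale (f (?s \<phi>)) (?s \<phi>))"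
    by (simp add: sum.reindex[OF stackwise_inj[OF ys]])
  have int: "f (?s \<psi>) \<in> \<int>" if "\<psi> \<in> ?S" for \<psi>
    by (rule stack_coeffs[OF ys _ _ _ _ that, where c = "\<lambda>\<phi>. f (?s \<phi>)"])
      (use evalm_down_int[OF v] v' in auto)
  define c where "c \<phi> = \<lfloor>Re (f (?s \<phi>))\<rfloor>" for \<phi>
  have "of_int (c \<psi>) = f (?s \<psi>)" if "\<psi> \<in> ?S" for \<psi>
    using int[OF that] by (elim Ints_cases) (simp add: c_def)
  then show ?thesis using v' by (intro exI[of _ c]) simp
qed

section \<open>Flags and multichains\<close>

lemma flag_of_bij:
  "bij_betw (flag_of m) (bounded_mono_maps m :: ('p \<Rightarrow> nat) set) (filter_flags m)"
  unfolding bij_betw_def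
proof (intro conjI inj_onI set_eqI iffI)
  fix \<phi> \<psi> :: "'p \<Rightarrow> nat"
  assume b: "\<phi> \<in> bounded_mono_maps m" "\<psi> \<in> bounded_mono_maps m" and eq: "flag_of m \<phi> = flag_of m \<psi>"
  have le: "k \<le> \<phi> y \<longleftrightarrow> k \<le> \<psi> y" if "k \<le> m" for k y
  proof (cases "k = 0")
    case False
    then have "k \<in> set [1..<m+1]" using that by auto
    then show ?thesis using eq unfolding flag_of_def map_eq_conv by blast
  qed simp
  show "\<phi> = \<psi>"
  proof
    fix y
    have "\<phi> y \<le> m" "\<psi> y \<le> m" using b by (auto simp: bounded_mono_maps_def)
    then show "\<phi> y = \<psi> y" using le[of "\<phi> y" y] le[of "\<psi> y" y] by simp
  qed
next
  fix Fs assume "Fs \<in> flag_of m ` (bounded_mono_maps m :: ('p \<Rightarrow> nat) set)"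
  then obtain \<phi> :: "'p \<Rightarrow> nat" where \<phi>: "mono \<phi>" "Fs = flag_of m \<phi>" by (auto simp: bounded_mono_maps_def)
  then show "Fs \<in> filter_flags m"
    by (auto simp: filter_flags_def flag_of_def order_filters_def sorted_wrt_iff_nth_less
        intro: order.trans dest: monoD simp del: upt_Suc)
next
  fix Fs :: "'p set list" assume "Fs \<in> filter_flags m"
  then have Fs: "length Fs = m" "set Fs \<subseteq> order_filters" "sorted_wrt (\<supseteq>) Fs"
    by (auto simp: filter_flags_def)
  \<comment> \<open>The inverse map: the filters decrease, so y belongs to the first \<phi> y of
    them and to no others.\<close>
  define \<phi> where "\<phi> y = card {i. i < m \<and> y \<in> Fs ! i}" for y
  have dec: "Fs ! j \<subseteq> Fs ! i" if "i \<le> j" "j < m" for i j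
    using Fs(1,3) that by (cases "i = j") (auto simp: sorted_wrt_iff_nth_less)
  have seg: "{i. i < m \<and> y \<in> Fs ! i} = {..<\<phi> y}" for y
  proof -
    define l where "l = (LEAST i. \<not> (i < m \<and> y \<in> Fs ! i))"
    have l: "\<not> (l < m \<and> y \<in> Fs ! l)" unfolding l_def by (rule LeastI[of _ m]) simp
    have "i < m \<and> y \<in> Fs ! i \<longleftrightarrow> i < l" for i
    proof
      assume i: "i < m \<and> y \<in> Fs ! i"
      show "i < l"
      proof (rule ccontr)
        assume "\<not> i < l"
        then show False using i l dec[of l i] by auto
      qed
    qed (use not_less_Least in \<open>auto simp: l_def\<close>)
    then have "{i. i < m \<and> y \<in> Fs ! i} = {..<l}" by auto
    then show ?thesis by (simp add: \<phi>_def)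
  qed
  \<comment> \<open>Position i of the list holds the filter with index i + 1, which accounts for the
    strict inequality.\<close>
  have mem: "y \<in> Fs ! i \<longleftrightarrow> i < \<phi> y" if "i < m" for i y
    using seg[of y] that by auto
  have "\<phi> x \<le> \<phi> y" if "x \<le> y" for x y
    unfolding \<phi>_def
  proof (rule card_mono)
    show "{i. i < m \<and> x \<in> Fs ! i} \<subseteq> {i. i < m \<and> y \<in> Fs ! i}"
      using Fs(1,2) that filterD nth_mem by blast
  qed simp
  moreover have "\<phi> y \<le> m" for y
    using card_mono[of "{..<m}" "{i. i < m \<and> y \<in> Fs ! i}"] by (auto simp: \<phi>_def)
  ultimately have "\<phi> \<in> bounded_mono_maps m" by (auto simp: bounded_mono_maps_def mono_def)
  moreover have "Fs = flag_of m \<phi>"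
    by (rule nth_equalityI) (auto simp: flag_of_def Fs(1) mem simp del: upt_Suc)
  ultimately show "Fs \<in> flag_of m ` bounded_mono_maps m" by blast
qed

text \<open>Complements turn a decreasing flag of filters into an increasing chain of ideals, and by
  \<open>weight_le_iff\<close> their weights increase accordingly.\<close>

lemma multichains_bij:
  assumes W: "W = iw ` order_ideals"
  shows "bij_betw (map (\<lambda>F. iw (- F)))
    (filter_flags m :: 'p set list set) (weight_multichains adj m W)"
proof -
  let ?g = "\<lambda>F. iw (- F)"
  have le: "weight_le adj (?g F) (?g F') \<longleftrightarrow> F' \<subseteq> F" if "F \<in> order_filters" "F' \<in> order_filters" for F F'
    using weight_le_iff[of "- F" "- F'"] that by (auto simp: ideal_compl_filter[symmetric])
  have inj: "inj_on ?g order_filters"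
  proof (rule inj_onI)
    fix F F' :: "'p set" assume "F \<in> order_filters" "F' \<in> order_filters" "?g F = ?g F'"
    then have "- F = - F'" by (intro ideal_weight_inj) (simp_all add: ideal_compl_filter)
    then show "F = F'" by simp
  qed
  have img: "?g ` order_filters = W"
  proof
    show "W \<subseteq> ?g ` order_filters"
    proof
      fix w assume "w \<in> W"
      then obtain I where "I \<in> order_ideals" "w = iw I" using W by auto
      then show "w \<in> ?g ` order_filters"
        by (intro image_eqI[of _ _ "- I"]) (simp_all add: ideal_compl_filter)
    qed
  qed (use W in \<open>auto simp: ideal_compl_filter\<close>)
  have sorted: "sorted_wrt (weight_le adj) (map ?g Fs) \<longleftrightarrow> sorted_wrt (\<supseteq>) Fs"
    if "set Fs \<subseteq> order_filters" for Fs
    unfolding sorted_wrt_map using that le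
    by (auto elim!: sorted_wrt_mono_rel[rotated] simp: subset_iff)
  show ?thesis
    unfolding bij_betw_def
  proof
    show "inj_on (map ?g) (filter_flags m)"
      by (rule inj_on_subset[OF inj_on_map_lists[OF inj]]) (auto simp: filter_flags_def)
    show "map ?g ` filter_flags m = weight_multichains adj m W"
    proof
      show "map ?g ` filter_flags m \<subseteq> weight_multichains adj m W"
        using sorted unfolding img[symmetric]
        by (auto simp: filter_flags_def weight_multichains_def intro!: imageI dest: subsetD)
      show "weight_multichains adj m W \<subseteq> map ?g ` filter_flags m"
      proof
        fix \<nu>s assume \<nu>s: "\<nu>s \<in> weight_multichains adj m W"
        then have "\<nu>s \<in> lists (?g ` order_filters)" unfolding img by (auto simp: weight_multichains_def)
        then obtain Fs where Fs: "\<nu>s = map ?g Fs" "set Fs \<subseteq> order_filters"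
          unfolding lists_image by auto
        then show "\<nu>s \<in> map ?g ` filter_flags m"
          using \<nu>s sorted[OF Fs(2)] by (auto simp: filter_flags_def weight_multichains_def)
      qed
    qed
  qed
qed

end

section \<open>The irreducible modules on ideals and multisets\<close>

lemma subspace_herm: "pm.subspace {u. herm w u v = 0}" "pm.subspace {v. herm w u v = 0}"
  by (auto simp: pm.subspace_def herm_add_left herm_scale_left herm_add_right herm_scale_right)

lemma ideal_module_simps [simp]:
  "car (ideal_module \<rho>) = ideal_space" "mscale (ideal_module \<rho>) = pscale" "act (ideal_module \<rho>) = \<rho>"
  by (simp_all add: ideal_module_def)

lemma down_module_simps [simp]:
  "car (down_module \<kappa> m \<rho>) = pm.span (down_vectors \<kappa> m)" "mscale (down_module \<kappa> m \<rho>) = pscale"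
  "act (down_module \<kappa> m \<rho>) = (\<lambda>z. sym_op (\<rho> z))"
  by (simp_all add: down_module_def)

text \<open>The whole symmetric algebra serves as ambient module, in which the downward span is
  recognized as a cyclic submodule.\<close>

definition sym_module :: "('g \<Rightarrow> ('b \<Rightarrow>\<^sub>0 complex) \<Rightarrow> ('b \<Rightarrow>\<^sub>0 complex)) \<Rightarrow> ('g, 'b multiset \<Rightarrow>\<^sub>0 complex) gmod" where
  "sym_module \<rho> = \<lparr>car = UNIV, mscale = pscale, act = (\<lambda>z. sym_op (\<rho> z))\<rparr>"

lemma sym_module_simps [simp]:
  "car (sym_module \<rho>) = UNIV" "mscale (sym_module \<rho>) = pscale" "act (sym_module \<rho>) = (\<lambda>z. sym_op (\<rho> z))"
  by (simp_all add: sym_module_def)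

context minuscule_poset
begin

lemma ideal_downward_induct [consumes 1, case_names top remove]:
  assumes I: "I \<in> order_ideals"
    and top: "P UNIV"
    and step: "\<And>I x. I \<in> order_ideals \<Longrightarrow> insert x I \<in> order_ideals \<Longrightarrow> x \<notin> I \<Longrightarrow>
      removable \<kappa> (\<kappa> x) (insert x I) x \<Longrightarrow> P (insert x I) \<Longrightarrow> P I"
  shows "P I"
  using I
proof (induction "card (- I)" arbitrary: I)
  case 0
  then have "I = UNIV" by auto
  then show ?case using top by simp
next
  case (Suc n)
  then obtain x0 where "x0 \<in> - I" by (metis card.empty ex_in_conv nat.distinct(1))
  from finite_minimal[OF this] obtain x where x: "x \<in> - I" and min: "\<forall>b\<in>- I. \<not> b < x" by blast
  have ad: "addable \<kappa> (\<kappa> x) I x" using x min by (auto simp: addable_def)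
  have I': "insert x I \<in> order_ideals" using addable_ideal[OF Suc.prems ad] .
  have "- insert x I = - I - {x}" by auto
  then have "n = card (- insert x I)" using Suc.hyps(2) x by simp
  then have "P (insert x I)" using Suc.hyps(1) I' by blast
  then show ?case using step[OF Suc.prems I'] x addable_removable[OF ad Suc.prems] by simp
qed

lemma UNIV_ideal: "UNIV \<in> order_ideals"
  by (simp add: order_ideals_def)

lemma ideal_weight_UNIV: "iw UNIV = fund_weight (\<kappa> t)"
  by (auto simp: ideal_weight_def ideal_mu_UNIV fund_weight_def)

lemma xo_UNIV: "xo a (bas UNIV) = 0"
  by (rule xo_bas_0) (simp add: addable_def)

lemma ho_UNIV: "ho a (bas UNIV) = pscale (fund_weight (\<kappa> t) a) (bas UNIV)"
  by (simp add: ho_bas[OF UNIV_ideal] ideal_mu_UNIV fund_weight_def)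

lemma lookup_ho: "I \<in> order_ideals \<Longrightarrow> lk (ho a v) I = of_int (mu a I) * lk v I"
proof -
  assume I: "I \<in> order_ideals"
  have "herm (\<lambda>_. 1) (ho a u) v = herm (\<lambda>_. 1) u (ho a v)" for u v
    by (rule herm_adjointI[OF plin_ops(3,3)])
      (auto simp: ho_def herm_scale_left herm_scale_right herm_bas_left lookup_pscale lookup_single when_def)
  from this[of v "bas I"] show ?thesis
    using I by (simp add: ho_bas herm_scale_right herm_bas_right)
qed

lemma ideal_module_irrep:
  assumes G: "cartan_lie_algebra adj G"
  shows "highest_weight_irrep G (ideal_module (ideal_rep G)) (fund_weight (\<kappa> t))"
proof -
  let ?M = "ideal_module (ideal_rep G)"
  note r = ideal_rep_simps[OF G]
  have v: "bas UNIV \<in> (ideal_space :: ('p set \<Rightarrow>\<^sub>0 complex) set)"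
    by (simp add: ideal_space_def UNIV_ideal)
  interpret M: highest_weight_module adj G ?M "bas UNIV" "fund_weight (\<kappa> t)"
    by unfold_locales
      (use G lie_module_ideal[OF G] v sum_cartan_list_nonzero in \<open>simp_all add: r xo_UNIV ho_UNIV\<close>)
  have "bas I \<in> M.gen" if "I \<in> order_ideals" for I
    using that
  proof (induction rule: ideal_downward_induct)
    case top
    show ?case using M.yword_gen[of "[]"] by simp
  next
    case (remove I x)
    have "yo (\<kappa> x) (bas (insert x I)) \<in> M.gen" using M.gen_y[OF remove.IH, of "\<kappa> x"] by (simp add: r)
    then show ?case using yo_bas[OF remove(2,4)] remove(3) by simp
  qed
  then have "ideal_space \<subseteq> M.gen"
    using M.subspace_gen unfolding ideal_space_eq_span by (intro pm.span_minimal) auto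
  then have cyclic: "car ?M = M.gen" using M.gen_car by auto
  have nz: "bas (UNIV :: 'p set) \<noteq> 0" by (metis lookup_single_eq lookup_zero zero_neq_one)
  have "irreducible_module G ?M"
    by (rule M.irreducible_by_form[OF cyclic nz, where B = "herm (\<lambda>_. 1)"])
      (auto simp: r subspace_herm herm_yo herm_xo intro: herm_definite[of "\<lambda>_. 1"] simp del: One_nat_def)
  then show ?thesis
    unfolding highest_weight_irrep_def using nz v by (auto simp: r xo_UNIV ho_UNIV)
qed

section \<open>Weights of the ideal module and the Weyl orbit\<close>

lemma weights_ideal_module:
  assumes G: "cartan_lie_algebra adj G"
  shows "weights G (ideal_module (ideal_rep G)) = iw ` order_ideals"
proof
  note r = ideal_rep_simps[OF G]
  show "weights G (ideal_module (ideal_rep G)) \<subseteq> iw ` order_ideals"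
  proof
    fix \<nu> assume "\<nu> \<in> weights G (ideal_module (ideal_rep G))"
    then obtain v where v: "v \<in> ideal_space" "v \<noteq> 0" "\<And>a. ho a v = pscale (\<nu> a) v"
      by (auto simp: weights_def r)
    obtain I where I: "I \<in> Poly_Mapping.keys v" using v(2) by (metis ex_in_conv keys_eq_empty)
    then have "I \<in> order_ideals" "lk v I \<noteq> 0" using v(1) by (auto simp: ideal_space_def in_keys_iff)
    moreover have "\<nu> a = of_int (mu a I)" for a
      using arg_cong[OF v(3)[of a], of "\<lambda>u. lk u I"] lookup_ho[OF \<open>I \<in> order_ideals\<close>] \<open>lk v I \<noteq> 0\<close>
      by (simp add: lookup_pscale)
    then have "\<nu> = iw I" by (auto simp: ideal_weight_def)
    ultimately show "\<nu> \<in> iw ` order_ideals" by blast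
  qed
  show "iw ` order_ideals \<subseteq> weights G (ideal_module (ideal_rep G))"
  proof
    fix \<nu> assume "\<nu> \<in> iw ` (order_ideals :: 'p set set)"
    then obtain I where I: "I \<in> order_ideals" "\<nu> = iw I" by auto
    have "bas I \<noteq> 0" by (metis lookup_single_eq lookup_zero zero_neq_one)
    moreover have "bas I \<in> ideal_space" using I by (simp add: ideal_space_def)
    ultimately show "\<nu> \<in> weights G (ideal_module (ideal_rep G))"
      using I by (auto simp: weights_def r ho_bas ideal_weight_def intro!: bexI[of _ "bas I"])
  qed
qed

text \<open>By \<open>ideal_mu_eq\<close> the coordinate at k is 1, -1 or 0, so the reflection
  subtracts the simple root, adds it, or does nothing.\<close>

lemma reflect_ideal_weight:
  assumes "I \<in> order_ideals"
  shows "removable \<kappa> k I x \<Longrightarrow>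
      simple_reflection adj k (iw I) = iw (I - {x})"
    and "addable \<kappa> k I x \<Longrightarrow>
      simple_reflection adj k (iw I) = iw (insert x I)"
    and "\<not> (\<exists>x. removable \<kappa> k I x) \<Longrightarrow> \<not> (\<exists>x. addable \<kappa> k I x) \<Longrightarrow>
      simple_reflection adj k (iw I) = iw I"
proof -
  note mu = ideal_mu_eq[OF assms, of k]
  {
    assume x: "removable \<kappa> k I x"
    then have "\<not> (\<exists>x. addable \<kappa> k I x)" using not_removable_addable[OF x _ assms] by blast
    then have "mu k I = 1" using mu x by auto
    moreover have "mu i (I - {x}) = mu i I - cartan adj i k" for i
      using mu_insert[of x "I - {x}" i] x by (auto simp: removable_def insert_absorb)
    ultimately show "simple_reflection adj k (iw I) = iw (I - {x})"
      by (auto simp: simple_reflection_def ideal_weight_def simple_root_def)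
  next
    assume x: "addable \<kappa> k I x"
    then have "\<not> (\<exists>x. removable \<kappa> k I x)" using not_removable_addable[OF _ x assms] by blast
    then have "mu k I = -1" using mu x by auto
    moreover have "mu i (insert x I) = mu i I + cartan adj i k" for i
      using mu_insert[of x I i] x by (simp add: addable_def)
    ultimately show "simple_reflection adj k (iw I) = iw (insert x I)"
      by (auto simp: simple_reflection_def ideal_weight_def simple_root_def)
  next
    assume "\<not> (\<exists>x. removable \<kappa> k I x)" "\<not> (\<exists>x. addable \<kappa> k I x)"
    then have "mu k I = 0" using mu by simp
    then show "simple_reflection adj k (iw I) = iw I"
      by (auto simp: simple_reflection_def ideal_weight_def)
  }
qed

lemma weyl_orbit: "{w (fund_weight (\<kappa> t)) |w. w \<in> weyl_group adj} = iw ` order_ideals"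
proof
  let ?W = "iw ` (order_ideals :: 'p set set)"
  have "w (fund_weight (\<kappa> t)) \<in> ?W" if "w \<in> weyl_group adj" for w
    using that
  proof (induction rule: weyl_group.induct)
    case 1
    show ?case using UNIV_ideal by (auto simp: ideal_weight_UNIV[symmetric])
  next
    case (2 w k)
    then obtain I where I: "I \<in> order_ideals" "w (fund_weight (\<kappa> t)) = iw I" by auto
    consider x where "removable \<kappa> k I x" | x where "addable \<kappa> k I x"
      | "\<not> (\<exists>x. removable \<kappa> k I x)" "\<not> (\<exists>x. addable \<kappa> k I x)" by blast
    then show ?case
    proof cases
      case (1 x)
      then show ?thesis using reflect_ideal_weight(1)[OF I(1) 1] removable_ideal[OF I(1) 1] I(2) by simp
    next
      case (2 x)
      then show ?thesis using reflect_ideal_weight(2)[OF I(1) 2] addable_ideal[OF I(1) 2] I(2) by simp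
    next
      case 3
      then show ?thesis using reflect_ideal_weight(3)[OF I(1) 3] I by simp
    qed
  qed
  then show "{w (fund_weight (\<kappa> t)) |w. w \<in> weyl_group adj} \<subseteq> ?W" by auto
  have "\<exists>w\<in>weyl_group adj. iw I = w (fund_weight (\<kappa> t))" if "I \<in> order_ideals" for I
    using that
  proof (induction rule: ideal_downward_induct)
    case top
    show ?case using weyl_group.intros(1) by (intro bexI[of _ id]) (simp_all add: ideal_weight_UNIV)
  next
    case (remove I x)
    then obtain w where w: "w \<in> weyl_group adj"
      "iw (insert x I) = w (fund_weight (\<kappa> t))" by blast
    have "insert x I - {x} = I" using remove(3) by auto
    then have "iw I = simple_reflection adj (\<kappa> x) (w (fund_weight (\<kappa> t)))"
      using reflect_ideal_weight(1)[OF remove(2,4)] w(2) by simp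
    then show ?case using weyl_group.intros(2)[OF w(1), of "\<kappa> x"] by (intro bexI[of _ "simple_reflection adj (\<kappa> x) \<circ> w"]) simp_all
  qed
  then show "?W \<subseteq> {w (fund_weight (\<kappa> t)) |w. w \<in> weyl_group adj}" by blast
qed

text \<open>Uniqueness identifies L with the ideal module, whose weights form the orbit computed in
  \<open>weyl_orbit\<close>.\<close>

lemma minuscule_weight_irrep:
  fixes L :: "('g::ab_group_add, 'v::ab_group_add) gmod"
  assumes G: "cartan_lie_algebra adj G" and L: "highest_weight_irrep G L (fund_weight (\<kappa> t))"
  shows "minuscule_weight adj G L (fund_weight (\<kappa> t))"
    and "weights G L = iw ` order_ideals"
proof -
  let ?M = "ideal_module (ideal_rep G) :: ('g, 'p set \<Rightarrow>\<^sub>0 complex) gmod"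
  have "module_iso L ?M"
    by (rule highest_weight_irrep_unique[OF G sum_cartan_list_nonzero L ideal_module_irrep[OF G]])
  then have "weights G L = weights G ?M"
    using L lie_module_ideal[OF G]
    by (intro weights_module_iso) (simp_all add: highest_weight_irrep_def irreducible_module_def)
  then show w: "weights G L = iw ` order_ideals"
    using weights_ideal_module[OF G] by simp
  have "\<forall>a. fund_weight (\<kappa> t) a \<in> \<nat>" "\<exists>a. fund_weight (\<kappa> t) a \<noteq> 0"
    by (auto simp: fund_weight_def)
  then show "minuscule_weight adj G L (fund_weight (\<kappa> t))"
    unfolding minuscule_weight_def w weyl_orbit using L by blast
qed

section \<open>The downward span as a highest weight module\<close>

lemma Xa_topv: "Xa b (topv m) = 0"
proof (induction m)
  case 0
  show ?case unfolding topv_def replicate_mset_0 by (rule sym_op_empty)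
next
  case (Suc m)
  then show ?case by (simp add: topv_Suc sym_op_mult sym_op_gen xo_UNIV plin_zero[OF plin_emb])
qed

lemma Ha_topv: "sym_op (ho a) (topv m) = pscale (of_nat m * fund_weight (\<kappa> t) a) (topv m)"
proof (induction m)
  case 0
  show ?case unfolding topv_def replicate_mset_0 sym_op_empty by simp
next
  case (Suc m)
  have "sym_op (ho a) (bas {#UNIV#}) = pscale (fund_weight (\<kappa> t) a) (bas {#UNIV#})"
    by (simp add: sym_op_gen ho_UNIV plin_scale[OF plin_emb])
  then show ?case
    unfolding topv_Suc sym_op_mult Suc
    by (simp add: pscale_mult_left pscale_mult_right distrib_right flip: pm.scale_left_distrib)
qed

lemma topv_nonzero: "topv m \<noteq> 0"
  unfolding topv_def by (metis lookup_single_eq lookup_zero zero_neq_one)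

lemma lie_module_sym:
  assumes G: "cartan_lie_algebra adj G"
  shows "lie_module G (sym_module (ideal_rep G))"
  by (simp add: lie_module_def pm.vector_space_axioms ideal_rep_simps(4-6)[OF G] plin_add[OF plin_sym_op]
      plin_scale[OF plin_sym_op] sym_op_add sym_op_scale sym_op_commutator plin_ideal_rep)

text \<open>The downward span is the submodule generated by {P,...,P}: words in the lowering
  operators stay in the cell of P, which is stable under all of them, and conversely downward
  vectors are multiples of such words. The form for which raising and lowering are adjoint then
  gives irreducibility.\<close>

lemma down_module_irrep:
  fixes ys :: "'p list"
  assumes G: "cartan_lie_algebra adj G" and ys: "decreasing_linear_extension ys"
  shows "highest_weight_irrep G (down_module \<kappa> m (ideal_rep G)) (\<lambda>a. of_nat m * fund_weight (\<kappa> t) a)"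
proof -
  let ?\<mu> = "\<lambda>a. of_nat m * fund_weight (\<kappa> t) a"
  let ?M = "down_module \<kappa> m (ideal_rep G)"
  note r = ideal_rep_simps[OF G]
  interpret S: highest_weight_module adj G "sym_module (ideal_rep G)" "topv m" ?\<mu>
    by unfold_locales
      (use G lie_module_sym[OF G] sum_cartan_list_nonzero in \<open>simp_all add: r Xa_topv Ha_topv\<close>)
  have sp: "module.span (mscale (sym_module (ideal_rep G))) = pm.span"
    "module.subspace (mscale (sym_module (ideal_rep G))) = pm.subspace" by simp_all
  have Sgen_y: "Ya b u \<in> S.gen" if "u \<in> S.gen" for b u
    using S.gen_y[OF that, of b] by (simp add: r)
  have Ssub: "pm.subspace S.gen" using S.subspace_gen by simp
  have "S.yword as (topv m) \<in> cell m UNIV" for as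
  proof (induction as)
    case Nil
    have "topv m \<in> down_vectors \<kappa> m"
      unfolding down_vectors_def by (rule range_eqI[of _ _ "[]"]) (simp add: down_vector_Ya)
    then show ?case using down_span(1)[OF ys, of m] pm.span_base by auto
  next
    case (Cons a as)
    have "Ya a (S.yword as (topv m)) \<in> cell m UNIV"
      by (rule cell_stable[OF _ _ Cons]) (simp_all add: order_filters_def)
    then show ?case by (simp add: r)
  qed
  then have 1: "S.gen \<subseteq> cell m UNIV"
    unfolding S.gen_def sp by (intro pm.span_minimal subspace_cell) auto
  have pow: "dpow (Ya b) k u \<in> S.gen" if "u \<in> S.gen" for b k u
  proof -
    have "(Ya b ^^ k) u \<in> S.gen" using that by (induction k) (simp_all add: Sgen_y)
    then show ?thesis unfolding dpow_def by (rule pm.subspace_scale[OF Ssub])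
  qed
  have "fold (\<lambda>(b, k). dpow (Ya b) k) bs u \<in> S.gen" if "u \<in> S.gen" for bs u
    using that by (induction bs arbitrary: u) (auto simp: pow)
  moreover have "topv m \<in> S.gen" using S.yword_gen[of "[]"] by simp
  ultimately have "down_vectors \<kappa> m \<subseteq> S.gen" by (auto simp: down_vectors_def down_vector_Ya)
  then have 2: "pm.span (down_vectors \<kappa> m) \<subseteq> S.gen" by (rule pm.span_minimal[OF _ Ssub])
  have car: "pm.span (down_vectors \<kappa> m) = S.gen" using 1 2 down_span(1)[OF ys, of m] by blast
  have lM: "lie_module G ?M"
  proof -
    have "sym_op (ideal_rep G z) u \<in> S.gen" if "u \<in> S.gen" for z u
      using S.gen_act[OF that, of z] by simp
    then show ?thesis
      using lie_module_sym[OF G] Ssub by (simp add: lie_module_def car)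
  qed
  have topM: "topv m \<in> car ?M" using S.yword_gen[of "[]"] by (simp add: car)
  interpret M: highest_weight_module adj G ?M "topv m" ?\<mu>
    by unfold_locales
      (use G lM topM sum_cartan_list_nonzero in \<open>simp_all add: r Xa_topv Ha_topv\<close>)
  have "M.yword as u = S.yword as u" for as u by (induction as) simp_all
  then have "M.gen = S.gen" by (simp add: M.gen_def S.gen_def)
  then have cyclic: "car ?M = M.gen" by (simp add: car)
  have "irreducible_module G ?M"
    by (rule M.irreducible_by_form[OF cyclic topv_nonzero, where B = "herm fact_weight"])
      (use sym_op_adjoint[OF plin_ops(1,2) herm_yo] sym_op_adjoint[OF plin_ops(2,1) herm_xo] in
        \<open>auto simp: r subspace_herm intro: herm_definite[OF fact_weight_pos]\<close>)
  then show ?thesis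
    unfolding highest_weight_irrep_def using topM by (auto simp: r Xa_topv Ha_topv topv_nonzero intro!: bexI[of _ "topv m"])
qed

end

theorem theorem9p5:
  fixes adj :: "'c::finite \<Rightarrow> 'c \<Rightarrow> bool"
    and \<kappa> :: "'p::{finite, order} \<Rightarrow> 'c"
    and G :: "('c, 'g::ab_group_add) chev_alg"
    and m :: nat
    and t :: 'p
    and lam :: "'c \<Rightarrow> complex"
    and ys :: "'p list"
  assumes "simple_graph adj"
    and "colored_minuscule adj \<kappa>"
    and "connected_poset TYPE('p)"
    and "cartan_lie_algebra adj G"
    and "m \<ge> 1"
    and t_maximal: "\<forall>x. \<not> t < x"
    and lam_def: "lam = fund_weight (\<kappa> t)"
    and "decreasing_linear_extension ys"
  shows
    "(\<forall>L :: ('g, 'v::ab_group_add) gmod.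
        highest_weight_irrep G L lam \<longrightarrow>
          minuscule_weight adj G L lam \<and>
          bij_betw (map (\<lambda>F. ideal_weight adj \<kappa> (\<kappa> t) (- F)))
            (filter_flags m :: 'p set list set) (weight_multichains adj m (weights G L))) \<and>
     (\<exists>\<rho>. ideal_action adj \<kappa> (\<kappa> t) G \<rho> \<and>
          minuscule_weight adj G (ideal_module \<rho>) lam \<and>
          highest_weight_irrep G (down_module \<kappa> m \<rho>) (\<lambda>a. of_nat m * lam a) \<and>
          (\<forall>M :: ('g, 'w::ab_group_add) gmod.
             highest_weight_irrep G M (\<lambda>a. of_nat m * lam a) \<longrightarrow>
               module_iso (down_module \<kappa> m \<rho>) M)) \<and>
     stackwise_vector \<kappa> m ys ` bounded_mono_maps m \<subseteq> down_vectors \<kappa> m \<and>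
     pm.independent (stackwise_vector \<kappa> m ys ` bounded_mono_maps m) \<and>
     pm.span (stackwise_vector \<kappa> m ys ` bounded_mono_maps m) = pm.span (down_vectors \<kappa> m) \<and>
     inj_on (stackwise_vector \<kappa> m ys) (bounded_mono_maps m) \<and>
     bij_betw (flag_of m) (bounded_mono_maps m :: ('p \<Rightarrow> nat) set) (filter_flags m) \<and>
     (\<forall>v\<in>down_vectors \<kappa> m. \<exists>c :: ('p \<Rightarrow> nat) \<Rightarrow> int.
        v = (\<Sum>\<phi>\<in>bounded_mono_maps m. pscale (of_int (c \<phi>)) (stackwise_vector \<kappa> m ys \<phi>)))"
proof -
  interpret minuscule_poset adj \<kappa> t
    using assms(1-3) t_maximal by unfold_locales
  note G = assms(4) and ys = assms(8)
  have L: "minuscule_weight adj G L lam \<and>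
      bij_betw (map (\<lambda>F. ideal_weight adj \<kappa> (\<kappa> t) (- F)))
        (filter_flags m :: 'p set list set) (weight_multichains adj m (weights G L))"
    if "highest_weight_irrep G L lam" for L :: "('g, 'v) gmod"
    using minuscule_weight_irrep[OF G that[unfolded lam_def]] multichains_bij unfolding lam_def by blast
  have minuscule: "minuscule_weight adj G (ideal_module (ideal_rep G)) lam"
    unfolding lam_def by (rule minuscule_weight_irrep(1)[OF G ideal_module_irrep[OF G]])
  have irrep: "highest_weight_irrep G (down_module \<kappa> m (ideal_rep G)) (\<lambda>a. of_nat m * lam a)"
    unfolding lam_def by (rule down_module_irrep[OF G ys])
  have iso: "module_iso (down_module \<kappa> m (ideal_rep G)) M"
    if "highest_weight_irrep G M (\<lambda>a. of_nat m * lam a)" for M :: "('g, 'w) gmod"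
    by (rule highest_weight_irrep_unique[OF G sum_cartan_list_nonzero irrep that])
  have rep: "\<exists>\<rho>. ideal_action adj \<kappa> (\<kappa> t) G \<rho> \<and>
          minuscule_weight adj G (ideal_module \<rho>) lam \<and>
          highest_weight_irrep G (down_module \<kappa> m \<rho>) (\<lambda>a. of_nat m * lam a) \<and>
          (\<forall>M :: ('g, 'w) gmod.
             highest_weight_irrep G M (\<lambda>a. of_nat m * lam a) \<longrightarrow>
               module_iso (down_module \<kappa> m \<rho>) M)"
    by (intro exI[of _ "ideal_rep G"] conjI allI impI iso ideal_action_ideal_rep[OF G] minuscule irrep)
  show ?thesis
    by (intro conjI allI impI ballI L rep stackwise_down stackwise_independent[OF ys]
        down_span(2)[OF ys] stackwise_inj[OF ys] flag_of_bij down_vector_expand[OF ys])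
      (use L in simp_all)
qed

end
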